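(* Let $P$ be a Poisson manifold with Poisson bivector field $\eta$, equipped with a torsion free connection $\nabla$ on $TP$, and let $TP$ carry the Poisson structure $\{\,,\}_{TP}$ dual to the Lie algebroid $T^*P$. Let $\pi:TP\to P$ be a smooth map and $f,g$ smooth functions on $P$. For $x\in P$ and $v\in T_xP$, $$\{\pi^*f,\pi^*g\}_{TP}(v)=\big\langle(\partial_1\pi(v)\otimes\partial_1\pi(v))(\mathfrak D\eta(v))+2(\partial_1\pi(v)\otimes\partial_2\pi(v))(\eta(x)),\ \mathrm d_{\pi(v)}f\wedge\mathrm d_{\pi(v)}g\big\rangle.$$ In particular, $\pi$ is Poisson if and only if for all $x\in P$ and $v\in T_xP$ $$\tfrac12(\partial_1\pi(v)\odot\partial_1\pi(v))(\mathfrak D\eta(v))+(\partial_1\pi(v)\odot\partial_2\pi(v))(\eta(x))=\eta(\pi(v)).$$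
   Context: The bivector field $\eta$ is also viewed as the anchor $T^*P\to TP$ of the Lie algebroid $T^*P$, with $\beta(\eta(\alpha))=\eta(\alpha,\beta)$; on closed 1-forms the algebroid bracket is $[\alpha,\beta]=\mathrm d(\eta(\alpha,\beta))$. With $p:TP\to P$ the projection and $\widetilde\alpha(v)=\alpha(v)$ for a 1-form $\alpha$, the Poisson structure on $TP$ is determined by $\{\widetilde\alpha,\widetilde\beta\}_{TP}(v)=[\alpha,\beta](v)$, $\{\widetilde\alpha,p^*f\}_{TP}(v)=\eta(\alpha(x))\cdot f$ for $v\in T_xP$, and $\{p^*f,p^*g\}_{TP}=0$, for closed 1-forms $\alpha,\beta$ and functions $f,g$ on $P$. The connection splits $T_v(TP)$ ($v\in T_xP$) into a horizontal space, identified with $T_xP$ by $p_*$, and a vertical space $\ker p_*$, identified with $T_xP$ by $u\mapsto\frac{\mathrm d}{\mathrm dt}|_{t=0}(v+tu)$. For a smooth map $\pi:TP\to P$, $\partial_1\pi(v),\partial_2\pi(v):T_xP\to T_{\pi(v)}P$ are respectively the restrictions of $\pi_*$ to the vertical and horizontal spaces at $v$. $\mathfrak D\eta:TP\to\bigwedge^2TP$ is the vertical component of the differential of $\eta:P\to\bigwedge^2TP$, i.e. $\mathfrak D\eta(v)=\nabla_v\eta$. Conventions: bivectors are regarded as skew elements of $TP\otimes TP$; for a 2-tensor $T$, $\langle T,\alpha\wedge\beta\rangle=\frac12(T(\alpha,\beta)-T(\beta,\alpha))$, so $\langle\eta,\alpha\wedge\beta\rangle=\eta(\alpha,\beta)$;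 for linear maps $a,b$, $a\odot b=a\otimes b+b\otimes a$. A map $\pi$ is Poisson if $\{\pi^*f,\pi^*g\}_{TP}=\pi^*\{f,g\}_P$ for all $f,g$, where $\{f,g\}_P=\eta(\mathrm df,\mathrm dg)$. *)

theory Defs
  imports "HOL-Analysis.Analysis"
begin

section \<open>Smooth maps between vector spaces\<close>

text \<open>
  \<open>C_diff k f S\<close> says that \<open>f\<close> is of class \<open>C\<^sup>k\<close> on the open set \<open>S\<close>.  The recursion goes through
  directional derivatives; it is meant for finite-dimensional domains.
\<close>

fun C_diff :: "nat \<Rightarrow> ('a::real_normed_vector \<Rightarrow> 'b::real_normed_vector) \<Rightarrow> 'a set \<Rightarrow> bool" where
  "C_diff 0 f S \<longleftrightarrow> continuous_on S f"
| "C_diff (Suc k) f S \<longleftrightarrow>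
     (\<forall>x\<in>S. f differentiable (at x)) \<and> (\<forall>v. C_diff k (\<lambda>x. frechet_derivative f (at x) v) S)"

definition smooth_on :: "'a set \<Rightarrow> ('a::real_normed_vector \<Rightarrow> 'b::real_normed_vector) \<Rightarrow> bool" where
  "smooth_on S f \<longleftrightarrow> (\<forall>k. C_diff k f S)"


section \<open>Smooth manifolds\<close>

text \<open>
  A chart is a pair \<open>(U, \<phi>)\<close>; only the values of \<open>\<phi>\<close> on \<open>U\<close> matter.  A manifold is given by an
  atlas \<open>A\<close>: its points are the points covered by the charts, and its topology is the one that makes
  all charts homeomorphisms onto open sets.
\<close>

type_synonym ('p, 'e) chart = "'p set \<times> ('p \<Rightarrow> 'e)"

definition chart_inv :: "('p, 'e) chart \<Rightarrow> 'e \<Rightarrow> 'p" where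
  "chart_inv c = inv_into (fst c) (snd c)"

definition chart_range :: "('p, 'e) chart \<Rightarrow> 'e set" where
  "chart_range c = snd c ` fst c"

definition points :: "('p, 'e) chart set \<Rightarrow> 'p set" where
  "points A = (\<Union>c\<in>A. fst c)"

definition smooth_atlas :: "('p, 'e::real_normed_vector) chart set \<Rightarrow> bool" where
  "smooth_atlas A \<longleftrightarrow>
     (\<forall>c\<in>A. inj_on (snd c) (fst c) \<and> open (chart_range c)) \<and>
     (\<forall>c\<in>A. \<forall>d\<in>A. open (snd c ` (fst c \<inter> fst d)) \<and>
        smooth_on (snd c ` (fst c \<inter> fst d)) (snd d \<circ> chart_inv c))"

definition atlas_topology :: "('p, 'e::real_normed_vector) chart set \<Rightarrow> 'p topology" where
  "atlas_topology A =
     topology (\<lambda>W. W \<subseteq> points A \<and> (\<forall>c\<in>A. open (snd c ` (W \<inter> fst c))))"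

lemma openin_atlas_topology:
  assumes "smooth_atlas A"
  shows "openin (atlas_topology A) W \<longleftrightarrow>
    W \<subseteq> points A \<and> (\<forall>c\<in>A. open (snd c ` (W \<inter> fst c)))"
proof -
  have "istopology (\<lambda>W. W \<subseteq> points A \<and> (\<forall>c\<in>A. open (snd c ` (W \<inter> fst c))))"
    unfolding istopology_def
  proof (intro conjI allI impI ballI)
    fix S T c
    assume S: "S \<subseteq> points A \<and> (\<forall>c\<in>A. open (snd c ` (S \<inter> fst c)))"
      and T: "T \<subseteq> points A \<and> (\<forall>c\<in>A. open (snd c ` (T \<inter> fst c)))" and c: "c \<in> A"
    have "inj_on (snd c) (fst c)"
      using assms c by (auto simp: smooth_atlas_def)
    then have "snd c ` (S \<inter> T \<inter> fst c) = snd c ` (S \<inter> fst c) \<inter> snd c ` (T \<inter> fst c)"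
      by (auto simp: inj_on_def image_iff)
    then show "open (snd c ` (S \<inter> T \<inter> fst c))"
      using S T c by auto
  next
    fix K c
    assume K: "\<forall>W\<in>K. W \<subseteq> points A \<and> (\<forall>c\<in>A. open (snd c ` (W \<inter> fst c)))" and c: "c \<in> A"
    have "snd c ` (\<Union>K \<inter> fst c) = (\<Union>W\<in>K. snd c ` (W \<inter> fst c))"
      by auto
    then show "open (snd c ` (\<Union>K \<inter> fst c))"
      using K c by auto
  qed auto
  then show ?thesis
    by (simp add: atlas_topology_def topology_inverse')
qed

text \<open>
  The model space \<open>'e\<close> is an arbitrary finite-dimensional inner product space; its inner product
  plays no role.  The class \<open>real_inner\<close> is used instead of \<open>euclidean_space\<close> because the
  latter excludes dimension 0.
\<close>

definition smooth_manifold :: "('p, 'e::real_inner) chart set \<Rightarrow> bool" where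
  "smooth_manifold A \<longleftrightarrow>
     (\<exists>B. finite B \<and> span B = (UNIV :: 'e set)) \<and>
     smooth_atlas A \<and>
     Hausdorff_space (atlas_topology A) \<and>
     (\<exists>\<B>. countable \<B> \<and> (\<forall>V\<in>\<B>. openin (atlas_topology A) V) \<and>
        (\<forall>W. openin (atlas_topology A) W \<longrightarrow> (\<forall>x\<in>W. \<exists>V\<in>\<B>. x \<in> V \<and> V \<subseteq> W)))"

definition smooth_function :: "('p, 'e::real_normed_vector) chart set \<Rightarrow> ('p \<Rightarrow> real) \<Rightarrow> bool" where
  "smooth_function A f \<longleftrightarrow> (\<forall>c\<in>A. smooth_on (chart_range c) (f \<circ> chart_inv c))"

definition smooth_map ::
  "('p, 'e::real_normed_vector) chart set \<Rightarrow> ('q, 'f::real_normed_vector) chart set \<Rightarrow> ('p \<Rightarrow> 'q) \<Rightarrow> bool" where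
  "smooth_map A B F \<longleftrightarrow>
     continuous_map (atlas_topology A) (atlas_topology B) F \<and>
     (\<forall>c\<in>A. \<forall>d\<in>B. smooth_on (snd c ` (fst c \<inter> F -` fst d)) (snd d \<circ> F \<circ> chart_inv c))"


section \<open>Tangent vectors, tangent maps and tensor fields\<close>

text \<open>
  A preferred chart \<open>chart_at A x\<close> is chosen around each point \<open>x\<close>, and the tangent space at \<open>x\<close>
  is represented by the model space \<open>'e\<close> by means of this chart.  Then covectors at \<open>x\<close> are
  elements of \<open>'e \<Rightarrow>\<^sub>L real\<close>, and 2-tensors at \<open>x\<close>, i.e. elements of the tensor square of the
  tangent space, are bilinear forms on covectors.  The components with respect to another chart \<open>c\<close>
  are obtained with the Jacobian of the change of charts, see \<open>coord_change\<close>.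
\<close>

definition chart_at :: "('p, 'e) chart set \<Rightarrow> 'p \<Rightarrow> ('p, 'e) chart" where
  "chart_at A x = (SOME c. c \<in> A \<and> x \<in> fst c)"

type_synonym 'e tensor2 = "('e \<Rightarrow>\<^sub>L real) \<Rightarrow>\<^sub>L ('e \<Rightarrow>\<^sub>L real) \<Rightarrow>\<^sub>L real"

definition coord_change ::
  "('p, 'e::real_normed_vector) chart \<Rightarrow> ('p, 'e) chart \<Rightarrow> 'p \<Rightarrow> 'e \<Rightarrow>\<^sub>L 'e" where
  "coord_change c d x = Blinfun (frechet_derivative (snd d \<circ> chart_inv c) (at (snd c x)))"

definition tangent_map ::
  "('p, 'e::real_normed_vector) chart set \<Rightarrow> ('q, 'f::real_normed_vector) chart set \<Rightarrow>
     ('p \<Rightarrow> 'q) \<Rightarrow> 'p \<Rightarrow> 'e \<Rightarrow>\<^sub>L 'f" where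
  "tangent_map A B F x =
     Blinfun (frechet_derivative (snd (chart_at B (F x)) \<circ> F \<circ> chart_inv (chart_at A x))
       (at (snd (chart_at A x) x)))"

definition dif :: "('p, 'e::real_normed_vector) chart set \<Rightarrow> ('p \<Rightarrow> real) \<Rightarrow> 'p \<Rightarrow> 'e \<Rightarrow>\<^sub>L real" where
  "dif A f x = Blinfun (frechet_derivative (f \<circ> chart_inv (chart_at A x)) (at (snd (chart_at A x) x)))"

definition velocity :: "('p, 'e::real_normed_vector) chart set \<Rightarrow> (real \<Rightarrow> 'p) \<Rightarrow> real \<Rightarrow> 'e" where
  "velocity A \<gamma> t = vector_derivative (\<lambda>s. snd (chart_at A (\<gamma> t)) (\<gamma> s)) (at t)"

text \<open>\<open>tensor_map a b\<close> is \<open>a \<otimes> b\<close> acting on 2-tensors, and \<open>sym_tensor_map a b\<close> is \<open>a \<odot> b\<close>.\<close>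

definition tensor_map ::
  "('e::real_normed_vector \<Rightarrow>\<^sub>L 'f::real_normed_vector) \<Rightarrow> ('e \<Rightarrow>\<^sub>L 'f) \<Rightarrow> 'e tensor2 \<Rightarrow> 'f tensor2" where
  "tensor_map a b T = Blinfun (\<lambda>\<alpha>. Blinfun (\<lambda>\<beta>. T (\<alpha> o\<^sub>L a) (\<beta> o\<^sub>L b)))"

lemma tensor_map_apply:
  fixes a b :: "'e::real_normed_vector \<Rightarrow>\<^sub>L 'f::real_normed_vector"
  shows "tensor_map a b T \<alpha> \<beta> = T (\<alpha> o\<^sub>L a) (\<beta> o\<^sub>L b)"
proof -
  have 1: "bounded_linear (\<lambda>\<beta>::'f \<Rightarrow>\<^sub>L real. T \<alpha>' (\<beta> o\<^sub>L b))" for \<alpha>'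
    by (intro bounded_linear_intros)
  have 2: "Blinfun (\<lambda>\<beta>. T \<alpha>' (\<beta> o\<^sub>L b)) = T \<alpha>' o\<^sub>L Blinfun (\<lambda>\<beta>. \<beta> o\<^sub>L b)" for \<alpha>'
  proof -
    have "bounded_linear (\<lambda>\<beta>::'f \<Rightarrow>\<^sub>L real. \<beta> o\<^sub>L b)"
      by (intro bounded_linear_intros)
    then show ?thesis
      by (intro blinfun_eqI) (simp add: bounded_linear_Blinfun_apply 1)
  qed
  have "bounded_linear (\<lambda>\<alpha>. T (\<alpha> o\<^sub>L a) o\<^sub>L Blinfun (\<lambda>\<beta>. \<beta> o\<^sub>L b))"
    by (intro bounded_linear_intros)
  then show ?thesis
    unfolding tensor_map_def 2 by (simp add: bounded_linear_Blinfun_apply 1 2[symmetric])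
qed

definition sym_tensor_map ::
  "('e::real_normed_vector \<Rightarrow>\<^sub>L 'f::real_normed_vector) \<Rightarrow> ('e \<Rightarrow>\<^sub>L 'f) \<Rightarrow> 'e tensor2 \<Rightarrow> 'f tensor2" where
  "sym_tensor_map a b T = tensor_map a b T + tensor_map b a T"

definition wedge_pairing ::
  "('e::real_normed_vector) tensor2 \<Rightarrow> ('e \<Rightarrow>\<^sub>L real) \<Rightarrow> ('e \<Rightarrow>\<^sub>L real) \<Rightarrow> real" where
  "wedge_pairing T \<alpha> \<beta> = (T \<alpha> \<beta> - T \<beta> \<alpha>) / 2"

text \<open>Components of fields with respect to a chart \<open>c\<close>, as functions on the range of \<open>c\<close>.\<close>

definition vf_in ::
  "('p, 'e::real_normed_vector) chart set \<Rightarrow> ('p, 'e) chart \<Rightarrow> ('p \<Rightarrow> 'e) \<Rightarrow> 'e \<Rightarrow> 'e" where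
  "vf_in A c Y z = (let x = chart_inv c z in coord_change (chart_at A x) c x (Y x))"

definition form_in ::
  "('p, 'e::real_normed_vector) chart set \<Rightarrow> ('p, 'e) chart \<Rightarrow> ('p \<Rightarrow> 'e \<Rightarrow>\<^sub>L real) \<Rightarrow> 'e \<Rightarrow> 'e \<Rightarrow>\<^sub>L real" where
  "form_in A c \<alpha> z = (let x = chart_inv c z in \<alpha> x o\<^sub>L coord_change c (chart_at A x) x)"

definition endo_in ::
  "('p, 'e::real_normed_vector) chart set \<Rightarrow> ('p, 'e) chart \<Rightarrow> ('p \<Rightarrow> 'e \<Rightarrow>\<^sub>L 'e) \<Rightarrow> 'e \<Rightarrow> 'e \<Rightarrow>\<^sub>L 'e" where
  "endo_in A c L z = (let x = chart_inv c z in
     coord_change (chart_at A x) c x o\<^sub>L L x o\<^sub>L coord_change c (chart_at A x) x)"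

definition tensor_in ::
  "('p, 'e::real_normed_vector) chart set \<Rightarrow> ('p, 'e) chart \<Rightarrow> ('p \<Rightarrow> 'e tensor2) \<Rightarrow> 'e \<Rightarrow> 'e tensor2" where
  "tensor_in A c \<eta> z = (let x = chart_inv c z; J = coord_change (chart_at A x) c x in tensor_map J J (\<eta> x))"

definition smooth_vf :: "('p, 'e::real_normed_vector) chart set \<Rightarrow> ('p \<Rightarrow> 'e) \<Rightarrow> bool" where
  "smooth_vf A Y \<longleftrightarrow> (\<forall>c\<in>A. smooth_on (chart_range c) (vf_in A c Y))"

definition smooth_form :: "('p, 'e::real_normed_vector) chart set \<Rightarrow> ('p \<Rightarrow> 'e \<Rightarrow>\<^sub>L real) \<Rightarrow> bool" where
  "smooth_form A \<alpha> \<longleftrightarrow> (\<forall>c\<in>A. smooth_on (chart_range c) (form_in A c \<alpha>))"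

definition smooth_endo :: "('p, 'e::real_normed_vector) chart set \<Rightarrow> ('p \<Rightarrow> 'e \<Rightarrow>\<^sub>L 'e) \<Rightarrow> bool" where
  "smooth_endo A L \<longleftrightarrow> (\<forall>c\<in>A. smooth_on (chart_range c) (endo_in A c L))"

definition smooth_tensor :: "('p, 'e::real_normed_vector) chart set \<Rightarrow> ('p \<Rightarrow> 'e tensor2) \<Rightarrow> bool" where
  "smooth_tensor A \<eta> \<longleftrightarrow> (\<forall>c\<in>A. smooth_on (chart_range c) (tensor_in A c \<eta>))"

text \<open>
  The Lie bracket of vector fields and the exterior derivative of a 1-form at \<open>x\<close>, computed in the
  preferred chart at \<open>x\<close>.
\<close>

definition lie_bracket ::
  "('p, 'e::real_normed_vector) chart set \<Rightarrow> ('p \<Rightarrow> 'e) \<Rightarrow> ('p \<Rightarrow> 'e) \<Rightarrow> 'p \<Rightarrow> 'e" where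
  "lie_bracket A X Y x = (let c = chart_at A x in
     frechet_derivative (vf_in A c Y) (at (snd c x)) (X x) -
     frechet_derivative (vf_in A c X) (at (snd c x)) (Y x))"

definition ext_derivative ::
  "('p, 'e::real_normed_vector) chart set \<Rightarrow> ('p \<Rightarrow> 'e \<Rightarrow>\<^sub>L real) \<Rightarrow> 'p \<Rightarrow> 'e \<Rightarrow> 'e \<Rightarrow> real" where
  "ext_derivative A \<alpha> x u w = (let c = chart_at A x in
     frechet_derivative (form_in A c \<alpha>) (at (snd c x)) u w -
     frechet_derivative (form_in A c \<alpha>) (at (snd c x)) w u)"

definition closed_form :: "('p, 'e::real_normed_vector) chart set \<Rightarrow> ('p \<Rightarrow> 'e \<Rightarrow>\<^sub>L real) \<Rightarrow> bool" where
  "closed_form A \<alpha> \<longleftrightarrow> smooth_form A \<alpha> \<and> (\<forall>x\<in>points A. \<forall>u w. ext_derivative A \<alpha> x u w = 0)"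


section \<open>Poisson structures\<close>

definition bracket ::
  "('p, 'e::real_normed_vector) chart set \<Rightarrow> ('p \<Rightarrow> 'e tensor2) \<Rightarrow> ('p \<Rightarrow> real) \<Rightarrow> ('p \<Rightarrow> real) \<Rightarrow> 'p \<Rightarrow> real" where
  "bracket A \<eta> f g x = \<eta> x (dif A f x) (dif A g x)"

definition poisson_bivector :: "('p, 'e::real_normed_vector) chart set \<Rightarrow> ('p \<Rightarrow> 'e tensor2) \<Rightarrow> bool" where
  "poisson_bivector A \<eta> \<longleftrightarrow>
     smooth_tensor A \<eta> \<and>
     (\<forall>x\<in>points A. \<forall>\<alpha> \<beta>. \<eta> x \<alpha> \<beta> = - \<eta> x \<beta> \<alpha>) \<and>
     (\<forall>f g h. smooth_function A f \<longrightarrow> smooth_function A g \<longrightarrow> smooth_function A h \<longrightarrow>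
        (\<forall>x\<in>points A.
           bracket A \<eta> f (bracket A \<eta> g h) x +
           bracket A \<eta> g (bracket A \<eta> h f) x +
           bracket A \<eta> h (bracket A \<eta> f g) x = 0))"

definition poisson_map ::
  "('p, 'e::real_normed_vector) chart set \<Rightarrow> ('p \<Rightarrow> 'e tensor2) \<Rightarrow>
   ('q, 'f::real_normed_vector) chart set \<Rightarrow> ('q \<Rightarrow> 'f tensor2) \<Rightarrow> ('p \<Rightarrow> 'q) \<Rightarrow> bool" where
  "poisson_map A \<Lambda> B \<eta> F \<longleftrightarrow>
     (\<forall>f g. smooth_function B f \<longrightarrow> smooth_function B g \<longrightarrow>
        (\<forall>v\<in>points A. bracket A \<Lambda> (f \<circ> F) (g \<circ> F) v = bracket B \<eta> f g (F v)))"


section \<open>The tangent bundle and its Poisson structure\<close>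

text \<open>A point of the tangent bundle is a pair \<open>(x, w)\<close> with \<open>w\<close> in the tangent space at \<open>x\<close>.\<close>

definition tangent_chart ::
  "('p, 'e::real_normed_vector) chart set \<Rightarrow> ('p, 'e) chart \<Rightarrow> ('p \<times> 'e, 'e \<times> 'e) chart" where
  "tangent_chart A c = (fst c \<times> UNIV, \<lambda>(x, w). (snd c x, coord_change (chart_at A x) c x w))"

definition tangent_atlas ::
  "('p, 'e::real_normed_vector) chart set \<Rightarrow> ('p \<times> 'e, 'e \<times> 'e) chart set" where
  "tangent_atlas A = tangent_chart A ` A"

definition fibre_linear :: "('p \<Rightarrow> 'e::real_normed_vector \<Rightarrow>\<^sub>L real) \<Rightarrow> 'p \<times> 'e \<Rightarrow> real" where
  "fibre_linear \<alpha> v = \<alpha> (fst v) (snd v)"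

text \<open>
  The bracket of closed 1-forms in the Lie algebroid \<open>T\<^sup>*P\<close> defined by \<open>\<eta>\<close>.
\<close>

definition form_bracket ::
  "('p, 'e::real_normed_vector) chart set \<Rightarrow> ('p \<Rightarrow> 'e tensor2) \<Rightarrow>
     ('p \<Rightarrow> 'e \<Rightarrow>\<^sub>L real) \<Rightarrow> ('p \<Rightarrow> 'e \<Rightarrow>\<^sub>L real) \<Rightarrow> 'p \<Rightarrow> 'e \<Rightarrow>\<^sub>L real" where
  "form_bracket A \<eta> \<alpha> \<beta> = dif A (\<lambda>y. \<eta> y (\<alpha> y) (\<beta> y))"

text \<open>
  The anchor sends a covector \<open>\<alpha>\<close> to the tangent vector \<open>\<eta>(\<alpha>)\<close> with \<open>\<beta>(\<eta>(\<alpha>)) = \<eta>(\<alpha>, \<beta>)\<close> for all \<open>\<beta>\<close>.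
\<close>

definition anchor :: "('e::real_normed_vector) tensor2 \<Rightarrow> ('e \<Rightarrow>\<^sub>L real) \<Rightarrow> 'e" where
  "anchor T \<alpha> = (THE u. \<forall>\<beta>. blinfun_apply \<beta> u = T \<alpha> \<beta>)"

definition dual_poisson_structure ::
  "('p, 'e::real_inner) chart set \<Rightarrow> ('p \<Rightarrow> 'e tensor2) \<Rightarrow> ('p \<times> 'e \<Rightarrow> ('e \<times> 'e) tensor2) \<Rightarrow> bool" where
  "dual_poisson_structure A \<eta> \<Lambda> \<longleftrightarrow>
     poisson_bivector (tangent_atlas A) \<Lambda> \<and>
     (\<forall>\<alpha> \<beta>. closed_form A \<alpha> \<longrightarrow> closed_form A \<beta> \<longrightarrow>
        (\<forall>v\<in>points (tangent_atlas A).
           bracket (tangent_atlas A) \<Lambda> (fibre_linear \<alpha>) (fibre_linear \<beta>) v =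
           fibre_linear (form_bracket A \<eta> \<alpha> \<beta>) v)) \<and>
     (\<forall>\<alpha> f. closed_form A \<alpha> \<longrightarrow> smooth_function A f \<longrightarrow>
        (\<forall>v\<in>points (tangent_atlas A).
           bracket (tangent_atlas A) \<Lambda> (fibre_linear \<alpha>) (f \<circ> fst) v =
           dif A f (fst v) (anchor (\<eta> (fst v)) (\<alpha> (fst v))))) \<and>
     (\<forall>f g. smooth_function A f \<longrightarrow> smooth_function A g \<longrightarrow>
        (\<forall>v\<in>points (tangent_atlas A).
           bracket (tangent_atlas A) \<Lambda> (f \<circ> fst) (g \<circ> fst) v = 0))"


section \<open>Connections\<close>

text \<open>
  A connection on the tangent bundle sends a vector field \<open>Y\<close> to a section \<open>nabla Y\<close> of
  \<open>End(TP)\<close>, where \<open>nabla Y x u\<close> is the derivative of \<open>Y\<close> in the direction of the tangent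
  vector \<open>u\<close> at \<open>x\<close>.
\<close>

definition connection ::
  "('p, 'e::real_normed_vector) chart set \<Rightarrow> (('p \<Rightarrow> 'e) \<Rightarrow> 'p \<Rightarrow> 'e \<Rightarrow>\<^sub>L 'e) \<Rightarrow> bool" where
  "connection A nabla \<longleftrightarrow>
     (\<forall>Y. smooth_vf A Y \<longrightarrow> smooth_endo A (nabla Y)) \<and>
     (\<forall>Y Z. smooth_vf A Y \<longrightarrow> smooth_vf A Z \<longrightarrow>
        (\<forall>x\<in>points A. nabla (\<lambda>y. Y y + Z y) x = nabla Y x + nabla Z x)) \<and>
     (\<forall>f Y. smooth_function A f \<longrightarrow> smooth_vf A Y \<longrightarrow>
        (\<forall>x\<in>points A. \<forall>u. nabla (\<lambda>y. f y *\<^sub>R Y y) x u =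
           dif A f x u *\<^sub>R Y x + f x *\<^sub>R nabla Y x u))"

definition torsion_free ::
  "('p, 'e::real_normed_vector) chart set \<Rightarrow> (('p \<Rightarrow> 'e) \<Rightarrow> 'p \<Rightarrow> 'e \<Rightarrow>\<^sub>L 'e) \<Rightarrow> bool" where
  "torsion_free A nabla \<longleftrightarrow>
     (\<forall>X Y. smooth_vf A X \<longrightarrow> smooth_vf A Y \<longrightarrow>
        (\<forall>x\<in>points A. nabla Y x (X x) - nabla X x (Y x) = lie_bracket A X Y x))"

text \<open>
  The induced covariant derivatives of 1-forms and of 2-tensors at \<open>x\<close> in the direction \<open>u\<close> are
  determined by the Leibniz rule.
\<close>

definition nabla_form ::
  "('p, 'e::real_normed_vector) chart set \<Rightarrow> (('p \<Rightarrow> 'e) \<Rightarrow> 'p \<Rightarrow> 'e \<Rightarrow>\<^sub>L 'e) \<Rightarrow>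
     ('p \<Rightarrow> 'e \<Rightarrow>\<^sub>L real) \<Rightarrow> 'p \<Rightarrow> 'e \<Rightarrow> 'e \<Rightarrow>\<^sub>L real" where
  "nabla_form A nabla \<alpha> x u = (THE \<theta>. \<forall>Y. smooth_vf A Y \<longrightarrow>
     dif A (\<lambda>y. \<alpha> y (Y y)) x u = blinfun_apply \<theta> (Y x) + \<alpha> x (nabla Y x u))"

definition nabla_tensor ::
  "('p, 'e::real_normed_vector) chart set \<Rightarrow> (('p \<Rightarrow> 'e) \<Rightarrow> 'p \<Rightarrow> 'e \<Rightarrow>\<^sub>L 'e) \<Rightarrow>
     ('p \<Rightarrow> 'e tensor2) \<Rightarrow> 'p \<Rightarrow> 'e \<Rightarrow> 'e tensor2" where
  "nabla_tensor A nabla \<eta> x u = (THE T. \<forall>\<alpha> \<beta>. smooth_form A \<alpha> \<longrightarrow> smooth_form A \<beta> \<longrightarrow>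
     dif A (\<lambda>y. \<eta> y (\<alpha> y) (\<beta> y)) x u =
       blinfun_apply (blinfun_apply T (\<alpha> x)) (\<beta> x) + \<eta> x (nabla_form A nabla \<alpha> x u) (\<beta> x) + \<eta> x (\<alpha> x) (nabla_form A nabla \<beta> x u))"

definition D_eta ::
  "('p, 'e::real_normed_vector) chart set \<Rightarrow> (('p \<Rightarrow> 'e) \<Rightarrow> 'p \<Rightarrow> 'e \<Rightarrow>\<^sub>L 'e) \<Rightarrow>
     ('p \<Rightarrow> 'e tensor2) \<Rightarrow> 'p \<times> 'e \<Rightarrow> 'e tensor2" where
  "D_eta A nabla \<eta> v = nabla_tensor A nabla \<eta> (fst v) (snd v)"

text \<open>
  The tangent space at a point \<open>v\<close> of the tangent bundle is represented by \<open>'e \<times> 'e\<close> by means of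
  \<open>chart_at (tangent_atlas A) v\<close>.  The two factors are \<^emph>\<open>not\<close> the horizontal and the vertical space.
  A tangent vector at \<open>v\<close> is horizontal if it is the image of some \<open>u\<close> under the differential of a
  vector field \<open>Y\<close> through \<open>v\<close>, seen as a section, with vanishing derivative in the direction \<open>u\<close>.
\<close>

definition horizontal_space ::
  "('p, 'e::real_normed_vector) chart set \<Rightarrow> (('p \<Rightarrow> 'e) \<Rightarrow> 'p \<Rightarrow> 'e \<Rightarrow>\<^sub>L 'e) \<Rightarrow>
     'p \<times> 'e \<Rightarrow> ('e \<times> 'e) set" where
  "horizontal_space A nabla v =
     {tangent_map A (tangent_atlas A) (\<lambda>y. (y, Y y)) (fst v) u | Y u.
        smooth_vf A Y \<and> Y (fst v) = snd v \<and> nabla Y (fst v) u = 0}"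

definition horizontal_lift ::
  "('p, 'e::real_normed_vector) chart set \<Rightarrow> (('p \<Rightarrow> 'e) \<Rightarrow> 'p \<Rightarrow> 'e \<Rightarrow>\<^sub>L 'e) \<Rightarrow>
     'p \<times> 'e \<Rightarrow> 'e \<Rightarrow> 'e \<times> 'e" where
  "horizontal_lift A nabla v u =
     (THE h. h \<in> horizontal_space A nabla v \<and> tangent_map (tangent_atlas A) A fst v h = u)"

definition vertical_lift ::
  "('p, 'e::real_normed_vector) chart set \<Rightarrow> 'p \<times> 'e \<Rightarrow> 'e \<Rightarrow> 'e \<times> 'e" where
  "vertical_lift A v u = velocity (tangent_atlas A) (\<lambda>t. (fst v, snd v + t *\<^sub>R u)) 0"

definition partial1 ::
  "('p, 'e::real_normed_vector) chart set \<Rightarrow> ('p \<times> 'e \<Rightarrow> 'p) \<Rightarrow> 'p \<times> 'e \<Rightarrow> 'e \<Rightarrow>\<^sub>L 'e" where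
  "partial1 A \<pi> v = Blinfun (\<lambda>u. tangent_map (tangent_atlas A) A \<pi> v (vertical_lift A v u))"

definition partial2 ::
  "('p, 'e::real_normed_vector) chart set \<Rightarrow> (('p \<Rightarrow> 'e) \<Rightarrow> 'p \<Rightarrow> 'e \<Rightarrow>\<^sub>L 'e) \<Rightarrow>
     ('p \<times> 'e \<Rightarrow> 'p) \<Rightarrow> 'p \<times> 'e \<Rightarrow> 'e \<Rightarrow>\<^sub>L 'e" where
  "partial2 A nabla \<pi> v = Blinfun (\<lambda>u. tangent_map (tangent_atlas A) A \<pi> v (horizontal_lift A nabla v u))"

end

theory Submission
  imports Defs
begin

text \<open>
  The cotangent space of \<open>TP\<close> at \<open>v \<in> T\<^sub>xP\<close> is spanned by the differentials of \<open>\<alpha>~\<close> for exact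
  1-forms \<open>\<alpha> = dk\<close> and of \<open>p\<^sup>*h\<close>.  On vertical lifts of \<open>u\<close> these differentials are \<open>\<alpha>(u)\<close> and
  \<open>0\<close>; on horizontal lifts they are \<open>(\<nabla>\<^sub>u\<alpha>)(v)\<close> and \<open>dh(u)\<close>, where
  \<open>(\<nabla>\<^sub>u\<alpha>)(v) = (\<nabla>\<^sub>v\<alpha>)(u)\<close> because \<open>\<alpha>\<close> is closed and \<open>\<nabla>\<close> is torsion free.  So if the
  differential of \<open>\<pi>\<^sup>*f\<close> at \<open>v\<close> is \<open>d(\<alpha>~) + d(p\<^sup>*h)\<close>, then \<open>\<alpha> = df \<circ> \<partial>\<^sub>1\<pi>\<close> and
  \<open>\<nabla>\<^sub>v\<alpha> + dh = df \<circ> \<partial>\<^sub>2\<pi>\<close>, and the formula follows from the Leibniz rule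
  \<open>d(\<eta>(\<alpha>, \<beta>))(v) = (\<nabla>\<^sub>v\<eta>)(\<alpha>, \<beta>) + \<eta>(\<nabla>\<^sub>v\<alpha>, \<beta>) + \<eta>(\<alpha>, \<nabla>\<^sub>v\<beta>)\<close>.
\<close>

section \<open>Calculus of smooth maps\<close>

text \<open>The connection, \<open>\<Lambda>\<close> and the induced covariant derivatives are
  specified only through global fields, forms and functions, while the claim is pointwise. Cut-off
  functions bridge the gap: every covector at a point is the differential of a global function, and
  every functional that is linear over the smooth functions depends only on the value at the point.
  Existence and uniqueness of this kind give \<open>nabla_form\<close>, \<open>nabla_tensor\<close>
  and \<open>horizontal_lift\<close>, all defined by \<open>THE\<close>, their values. Exact forms
  serve as test forms because they are closed, so that \<open>\<Lambda>\<close> is prescribed on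
  them, and still realise every covector. The second obstacle is that \<open>chart_at\<close> may
  jump from point to point, and the chart chosen at a point of \<open>TP\<close> need not come from
  the one chosen at its base point. Tangent vectors of \<open>TP\<close> are therefore compared by
  testing them against the two families of differentials, not by coordinates, and no Christoffel
  symbols appear. The factor 2 of the first formula and the symmetrisation in the second both encode
  the mixed terms in which one of df, dg is composed with the first partial derivative and the other
  with the second.\<close>

lemma frechet_derivative_eq:
  "(f has_derivative f') (at x) \<Longrightarrow> frechet_derivative f (at x) = f'"
  by (rule frechet_derivative_at[symmetric])

text \<open>On an open set the derivative at a point sees only values inside the set, so both
  clauses of the recursion transfer.\<close>

lemma C_diff_cong:
  assumes "open S" "\<And>x. x \<in> S \<Longrightarrow> f x = g x"
  shows "C_diff k f S \<longleftrightarrow> C_diff k g S"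
  using assms(2)
proof (induction k arbitrary: f g)
  case 0
  then show ?case by (simp cong: continuous_on_cong)
next
  case (Suc k)
  have *: "(f has_derivative D) (at x) \<longleftrightarrow> (g has_derivative D) (at x)" if "x \<in> S" for x D
    using has_derivative_transform_within_open[OF _ assms(1) that, of f D UNIV g]
      has_derivative_transform_within_open[OF _ assms(1) that, of g D UNIV f] Suc.prems by auto
  have d: "f differentiable (at x) \<longleftrightarrow> g differentiable (at x)" if "x \<in> S" for x
    using *[OF that] by (auto simp: differentiable_def)
  have e: "frechet_derivative f (at x) = frechet_derivative g (at x)" if "x \<in> S" for x
    using *[OF that] by (simp add: frechet_derivative_def)
  have "C_diff k (\<lambda>x. frechet_derivative f (at x) v) S \<longleftrightarrow>
        C_diff k (\<lambda>x. frechet_derivative g (at x) v) S" for v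
    by (rule Suc.IH) (simp add: e)
  then show ?case using d by simp
qed

lemma C_diff_subset: "C_diff k f S \<Longrightarrow> T \<subseteq> S \<Longrightarrow> C_diff k f T"
  by (induction k arbitrary: f) (auto intro: continuous_on_subset)

text \<open>The recursion for \<open>Suc k\<close> does not mention order \<open>k\<close> of the
  function itself, so lowering the order takes an induction; its base is that differentiability
  implies continuity.\<close>

lemma C_diff_Suc_D: "C_diff (Suc k) f S \<Longrightarrow> C_diff k f S"
proof (induction k arbitrary: f)
  case 0
  then show ?case
    by (auto intro!: differentiable_imp_continuous_on differentiable_at_imp_differentiable_on)
next
  case (Suc k)
  have "\<forall>x\<in>S. f differentiable (at x)" "\<And>v. C_diff (Suc k) (\<lambda>x. frechet_derivative f (at x) v) S"
    using C_diff.simps(2)[of "Suc k" f S] Suc.prems by blast+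
  then show ?case by (subst C_diff.simps(2)) (blast intro: Suc.IH)
qed

lemma C_diff_has_derivative:
  "C_diff (Suc k) f S \<Longrightarrow> x \<in> S \<Longrightarrow> (f has_derivative frechet_derivative f (at x)) (at x)"
  by (rule iffD1[OF frechet_derivative_works]) simp

text \<open>Trades \<open>frechet_derivative\<close> for an explicit derivative formula; all closure
  properties below go through this rule.\<close>

lemma C_diff_Suc_I:
  assumes "open S" "\<And>x. x \<in> S \<Longrightarrow> (f has_derivative f' x) (at x)"
    "\<And>v. C_diff k (\<lambda>x. f' x v) S"
  shows "C_diff (Suc k) f S"
proof -
  have "C_diff k (\<lambda>x. frechet_derivative f (at x) v) S" for v
    using assms(3)[of v] C_diff_cong[OF assms(1), of "\<lambda>x. frechet_derivative f (at x) v" "\<lambda>x. f' x v"]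
    by (simp add: frechet_derivative_eq[OF assms(2)])
  then show ?thesis using assms(2) by (auto simp: differentiable_def)
qed

lemma C_diff_Un:
  "open S \<Longrightarrow> open T \<Longrightarrow> C_diff k f S \<Longrightarrow> C_diff k f T \<Longrightarrow> C_diff k f (S \<union> T)"
  by (induction k arbitrary: f) (auto intro: continuous_on_open_Un)

lemma C_diff_const: "C_diff k (\<lambda>x. c) S"
  by (induction k arbitrary: c) auto

lemma C_diff_bounded_linear:
  assumes "bounded_linear L" "open S" "C_diff k f S"
  shows "C_diff k (\<lambda>x. L (f x)) S"
  using assms(3)
proof (induction k arbitrary: f)
  case 0
  then show ?case by (simp add: bounded_linear.continuous_on[OF assms(1)])
next
  case (Suc k)
  show ?case
  proof (rule C_diff_Suc_I[OF assms(2)])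
    show "((\<lambda>x. L (f x)) has_derivative (\<lambda>v. L (frechet_derivative f (at x) v))) (at x)" if "x \<in> S" for x
      using Suc.prems that
      by (intro bounded_linear.has_derivative[OF assms(1)] C_diff_has_derivative)
    show "C_diff k (\<lambda>x. L (frechet_derivative f (at x) v)) S" for v
      using Suc by auto
  qed
qed

lemma C_diff_ident: "C_diff k (\<lambda>x. x) S"
  by (cases k) (simp_all add: C_diff_const frechet_derivative_ident)

lemma C_diff_add:
  assumes "open S" "C_diff k f S" "C_diff k g S"
  shows "C_diff k (\<lambda>x. f x + g x) S"
  using assms(2,3)
proof (induction k arbitrary: f g)
  case 0
  then show ?case by (simp add: continuous_on_add)
next
  case (Suc k)
  show ?case
  proof (rule C_diff_Suc_I[OF assms(1)])
    show "((\<lambda>x. f x + g x) has_derivative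
        (\<lambda>v. frechet_derivative f (at x) v + frechet_derivative g (at x) v)) (at x)" if "x \<in> S" for x
      using Suc.prems that
      by (intro has_derivative_add C_diff_has_derivative)
    show "C_diff k (\<lambda>x. frechet_derivative f (at x) v + frechet_derivative g (at x) v) S" for v
      using Suc by auto
  qed
qed

text \<open>The product rule keeps one undifferentiated factor in each summand, which is why
  \<open>C_diff_Suc_D\<close> is applied before the induction hypothesis.\<close>

lemma C_diff_bilinear:
  assumes "bounded_bilinear p" "open S" "C_diff k f S" "C_diff k g S"
  shows "C_diff k (\<lambda>x. p (f x) (g x)) S"
  using assms(3,4)
proof (induction k arbitrary: f g)
  case 0
  then show ?case by (simp add: bounded_bilinear.continuous_on[OF assms(1)])
next
  case (Suc k)
  show ?case
  proof (rule C_diff_Suc_I[OF assms(2)])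
    show "((\<lambda>x. p (f x) (g x)) has_derivative
        (\<lambda>v. p (f x) (frechet_derivative g (at x) v) + p (frechet_derivative f (at x) v) (g x))) (at x)"
      if "x \<in> S" for x
      using Suc.prems that
      by (intro bounded_bilinear.FDERIV[OF assms(1)] C_diff_has_derivative)
    show "C_diff k (\<lambda>x. p (f x) (frechet_derivative g (at x) v) + p (frechet_derivative f (at x) v) (g x)) S" for v
      using Suc.prems C_diff_Suc_D[OF Suc.prems(1)] C_diff_Suc_D[OF Suc.prems(2)]
      by (intro C_diff_add Suc.IH assms(2)) auto
  qed
qed

section \<open>Closure properties of smooth maps\<close>

lemma smooth_on_C_diff: "smooth_on S f \<Longrightarrow> C_diff k f S"
  by (simp add: smooth_on_def)

lemma smooth_on_cong:
  "open S \<Longrightarrow> (\<And>x. x \<in> S \<Longrightarrow> f x = g x) \<Longrightarrow> smooth_on S f \<longleftrightarrow> smooth_on S g"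
  unfolding smooth_on_def using C_diff_cong[of S f g] by auto

lemma smooth_on_transform:
  "smooth_on S f \<Longrightarrow> open S \<Longrightarrow> (\<And>x. x \<in> S \<Longrightarrow> f x = g x) \<Longrightarrow> smooth_on S g"
  using smooth_on_cong[of S f g] by simp

lemma smooth_on_subset: "smooth_on S f \<Longrightarrow> T \<subseteq> S \<Longrightarrow> smooth_on T f"
  unfolding smooth_on_def using C_diff_subset by blast

lemma smooth_on_Un: "open S \<Longrightarrow> open T \<Longrightarrow> smooth_on S f \<Longrightarrow> smooth_on T f \<Longrightarrow> smooth_on (S \<union> T) f"
  by (simp add: smooth_on_def C_diff_Un)

lemma smooth_on_const: "smooth_on S (\<lambda>x. c)"
  by (simp add: smooth_on_def C_diff_const)

lemma smooth_on_ident: "smooth_on S (\<lambda>x. x)"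
  by (simp add: smooth_on_def C_diff_ident)

lemma smooth_on_bounded_linear:
  "bounded_linear L \<Longrightarrow> open S \<Longrightarrow> smooth_on S f \<Longrightarrow> smooth_on S (\<lambda>x. L (f x))"
  by (simp add: smooth_on_def C_diff_bounded_linear)

lemma smooth_on_add:
  "open S \<Longrightarrow> smooth_on S f \<Longrightarrow> smooth_on S g \<Longrightarrow> smooth_on S (\<lambda>x. f x + g x)"
  by (simp add: smooth_on_def C_diff_add)

lemma smooth_on_sum:
  "open S \<Longrightarrow> (\<And>i. i \<in> I \<Longrightarrow> smooth_on S (f i)) \<Longrightarrow> smooth_on S (\<lambda>x. \<Sum>i\<in>I. f i x)"
  by (induction I rule: infinite_finite_induct) (auto intro: smooth_on_const smooth_on_add)

lemma smooth_on_bilinear: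
  "bounded_bilinear p \<Longrightarrow> open S \<Longrightarrow> smooth_on S f \<Longrightarrow> smooth_on S g \<Longrightarrow> smooth_on S (\<lambda>x. p (f x) (g x))"
  by (simp add: smooth_on_def C_diff_bilinear)

lemmas smooth_on_scaleR = smooth_on_bilinear[OF bounded_bilinear_scaleR]
lemmas smooth_on_mult = smooth_on_bilinear[OF bounded_bilinear_mult]
lemmas smooth_on_inner = smooth_on_bilinear[OF bounded_bilinear_inner]
lemmas smooth_on_blinfun_apply = smooth_on_bilinear[OF bounded_bilinear_blinfun_apply]

lemma smooth_on_differentiable: "smooth_on S f \<Longrightarrow> x \<in> S \<Longrightarrow> f differentiable (at x)"
  using smooth_on_C_diff[of S f 1] by simp

lemma smooth_on_has_derivative:
  "smooth_on S f \<Longrightarrow> x \<in> S \<Longrightarrow> (f has_derivative frechet_derivative f (at x)) (at x)"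
  by (rule C_diff_has_derivative[OF smooth_on_C_diff])

lemma smooth_on_frechet_derivative:
  "smooth_on S f \<Longrightarrow> smooth_on S (\<lambda>x. frechet_derivative f (at x) v)"
  unfolding smooth_on_def
proof
  fix k assume "\<forall>k. C_diff k f S"
  then have "C_diff (Suc k) f S" ..
  then show "C_diff k (\<lambda>x. frechet_derivative f (at x) v) S" by simp
qed

text \<open>Spanning is expressed by the Fourier expansion, the form in which it is always applied.
  Dimension 0 is covered, with \<open>B\<close> empty.\<close>

definition orthonormal_basis :: "'a::real_inner set \<Rightarrow> bool" where
  "orthonormal_basis B \<longleftrightarrow> finite B \<and> (\<forall>b\<in>B. \<forall>c\<in>B. b \<bullet> c = (if b = c then 1 else 0)) \<and>
     (\<forall>x. (\<Sum>b\<in>B. (x \<bullet> b) *\<^sub>R b) = x)"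

lemma orthonormal_basis_real: "orthonormal_basis {1::real}"
  by (simp add: orthonormal_basis_def)

lemma linear_expand:
  assumes "orthonormal_basis B" "linear L"
  shows "L x = (\<Sum>b\<in>B. (x \<bullet> b) *\<^sub>R L b)"
proof -
  have "L x = L (\<Sum>b\<in>B. (x \<bullet> b) *\<^sub>R b)"
    using assms(1) by (simp add: orthonormal_basis_def)
  then show ?thesis by (simp add: linear_sum[OF assms(2)] linear_cmul[OF assms(2)])
qed

lemma linear_imp_bounded_linear:
  assumes "orthonormal_basis (B :: 'a::real_inner set)" "linear L"
  shows "bounded_linear (L :: 'a \<Rightarrow> 'b::real_normed_vector)"
proof -
  have "bounded_linear (\<lambda>x. \<Sum>b\<in>B. (x \<bullet> b) *\<^sub>R L b)"
    by (intro bounded_linear_sum bounded_linear_scaleR_const bounded_linear_inner_left)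
  also have "(\<lambda>x. \<Sum>b\<in>B. (x \<bullet> b) *\<^sub>R L b) = L"
    by (rule ext) (rule linear_expand[OF assms, symmetric])
  finally show ?thesis .
qed

text \<open>The chain rule applies the derivative of \<open>g\<close> to a vector that moves with
  the point, whereas \<open>C_diff\<close> controls derivatives in fixed directions only. Expanding
  that vector in a basis of the intermediate space leaves products of scalar coefficients with
  partial derivatives of \<open>g\<close> composed with \<open>f\<close>, to which the induction
  hypothesis applies.\<close>

lemma C_diff_compose:
  fixes f :: "'a::real_normed_vector \<Rightarrow> 'b::real_inner" and g :: "'b \<Rightarrow> 'c::real_normed_vector"
  assumes B: "orthonormal_basis (B :: 'b set)" and "open S" "open T" "f ` S \<subseteq> T"
    and "C_diff k f S" "C_diff k g T"
  shows "C_diff k (\<lambda>x. g (f x)) S"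
  using assms(5,6)
proof (induction k arbitrary: g)
  case 0
  then show ?case
    using continuous_on_compose2[OF _ _ assms(4)] by simp
next
  case (Suc k)
  have fd: "(f has_derivative frechet_derivative f (at x)) (at x)" if "x \<in> S" for x
    using Suc.prems that by (intro C_diff_has_derivative)
  have gd: "(g has_derivative frechet_derivative g (at (f x))) (at (f x))" if "x \<in> S" for x
    using Suc.prems(2) that assms(4) by (intro C_diff_has_derivative) auto
  show ?case
  proof (rule C_diff_Suc_I[OF assms(2)])
    show "((\<lambda>x. g (f x)) has_derivative
       (\<lambda>v. \<Sum>b\<in>B. (frechet_derivative f (at x) v \<bullet> b) *\<^sub>R frechet_derivative g (at (f x)) b)) (at x)"
      if "x \<in> S" for x
      using has_derivative_compose[OF fd[OF that] gd[OF that]]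
      by (subst linear_expand[OF B has_derivative_linear[OF gd[OF that]], symmetric])
    have *: "C_diff k (\<lambda>x. (frechet_derivative f (at x) v \<bullet> b) *\<^sub>R frechet_derivative g (at (f x)) b) S" for v b
    proof (rule C_diff_bilinear[OF bounded_bilinear_scaleR assms(2)])
      show "C_diff k (\<lambda>x. frechet_derivative f (at x) v \<bullet> b) S"
        using Suc.prems by (intro C_diff_bounded_linear[OF bounded_linear_inner_left assms(2)]) simp
      show "C_diff k (\<lambda>x. frechet_derivative g (at (f x)) b) S"
        using Suc.prems C_diff_Suc_D[OF Suc.prems(1)] by (intro Suc.IH) simp_all
    qed
    show "C_diff k (\<lambda>x. \<Sum>b\<in>B. (frechet_derivative f (at x) v \<bullet> b) *\<^sub>R frechet_derivative g (at (f x)) b) S" for v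
      by (induction B rule: infinite_finite_induct) (simp_all add: C_diff_const C_diff_add assms(2) *)
  qed
qed

lemma smooth_on_compose:
  fixes f :: "'a::real_normed_vector \<Rightarrow> 'b::real_inner" and g :: "'b \<Rightarrow> 'c::real_normed_vector"
  assumes "orthonormal_basis (B :: 'b set)" "open S" "open T" "f ` S \<subseteq> T"
    and "smooth_on S f" "smooth_on T g"
  shows "smooth_on S (\<lambda>x. g (f x))"
  using assms by (auto simp: smooth_on_def intro: C_diff_compose)

text \<open>An operator is the finite sum of its values on a basis, each multiplied by the
  corresponding coordinate functional, and this sum is linear in those values.\<close>

lemma smooth_on_blinfun:
  fixes F :: "'a::real_normed_vector \<Rightarrow> 'b::real_inner \<Rightarrow>\<^sub>L 'c::real_normed_vector"
  assumes B: "orthonormal_basis B" and S: "open S" and F: "\<And>b. b \<in> B \<Longrightarrow> smooth_on S (\<lambda>x. F x b)"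
  shows "smooth_on S F"
proof -
  have "F x = (\<Sum>b\<in>B. blinfun_scaleR_left (F x b) o\<^sub>L blinfun_inner_left b)" for x
    by (rule blinfun_eqI, subst linear_expand[OF B bounded_linear.linear[OF blinfun.bounded_linear_right]])
      (simp add: blinfun.sum_left inner_commute)
  then have "F = (\<lambda>x. \<Sum>b\<in>B. blinfun_scaleR_left (F x b) o\<^sub>L blinfun_inner_left b)" by auto
  moreover have "smooth_on S (\<lambda>x. \<Sum>b\<in>B. blinfun_scaleR_left (F x b) o\<^sub>L blinfun_inner_left b)"
  proof (rule smooth_on_sum[OF S])
    fix b assume "b \<in> B"
    then show "smooth_on S (\<lambda>x. blinfun_scaleR_left (F x b) o\<^sub>L blinfun_inner_left b)"
      by (intro smooth_on_bounded_linear[OF _ S F, of "\<lambda>y. blinfun_scaleR_left y o\<^sub>L blinfun_inner_left b"]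
          bounded_linear_intros)
  qed
  ultimately show ?thesis by simp
qed

text \<open>Schwarz's theorem by the second difference over the parallelogram spanned by
  \<open>h u\<close> and \<open>h w\<close>. It is symmetric in \<open>u\<close> and
  \<open>w\<close>, and two applications of the mean value theorem, in either order, express it by
  one of the two mixed derivatives at a nearby point.\<close>

lemma second_derivative_symmetric:
  fixes f :: "'a::real_normed_vector \<Rightarrow> real"
  assumes f: "C_diff 2 f S" and S: "open S" "x \<in> S"
  shows "frechet_derivative (\<lambda>y. frechet_derivative f (at y) u) (at x) w =
         frechet_derivative (\<lambda>y. frechet_derivative f (at y) w) (at x) u"
proof -
  define D where "D u w y = frechet_derivative (\<lambda>y. frechet_derivative f (at y) u) (at y) w" for u w y
  have f2: "C_diff (Suc (Suc 0)) f S" using f by (simp add: numeral_2_eq_2)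
  have d1: "(f has_derivative frechet_derivative f (at y)) (at y)" if "y \<in> S" for y
    using f2 that by (rule C_diff_has_derivative)
  have d2: "((\<lambda>y. frechet_derivative f (at y) u) has_derivative (\<lambda>w. D u w y)) (at y)" if "y \<in> S" for u y
    using f2 that unfolding D_def by (intro C_diff_has_derivative[where k = 0 and S = S]) auto
  have cont: "continuous_on S (D u w)" for u w
    using f2 unfolding D_def by auto
  have lineS: "((\<lambda>s. y + s *\<^sub>R u) has_derivative (\<lambda>h. h *\<^sub>R u)) (at s)" for y u :: 'a and s
    by (auto intro!: derivative_eq_intros)
  have line1: "((\<lambda>s. f (y + s *\<^sub>R u)) has_real_derivative frechet_derivative f (at (y + s *\<^sub>R u)) u) (at s)"
    if "y + s *\<^sub>R u \<in> S" for y u s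
    using has_derivative_compose[OF lineS d1[OF that]]
    unfolding has_field_derivative_def
    by (rule has_derivative_eq_rhs)
      (simp add: fun_eq_iff linear_cmul[OF has_derivative_linear[OF d1[OF that]]])
  have line2: "((\<lambda>s. frechet_derivative f (at (y + s *\<^sub>R w)) u) has_real_derivative D u w (y + s *\<^sub>R w)) (at s)"
    if "y + s *\<^sub>R w \<in> S" for y u w s
    using has_derivative_compose[OF lineS d2[OF that]]
    unfolding has_field_derivative_def
    by (rule has_derivative_eq_rhs)
      (simp add: fun_eq_iff linear_cmul[OF has_derivative_linear[OF d2[OF that]]])
  have mvt: "\<exists>s t. 0 < s \<and> s < h \<and> 0 < t \<and> t < h \<and>
      f (x + h *\<^sub>R u + h *\<^sub>R w) - f (x + h *\<^sub>R u) - f (x + h *\<^sub>R w) + f x = h * h * D u w (x + s *\<^sub>R u + t *\<^sub>R w)"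
    if h: "h > 0" and in_S: "\<And>s t. 0 \<le> s \<Longrightarrow> s \<le> h \<Longrightarrow> 0 \<le> t \<Longrightarrow> t \<le> h \<Longrightarrow> x + s *\<^sub>R u + t *\<^sub>R w \<in> S"
    for h u w
  proof -
    \<comment> \<open>The mean value theorem in direction \<open>u\<close> for the difference of
      \<open>f\<close> along the two parallel sides; the next application moves in direction
      \<open>w\<close>.\<close>
    have "\<exists>s. 0 < s \<and> s < h \<and> (f (x + h *\<^sub>R w + h *\<^sub>R u) - f (x + h *\<^sub>R u)) - (f (x + h *\<^sub>R w + 0 *\<^sub>R u) - f (x + 0 *\<^sub>R u))
        = (h - 0) * (frechet_derivative f (at (x + h *\<^sub>R w + s *\<^sub>R u)) u - frechet_derivative f (at (x + s *\<^sub>R u)) u)"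
    proof (rule MVT2[OF h])
      fix s assume s: "0 \<le> s" "s \<le> h"
      have 1: "x + h *\<^sub>R w + s *\<^sub>R u \<in> S" using in_S[of s h] s h by (simp add: algebra_simps)
      have 2: "x + s *\<^sub>R u \<in> S" using in_S[of s 0] s h by simp
      show "((\<lambda>s. f (x + h *\<^sub>R w + s *\<^sub>R u) - f (x + s *\<^sub>R u)) has_real_derivative
        frechet_derivative f (at (x + h *\<^sub>R w + s *\<^sub>R u)) u - frechet_derivative f (at (x + s *\<^sub>R u)) u) (at s)"
        by (intro DERIV_diff line1 1 2)
    qed
    then obtain s where s: "0 < s" "s < h" and eq1: "(f (x + h *\<^sub>R w + h *\<^sub>R u) - f (x + h *\<^sub>R u)) - (f (x + h *\<^sub>R w) - f x)
        = h * (frechet_derivative f (at (x + h *\<^sub>R w + s *\<^sub>R u)) u - frechet_derivative f (at (x + s *\<^sub>R u)) u)"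
      by auto
    have "\<exists>t. 0 < t \<and> t < h \<and> frechet_derivative f (at (x + s *\<^sub>R u + h *\<^sub>R w)) u - frechet_derivative f (at (x + s *\<^sub>R u + 0 *\<^sub>R w)) u
        = (h - 0) * D u w (x + s *\<^sub>R u + t *\<^sub>R w)"
      using s by (intro MVT2[OF h] line2 in_S) auto
    then obtain t where t: "0 < t" "t < h" and eq2:
      "frechet_derivative f (at (x + h *\<^sub>R w + s *\<^sub>R u)) u - frechet_derivative f (at (x + s *\<^sub>R u)) u
        = h * D u w (x + s *\<^sub>R u + t *\<^sub>R w)"
      by (auto simp: algebra_simps)
    show ?thesis using s t eq1[unfolded eq2] by (intro exI[of _ s] exI[of _ t]) (simp add: algebra_simps)
  qed
  have "D u w x = D w u x"
  proof (rule ccontr)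
    assume ne: "D u w x \<noteq> D w u x"
    define e where "e = \<bar>D u w x - D w u x\<bar> / 2"
    have e: "e > 0" using ne by (simp add: e_def)
    have c: "\<exists>d>0. \<forall>y. dist y x < d \<longrightarrow> \<bar>D u w y - D u w x\<bar> < e" for u w
      using cont[of u w] e S unfolding continuous_on_eq_continuous_at[OF S(1)] continuous_at_eps_delta
      by (simp add: dist_real_def)
    obtain d1 where d1: "d1 > 0" "\<And>y. dist y x < d1 \<Longrightarrow> \<bar>D u w y - D u w x\<bar> < e" using c[of u w] by auto
    obtain d2 where d2: "d2 > 0" "\<And>y. dist y x < d2 \<Longrightarrow> \<bar>D w u y - D w u x\<bar> < e" using c[of w u] by auto
    obtain d3 where d3: "d3 > 0" "ball x d3 \<subseteq> S" using S open_contains_ball by blast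
    define d where "d = min d1 (min d2 d3)"
    \<comment> \<open>The \<open>+ 1\<close> keeps the denominator positive when
      \<open>u = w = 0\<close>; the factor 2 makes the parallelogram lie strictly inside the ball of
      radius \<open>d\<close>.\<close>
    define h where "h = d / (2 * (norm u + norm w + 1))"
    have d: "d > 0" using d1 d2 d3 by (simp add: d_def)
    have n: "norm u + norm w + 1 > 0" by (simp add: add_nonneg_pos)
    have h: "h > 0" using d n by (simp add: h_def)
    have close: "dist (x + s *\<^sub>R u + t *\<^sub>R w) x < d" if "0 \<le> s" "s \<le> h" "0 \<le> t" "t \<le> h" for s t
    proof -
      have "norm (s *\<^sub>R u + t *\<^sub>R w) \<le> s * norm u + t * norm w"
        using norm_triangle_ineq[of "s *\<^sub>R u" "t *\<^sub>R w"] that by simp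
      also have "\<dots> \<le> h * norm u + h * norm w"
        using that by (intro add_mono mult_right_mono) auto
      also have "\<dots> \<le> h * (norm u + norm w + 1)" using h by (simp add: algebra_simps)
      also have "\<dots> = d / 2" using n unfolding h_def by (simp del: distrib_left_numeral)
      also have "\<dots> < d" using d by simp
      finally show ?thesis by (simp add: dist_norm algebra_simps)
    qed
    have inS: "y \<in> S" if "dist y x < d" for y
      using d3(2) that by (auto simp: d_def dist_commute subset_iff)
    obtain s t where st: "0 < s" "s < h" "0 < t" "t < h"
      and 1: "f (x + h *\<^sub>R u + h *\<^sub>R w) - f (x + h *\<^sub>R u) - f (x + h *\<^sub>R w) + f x = h * h * D u w (x + s *\<^sub>R u + t *\<^sub>R w)"
      using mvt[OF h, of u w, OF inS[OF close]] by auto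
    have "x + s *\<^sub>R w + t *\<^sub>R u \<in> S" if "0 \<le> s" "s \<le> h" "0 \<le> t" "t \<le> h" for s t
      using inS[OF close[of t s]] that by (simp add: add_ac)
    from mvt[OF h, of w u, OF this] obtain s' t' where st': "0 < s'" "s' < h" "0 < t'" "t' < h"
      and 2: "f (x + h *\<^sub>R w + h *\<^sub>R u) - f (x + h *\<^sub>R w) - f (x + h *\<^sub>R u) + f x = h * h * D w u (x + s' *\<^sub>R w + t' *\<^sub>R u)"
      by blast
    \<comment> \<open>Both sides are the same second difference. The two mixed derivatives thus
      agree at points where each is within half the gap of its value at \<open>x\<close>, a
      contradiction.\<close>
    have "h * h * D u w (x + s *\<^sub>R u + t *\<^sub>R w) = h * h * D w u (x + s' *\<^sub>R w + t' *\<^sub>R u)"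
      unfolding 1[symmetric] 2[symmetric] by (simp add: add_ac)
    then have "D u w (x + s *\<^sub>R u + t *\<^sub>R w) = D w u (x + t' *\<^sub>R u + s' *\<^sub>R w)"
      using h by (simp add: add_ac)
    moreover have "\<bar>D u w (x + s *\<^sub>R u + t *\<^sub>R w) - D u w x\<bar> < e"
      using close[of s t] st by (intro d1) (simp add: d_def)
    moreover have "\<bar>D w u (x + t' *\<^sub>R u + s' *\<^sub>R w) - D w u x\<bar> < e"
      using close[of t' s'] st' by (intro d2) (simp add: d_def)
    ultimately show False unfolding e_def by (smt (verit) field_sum_of_halves)
  qed
  then show ?thesis by (simp add: D_def)
qed

text \<open>Gram-Schmidt by induction over the spanning set: the residual \<open>n\<close> of the
  new vector is normalised and added, or the vector is dropped when the residual vanishes.\<close>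

lemma orthonormal_basis_exists:
  fixes S :: "'a::real_inner set"
  assumes "finite S" "span S = UNIV"
  obtains B :: "'a set" where "orthonormal_basis B"
proof -
  have "\<exists>B. finite B \<and> (\<forall>b\<in>B. \<forall>c\<in>B. b \<bullet> c = (if b = c then 1 else 0)) \<and> S \<subseteq> span B"
    using assms(1)
  proof (induction S)
    case empty
    then show ?case by (intro exI[of _ "{}"]) auto
  next
    case (insert a S)
    then obtain B where B: "finite B" "\<And>b c. b \<in> B \<Longrightarrow> c \<in> B \<Longrightarrow> b \<bullet> c = (if b = c then 1 else 0)"
      "S \<subseteq> span B" by blast
    define p where "p = (\<Sum>b\<in>B. (a \<bullet> b) *\<^sub>R b)"
    define n where "n = a - p"
    have p: "p \<in> span B"
      unfolding p_def by (intro span_sum span_scale span_base)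
    have n0: "n \<bullet> c = 0" if "c \<in> B" for c
    proof -
      have "p \<bullet> c = (\<Sum>b\<in>B. (a \<bullet> b) * (if b = c then 1 else 0))"
        unfolding p_def using that by (auto simp: inner_sum_left B(2) intro!: sum.cong)
      also have "\<dots> = a \<bullet> c" using that B(1) by (simp add: sum.delta' if_distrib cong: if_cong)
      finally show ?thesis by (simp add: n_def inner_diff_left)
    qed
    show ?case
    proof (cases "n = 0")
      case True
      then have "a \<in> span B" using p by (simp add: n_def)
      then show ?thesis using B by (intro exI[of _ B]) auto
    next
      case False
      define m where "m = n /\<^sub>R norm n"
      have m: "m \<bullet> m = 1" "\<And>c. c \<in> B \<Longrightarrow> m \<bullet> c = 0" "\<And>c. c \<in> B \<Longrightarrow> c \<bullet> m = 0"
        using False n0 by (auto simp: m_def dot_square_norm power2_eq_square inner_commute field_simps)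
      have "a = p + norm n *\<^sub>R m" using False by (simp add: m_def n_def)
      also have "\<dots> \<in> span (insert m B)"
        using span_mono[of B "insert m B"] p by (intro span_add span_scale) (auto intro: span_base)
      finally have "insert a S \<subseteq> span (insert m B)"
        using B(3) span_mono[of B "insert m B"] by auto
      moreover have "\<forall>b\<in>insert m B. \<forall>c\<in>insert m B. b \<bullet> c = (if b = c then 1 else 0)"
        using m B(2) m(2)[of m] by auto
      ultimately show ?thesis using B(1) by (intro exI[of _ "insert m B"]) auto
    qed
  qed
  then obtain B where B: "finite B" "\<And>b c. b \<in> B \<Longrightarrow> c \<in> B \<Longrightarrow> b \<bullet> c = (if b = c then 1 else 0)"
      "S \<subseteq> span B" by blast
  have span: "span B = UNIV" using assms(2) span_minimal[OF B(3) subspace_span] by auto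
  have "(\<Sum>b\<in>B. (x \<bullet> b) *\<^sub>R b) = x" for x
  proof -
    have "x \<in> span B" by (simp add: span)
    then show ?thesis
    proof (induction rule: span_induct_alt)
      case base
      then show ?case by simp
    next
      case (step c y z)
      have "(\<Sum>b\<in>B. ((c *\<^sub>R y + z) \<bullet> b) *\<^sub>R b) = c *\<^sub>R (\<Sum>b\<in>B. (y \<bullet> b) *\<^sub>R b) + (\<Sum>b\<in>B. (z \<bullet> b) *\<^sub>R b)"
        by (simp add: inner_add_left scaleR_add_left sum.distrib scaleR_sum_right)
      also have "(\<Sum>b\<in>B. (y \<bullet> b) *\<^sub>R b) = (\<Sum>b\<in>B. if b = y then y else 0)"
        using step by (intro sum.cong) (auto simp: B(2))
      also have "\<dots> = y" using step B(1) by (simp add: sum.delta')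
      finally show ?case using step by simp
    qed
  qed
  then have "orthonormal_basis B" using B by (auto simp: orthonormal_basis_def)
  then show thesis by (rule that)
qed

text \<open>Heine-Borel: a coordinate box is a finite sum of compact segments, hence compact, and
  the ball is a closed subset of a large enough box.\<close>

lemma compact_cball_finite_dim:
  assumes "orthonormal_basis (B :: 'a::real_inner set)"
  shows "compact (cball (z::'a) r)"
proof -
  have B: "finite B" using assms by (simp add: orthonormal_basis_def)
  \<comment> \<open>By the triangle inequality \<open>R\<close> bounds the norm on the ball, and by
    Cauchy-Schwarz also each coordinate.\<close>
  define R where "R = norm z + \<bar>r\<bar>"
  define box where "box C = {(\<Sum>b\<in>C. a b *\<^sub>R b) | a. \<forall>b\<in>C. \<bar>a b\<bar> \<le> R}" for C :: "'a set"
  have "compact (box C)" if "finite C" for C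
    using that
  proof (induction C)
    case empty
    have "box {} = {0}" by (auto simp: box_def)
    then show ?case by simp
  next
    case (insert c C)
    have 1: "compact ((\<lambda>t. t *\<^sub>R c) ` {-R..R})"
      by (intro compact_continuous_image continuous_intros) auto
    have "box (insert c C) = {x + y | x y. x \<in> (\<lambda>t. t *\<^sub>R c) ` {-R..R} \<and> y \<in> box C}"
    proof (intro equalityI subsetI)
      fix p assume "p \<in> box (insert c C)"
      then obtain a where a: "\<forall>b\<in>insert c C. \<bar>a b\<bar> \<le> R" "p = (\<Sum>b\<in>insert c C. a b *\<^sub>R b)"
        by (auto simp: box_def)
      have "p = a c *\<^sub>R c + (\<Sum>b\<in>C. a b *\<^sub>R b)" using a insert by simp
      moreover have "a c \<in> {-R..R}" "(\<Sum>b\<in>C. a b *\<^sub>R b) \<in> box C" using a by (auto simp: box_def)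
      ultimately show "p \<in> {x + y | x y. x \<in> (\<lambda>t. t *\<^sub>R c) ` {-R..R} \<and> y \<in> box C}" by blast
    next
      fix p assume "p \<in> {x + y | x y. x \<in> (\<lambda>t. t *\<^sub>R c) ` {-R..R} \<and> y \<in> box C}"
      then obtain t a where "t \<in> {-R..R}" and a: "\<forall>b\<in>C. \<bar>a b\<bar> \<le> R" "p = t *\<^sub>R c + (\<Sum>b\<in>C. a b *\<^sub>R b)"
        unfolding box_def by blast
      then have t: "\<bar>t\<bar> \<le> R" by auto
      have "(\<Sum>b\<in>C. (if b = c then t else a b) *\<^sub>R b) = (\<Sum>b\<in>C. a b *\<^sub>R b)"
        using insert by (intro sum.cong) auto
      then have "p = (\<Sum>b\<in>insert c C. (if b = c then t else a b) *\<^sub>R b)"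
        using a insert by simp
      then show "p \<in> box (insert c C)" unfolding box_def using a(1) t by (auto intro!: exI[of _ "\<lambda>b. if b = c then t else a b"])
    qed
    then show ?case using compact_sums[OF 1 insert.IH] by simp
  qed
  then have "compact (box B)" using B by blast
  moreover have "cball z r \<subseteq> box B"
  proof
    fix x assume x: "x \<in> cball z r"
    have "norm x \<le> R" using x norm_triangle_ineq[of z "x - z"] by (auto simp: R_def dist_norm norm_minus_commute)
    have "\<bar>x \<bullet> b\<bar> \<le> R" if "b \<in> B" for b
    proof -
      have "norm b = 1" using that assms by (simp add: orthonormal_basis_def norm_eq_sqrt_inner)
      then show ?thesis using Cauchy_Schwarz_ineq2[of x b] \<open>norm x \<le> R\<close> by simp
    qed
    moreover have "x = (\<Sum>b\<in>B. (x \<bullet> b) *\<^sub>R b)" using assms by (simp add: orthonormal_basis_def)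
    ultimately show "x \<in> box B" unfolding box_def by blast
  qed
  ultimately show ?thesis
    using compact_Int_closed[of "box B" "cball z r"] by (simp add: Int_absorb1 Int_commute)
qed

text \<open>
  The functions \<open>poly p (1/t) * exp (-1/t)\<close>, extended by \<open>0\<close>, are closed under differentiation,
  so that smoothness follows by induction.
\<close>

definition flat_exp :: "real poly \<Rightarrow> real \<Rightarrow> real" where
  "flat_exp p t = (if t \<le> 0 then 0 else poly p (1 / t) * exp (- (1 / t)))"

section \<open>Flat functions and bump functions\<close>

lemma poly_div_exp_tendsto_0: "((\<lambda>x::real. poly p x / exp x) \<longlongrightarrow> 0) at_top"
proof (induction p)
  case 0
  then show ?case by simp
next
  case (pCons a p)
  have "((\<lambda>x::real. poly q x * x / exp x) \<longlongrightarrow> 0) at_top" for q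
  proof -
    have "((\<lambda>x::real. \<Sum>i\<le>degree q. coeff q i * (x ^ Suc i / exp x)) \<longlongrightarrow> (\<Sum>i\<le>degree q. coeff q i * 0)) at_top"
      by (intro tendsto_intros tendsto_power_div_exp_0)
    moreover have "(\<Sum>i\<le>degree q. coeff q i * (x ^ Suc i / exp x)) = poly q x * x / exp x" for x
      by (simp add: poly_altdef sum_distrib_left sum_divide_distrib mult_ac)
    ultimately show ?thesis by simp
  qed
  moreover have "((\<lambda>x::real. a * (x ^ 0 / exp x)) \<longlongrightarrow> a * 0) at_top"
    by (intro tendsto_intros tendsto_power_div_exp_0)
  ultimately have "((\<lambda>x::real. a * (x ^ 0 / exp x) + poly p x * x / exp x) \<longlongrightarrow> a * 0 + 0) at_top"
    by (intro tendsto_add)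
  then show ?case by (simp add: add_divide_distrib mult_ac)
qed

text \<open>With s = 1/t the derivative of p(s) exp(-s) in t is s^2 (p(s) - p'(s)) exp(-s), and
  \<open>[:0, 0, 1:]\<close> is the polynomial s^2.\<close>

lemma flat_exp_deriv:
  "(flat_exp p has_real_derivative flat_exp ([:0, 0, 1:] * (p - pderiv p)) t) (at t)"
proof -
  consider "t > 0" | "t < 0" | "t = 0" by linarith
  then show ?thesis
  proof cases
    case 1
    have "((\<lambda>t. poly p (1 / t) * exp (- (1 / t))) has_real_derivative
        flat_exp ([:0, 0, 1:] * (p - pderiv p)) t) (at t)"
      using 1 unfolding flat_exp_def
      by (auto intro!: derivative_eq_intros DERIV_chain'[OF _ poly_DERIV] simp: field_simps power2_eq_square)
    then show ?thesis
      by (rule has_field_derivative_transform_within_open[of _ _ _ "{0<..}"]) (use 1 in \<open>auto simp: flat_exp_def\<close>)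
  next
    case 2
    have "((\<lambda>t. 0) has_real_derivative flat_exp ([:0, 0, 1:] * (p - pderiv p)) t) (at t)"
      using 2 by (simp add: flat_exp_def)
    then show ?thesis
      by (rule has_field_derivative_transform_within_open[of _ _ _ "{..<0}"]) (use 2 in \<open>auto simp: flat_exp_def\<close>)
  next
    case 3
    \<comment> \<open>The difference quotient at 0 from the right is x p(x) / exp x with x = 1/h, so
      its limit is one at infinity.\<close>
    have "((\<lambda>x. poly [:0, 1:] x * poly p x / exp x) \<longlongrightarrow> 0) at_top"
      using poly_div_exp_tendsto_0[of "[:0, 1:] * p"] by simp
    then have "((\<lambda>h. poly [:0, 1:] (inverse h) * poly p (inverse h) / exp (inverse h)) \<longlongrightarrow> 0) (at_right (0::real))"
      by (rule filterlim_compose[OF _ filterlim_inverse_at_top_right])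
    then have "((\<lambda>h. flat_exp p h / h) \<longlongrightarrow> 0) (at_right 0)"
      by (rule Lim_transform_eventually)
        (auto simp: eventually_at_filter flat_exp_def exp_minus field_simps intro!: always_eventually)
    moreover have "((\<lambda>h. flat_exp p h / h) \<longlongrightarrow> 0) (at_left (0::real))"
      by (rule Lim_transform_eventually[OF tendsto_const])
        (auto simp: eventually_at_filter flat_exp_def intro!: always_eventually)
    ultimately have "((\<lambda>h. flat_exp p h / h) \<longlongrightarrow> 0) (at 0)"
      by (simp add: filterlim_at_split)
    then show ?thesis
      unfolding 3 by (simp add: DERIV_def flat_exp_def)
  qed
qed

lemma smooth_flat_exp: "smooth_on UNIV (flat_exp p)"
proof -
  have "C_diff k (flat_exp p) UNIV" for k
  proof (induction k arbitrary: p)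
    case 0
    then show ?case
      using flat_exp_deriv DERIV_isCont continuous_at_imp_continuous_on by simp blast
  next
    case (Suc k)
    show ?case
    proof (rule C_diff_Suc_I)
      show "(flat_exp p has_derivative (\<lambda>v. v * flat_exp ([:0, 0, 1:] * (p - pderiv p)) x)) (at x)" for x
        using flat_exp_deriv[of p x] unfolding has_field_derivative_def
        by (simp add: mult_commute_abs)
      show "C_diff k (\<lambda>x. v * flat_exp ([:0, 0, 1:] * (p - pderiv p)) x) UNIV" for v
        by (rule C_diff_bounded_linear[OF bounded_linear_mult_right _ Suc.IH]) simp
    qed simp
  qed
  then show ?thesis by (simp add: smooth_on_def)
qed

lemma smooth_bump_exists:
  fixes z0 :: "'a::real_inner"
  assumes "r > 0"
  obtains \<psi> :: "'a \<Rightarrow> real" where "smooth_on UNIV \<psi>" "\<psi> z0 = 1" "\<And>z. z \<notin> cball z0 r \<Longrightarrow> \<psi> z = 0"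
proof
  \<comment> \<open>The argument r^2 - |z - z0|^2 is nonpositive outside the open ball, where
    \<open>flat_exp\<close> vanishes; the last factor normalises the value at the centre. The
    difference is spelled with sums and products to match the closure rules.\<close>
  define \<psi> where "\<psi> z = flat_exp 1 (r\<^sup>2 + (-1) * ((z + (- z0)) \<bullet> (z + (- z0)))) * (1 / flat_exp 1 (r\<^sup>2))" for z
  have "smooth_on UNIV (\<lambda>z. r\<^sup>2 + (-1) * ((z + (- z0)) \<bullet> (z + (- z0))))"
    by (intro smooth_on_add smooth_on_mult smooth_on_inner smooth_on_const smooth_on_ident) auto
  then have "smooth_on UNIV (\<lambda>z. flat_exp 1 (r\<^sup>2 + (-1) * ((z + (- z0)) \<bullet> (z + (- z0)))))"
    by (intro smooth_on_compose[OF orthonormal_basis_real _ _ _ _ smooth_flat_exp]) auto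
  then show "smooth_on UNIV \<psi>"
    unfolding \<psi>_def by (intro smooth_on_mult smooth_on_const) auto
  show "\<psi> z0 = 1" using assms by (simp add: \<psi>_def flat_exp_def)
  show "\<psi> z = 0" if "z \<notin> cball z0 r" for z
  proof -
    have "r < norm (z - z0)" using that by (simp add: dist_norm norm_minus_commute)
    then have "r\<^sup>2 < (norm (z - z0))\<^sup>2" using assms by (intro power_strict_mono) auto
    then show ?thesis by (simp add: \<psi>_def flat_exp_def power2_norm_eq_inner)
  qed
qed

section \<open>Charts\<close>

lemma openin_chart_domain:
  assumes "smooth_atlas A" "c \<in> A"
  shows "openin (atlas_topology A) (fst c)"
  using assms by (auto simp: openin_atlas_topology points_def smooth_atlas_def Int_commute)

lemma topspace_atlas_topology:
  assumes "smooth_atlas A"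
  shows "topspace (atlas_topology A) = points A"
proof (rule antisym)
  show "topspace (atlas_topology A) \<subseteq> points A"
    using openin_topspace[of "atlas_topology A"] unfolding openin_atlas_topology[OF assms] by blast
  show "points A \<subseteq> topspace (atlas_topology A)"
    unfolding points_def by (intro UN_least openin_subset openin_chart_domain assms)
qed

locale manifold =
  fixes A :: "('p, 'e::real_inner) chart set"
  assumes manifold: "smooth_manifold A"
begin

lemma atlas: "smooth_atlas A"
  using manifold by (simp add: smooth_manifold_def)

lemma basis_exists: obtains B :: "'e set" where "orthonormal_basis B"
proof -
  obtain S :: "'e set" where "finite S" "span S = UNIV"
    using manifold by (auto simp: smooth_manifold_def)
  then show thesis using that by (rule orthonormal_basis_exists)
qed

lemma linear_bounded: "linear L \<Longrightarrow> bounded_linear (L :: 'e \<Rightarrow> 'b::real_normed_vector)"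
  using basis_exists linear_imp_bounded_linear by blast

lemma chart_inj: "c \<in> A \<Longrightarrow> inj_on (snd c) (fst c)"
  and open_chart_range: "c \<in> A \<Longrightarrow> open (chart_range c)"
  and open_overlap: "c \<in> A \<Longrightarrow> d \<in> A \<Longrightarrow> open (snd c ` (fst c \<inter> fst d))"
  and transition_smooth: "c \<in> A \<Longrightarrow> d \<in> A \<Longrightarrow> smooth_on (snd c ` (fst c \<inter> fst d)) (snd d \<circ> chart_inv c)"
  using atlas by (auto simp: smooth_atlas_def)

lemma chart_inv_chart: "c \<in> A \<Longrightarrow> x \<in> fst c \<Longrightarrow> chart_inv c (snd c x) = x"
  by (simp add: chart_inv_def chart_inj)

lemma chart_inv_in: "z \<in> chart_range c \<Longrightarrow> chart_inv c z \<in> fst c"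
  and chart_chart_inv: "z \<in> chart_range c \<Longrightarrow> snd c (chart_inv c z) = z"
  by (auto simp: chart_inv_def chart_range_def inv_into_into f_inv_into_f)

lemma chart_in_range: "x \<in> fst c \<Longrightarrow> snd c x \<in> chart_range c"
  by (simp add: chart_range_def)

lemma points_I: "c \<in> A \<Longrightarrow> x \<in> fst c \<Longrightarrow> x \<in> points A"
  by (auto simp: points_def)

lemma in_image_chart_iff:
  "c \<in> A \<Longrightarrow> U \<subseteq> fst c \<Longrightarrow> z \<in> snd c ` U \<longleftrightarrow> z \<in> chart_range c \<and> chart_inv c z \<in> U"
  using chart_inv_chart[of c] chart_chart_inv[of z c] chart_in_range[of _ c]
  by (auto simp: subset_iff image_iff) metis

lemma overlap_iff:
  "c \<in> A \<Longrightarrow> z \<in> snd c ` (fst c \<inter> fst d) \<longleftrightarrow> z \<in> chart_range c \<and> chart_inv c z \<in> fst d"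
  using in_image_chart_iff[of c "fst c \<inter> fst d" z] chart_inv_in[of z c] by auto

lemma chart_at:
  assumes "x \<in> points A"
  shows chart_at_in: "chart_at A x \<in> A" and in_chart_at: "x \<in> fst (chart_at A x)"
proof -
  have "\<exists>c. c \<in> A \<and> x \<in> fst c" using assms by (auto simp: points_def)
  then show "chart_at A x \<in> A" "x \<in> fst (chart_at A x)"
    unfolding chart_at_def by (metis (mono_tags, lifting) someI_ex)+
qed

section \<open>Coordinate changes and components\<close>

lemma coord_change_has_derivative:
  assumes "c \<in> A" "d \<in> A" "x \<in> fst c" "x \<in> fst d"
  shows "((snd d \<circ> chart_inv c) has_derivative coord_change c d x) (at (snd c x))"
proof -
  have "((snd d \<circ> chart_inv c) has_derivative frechet_derivative (snd d \<circ> chart_inv c) (at (snd c x))) (at (snd c x))"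
    using assms by (intro smooth_on_has_derivative[OF transition_smooth]) auto
  then show ?thesis
    unfolding coord_change_def
    by (simp add: bounded_linear_Blinfun_apply has_derivative_bounded_linear)
qed

lemma coord_change_eqI:
  "((snd d \<circ> chart_inv c) has_derivative blinfun_apply J) (at (snd c x)) \<Longrightarrow> coord_change c d x = J"
  by (simp add: coord_change_def frechet_derivative_eq blinfun_apply_inverse)

text \<open>The chain rule for the transition map. Reading \<open>f\<close> through the two charts
  agrees only over the overlap, which is enough because its image is open.\<close>

lemma has_derivative_change_chart:
  assumes "c \<in> A" "d \<in> A" "x \<in> fst c" "x \<in> fst d"
    and f: "((\<lambda>z. f (chart_inv d z)) has_derivative D) (at (snd d x))"
  shows "((\<lambda>z. f (chart_inv c z)) has_derivative (\<lambda>u. D (coord_change c d x u))) (at (snd c x))"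
proof -
  have "((\<lambda>z. f (chart_inv d ((snd d \<circ> chart_inv c) z))) has_derivative (\<lambda>u. D (coord_change c d x u))) (at (snd c x))"
    using assms by (intro has_derivative_compose[OF coord_change_has_derivative]) (auto simp: chart_inv_chart)
  then show ?thesis
  proof (rule has_derivative_transform_within_open)
    show "open (snd c ` (fst c \<inter> fst d))" using assms by (simp add: open_overlap)
  qed (use assms in \<open>auto simp: overlap_iff chart_inv_chart\<close>)
qed

lemma coord_change_id: "c \<in> A \<Longrightarrow> x \<in> fst c \<Longrightarrow> coord_change c c x = id_blinfun"
proof (rule coord_change_eqI)
  assume c: "c \<in> A" "x \<in> fst c"
  have "((\<lambda>z. z) has_derivative blinfun_apply id_blinfun) (at (snd c x))" by simp
  then show "((snd c \<circ> chart_inv c) has_derivative blinfun_apply id_blinfun) (at (snd c x))"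
    by (rule has_derivative_transform_within_open[OF _ open_chart_range])
      (use c in \<open>auto simp: chart_in_range chart_chart_inv\<close>)
qed

text \<open>The cocycle rule is the preceding chain rule with the chart map of \<open>e\<close> as
  the function.\<close>

lemma coord_change_comp:
  assumes "c \<in> A" "d \<in> A" "e \<in> A" "x \<in> fst c" "x \<in> fst d" "x \<in> fst e"
  shows "coord_change d e x (coord_change c d x u) = coord_change c e x u"
proof -
  have "((snd e \<circ> chart_inv c) has_derivative coord_change d e x o\<^sub>L coord_change c d x) (at (snd c x))"
    using has_derivative_change_chart[OF assms(1,2,4,5) coord_change_has_derivative[OF assms(2,3,5,6), unfolded comp_def]]
    by (simp add: comp_def blinfun_compose.rep_eq)
  from coord_change_eqI[OF this] show ?thesis by simp
qed

lemma coord_change_inverse: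
  assumes "c \<in> A" "d \<in> A" "x \<in> fst c" "x \<in> fst d"
  shows "coord_change d c x (coord_change c d x u) = u"
  using coord_change_comp[OF assms(1,2,1,3,4,3)] assms by (simp add: coord_change_id)

lemma vf_in_chart: "c \<in> A \<Longrightarrow> x \<in> fst c \<Longrightarrow> vf_in A c Y (snd c x) = coord_change (chart_at A x) c x (Y x)"
  by (simp add: vf_in_def chart_inv_chart)

lemma form_in_chart: "c \<in> A \<Longrightarrow> x \<in> fst c \<Longrightarrow> form_in A c \<alpha> (snd c x) = \<alpha> x o\<^sub>L coord_change c (chart_at A x) x"
  by (simp add: form_in_def chart_inv_chart)

lemma vf_in_chart_at: "x \<in> points A \<Longrightarrow> vf_in A (chart_at A x) Y (snd (chart_at A x) x) = Y x"
  by (simp add: vf_in_chart chart_at coord_change_id)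

lemma form_in_chart_at: "x \<in> points A \<Longrightarrow> form_in A (chart_at A x) \<alpha> (snd (chart_at A x) x) = \<alpha> x"
  by (rule blinfun_eqI) (simp add: form_in_chart chart_at coord_change_id)

lemma form_in_vf_in:
  assumes "c \<in> A" "z \<in> chart_range c"
  shows "form_in A c \<alpha> z (vf_in A c Y z) = \<alpha> (chart_inv c z) (Y (chart_inv c z))"
proof -
  define y where "y = chart_inv c z"
  have "y \<in> fst c" "y \<in> points A" using assms chart_inv_in[of z c] points_I[of c] by (simp_all add: y_def)
  then show ?thesis
    using assms by (simp add: form_in_def vf_in_def y_def[symmetric] coord_change_inverse chart_at)
qed

lemma tensor_in_form_in:
  assumes "c \<in> A" "z \<in> chart_range c"
  shows "tensor_in A c T z (form_in A c \<alpha> z) (form_in A c \<beta> z) =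
    T (chart_inv c z) (\<alpha> (chart_inv c z)) (\<beta> (chart_inv c z))"
proof -
  define y where "y = chart_inv c z"
  have y: "y \<in> fst c" "y \<in> points A" using assms chart_inv_in[of z c] points_I[of c] by (simp_all add: y_def)
  have "\<alpha> y o\<^sub>L coord_change c (chart_at A y) y o\<^sub>L coord_change (chart_at A y) c y = \<alpha> y" for \<alpha> :: "'p \<Rightarrow> 'e \<Rightarrow>\<^sub>L real"
    by (rule blinfun_eqI) (simp add: coord_change_inverse y chart_at assms)
  then show ?thesis
    by (simp add: form_in_def tensor_in_def Let_def tensor_map_apply y_def)
qed

lemma openin_atlas:
  "openin (atlas_topology A) W \<longleftrightarrow> W \<subseteq> points A \<and> (\<forall>c\<in>A. open (snd c ` (W \<inter> fst c)))"
  by (rule openin_atlas_topology[OF atlas])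

lemma openin_chart: "c \<in> A \<Longrightarrow> openin (atlas_topology A) (fst c)"
  using atlas by (rule openin_chart_domain)

lemma topspace_atlas: "topspace (atlas_topology A) = points A"
  using atlas by (rule topspace_atlas_topology)

lemma smooth_transition_compose:
  assumes "c \<in> A" "d \<in> A" "smooth_on (chart_range c) g"
  shows "smooth_on (snd d ` (fst d \<inter> fst c)) (\<lambda>z. g (snd c (chart_inv d z)))"
proof -
  obtain B :: "'e set" where "orthonormal_basis B" by (rule basis_exists)
  then have "smooth_on (snd d ` (fst d \<inter> fst c)) (\<lambda>z. g ((snd c \<circ> chart_inv d) z))"
    using assms
    by (intro smooth_on_compose[OF _ open_overlap open_chart_range _ transition_smooth])
      (auto simp: chart_inv_chart chart_in_range)
  then show ?thesis by simp
qed

section \<open>Cut-off functions and local frames\<close>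

text \<open>The open set \<open>W\<close> replaces a compact support: over \<open>W\<close> a
  product with \<open>\<psi>\<close> is zero, over \<open>fst c\<close> it is computed in the chart,
  and these two open sets cover the manifold. The vanishing off \<open>fst c\<close> is demanded for
  every element of the type, so identities multiplied by \<open>\<psi>\<close> hold without
  restriction on the point.\<close>

definition cutoff :: "('p, 'e) chart \<Rightarrow> ('p \<Rightarrow> real) \<Rightarrow> bool" where
  "cutoff c \<psi> \<longleftrightarrow> c \<in> A \<and> smooth_function A \<psi> \<and> (\<forall>y. y \<notin> fst c \<longrightarrow> \<psi> y = 0) \<and>
     (\<exists>W. openin (atlas_topology A) W \<and> points A \<subseteq> fst c \<union> W \<and> (\<forall>y\<in>W. \<psi> y = 0))"

text \<open>Smoothness is local, and the two open pieces of the chart range are the overlap with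
  \<open>c\<close> and a set where \<open>F\<close> is zero.\<close>

lemma smooth_on_chart_range_glue:
  assumes "c \<in> A" "d \<in> A" "openin (atlas_topology A) W" "points A \<subseteq> fst c \<union> W"
    and "smooth_on (snd d ` (fst d \<inter> fst c)) F" "\<And>y. y \<in> W \<Longrightarrow> y \<in> fst d \<Longrightarrow> F (snd d y) = 0"
  shows "smooth_on (chart_range d) F"
proof -
  have W: "open (snd d ` (W \<inter> fst d))" using assms by (simp add: openin_atlas)
  have "chart_range d = snd d ` (fst d \<inter> fst c) \<union> snd d ` (W \<inter> fst d)"
    using assms(4) points_I[OF assms(2)] by (auto simp: chart_range_def)
  moreover have "smooth_on (snd d ` (W \<inter> fst d)) F"
    using assms(6) by (intro smooth_on_transform[OF smooth_on_const W, of 0]) auto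
  ultimately show ?thesis
    using smooth_on_Un[OF open_overlap[OF assms(2,1)] W assms(5)] by simp
qed

lemma cutoff_exists:
  assumes "c \<in> A" "x \<in> fst c"
  obtains \<psi> where "cutoff c \<psi>" "\<psi> x = 1"
proof -
  obtain B :: "'e set" where B: "orthonormal_basis B" by (rule basis_exists)
  obtain r where r: "r > 0" "cball (snd c x) r \<subseteq> chart_range c"
    using open_chart_range[OF assms(1)] chart_in_range[OF assms(2)] open_contains_cball by blast
  obtain \<rho> :: "'e \<Rightarrow> real" where \<rho>: "smooth_on UNIV \<rho>" "\<rho> (snd c x) = 1" "\<And>z. z \<notin> cball (snd c x) r \<Longrightarrow> \<rho> z = 0"
    using smooth_bump_exists[OF r(1), of "snd c x"] by blast
  \<comment> \<open>\<open>K\<close> contains the support of the bump transported to the manifold;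
    its complement becomes the set \<open>W\<close> of \<open>cutoff\<close>.\<close>
  define K where "K = chart_inv c ` cball (snd c x) r"
  define \<psi> where "\<psi> y = (if y \<in> fst c then \<rho> (snd c y) else 0)" for y
  have "continuous_map (top_of_set (chart_range c)) (atlas_topology A) (chart_inv c)"
    unfolding continuous_map_def
  proof (intro conjI allI impI)
    show "chart_inv c \<in> topspace (top_of_set (chart_range c)) \<rightarrow> topspace (atlas_topology A)"
      using chart_inv_in[of _ c] points_I[OF assms(1)] by (auto simp: topspace_atlas)
    fix W assume "openin (atlas_topology A) W"
    then have "open (snd c ` (W \<inter> fst c))" using assms(1) by (simp add: openin_atlas)
    moreover have "{z \<in> topspace (top_of_set (chart_range c)). chart_inv c z \<in> W} = snd c ` (W \<inter> fst c)"
      using in_image_chart_iff[OF assms(1), of "W \<inter> fst c"] chart_inv_in[of _ c] by auto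
    ultimately show "openin (top_of_set (chart_range c)) {z \<in> topspace (top_of_set (chart_range c)). chart_inv c z \<in> W}"
      by (auto simp: openin_open)
  qed
  moreover have "compactin (top_of_set (chart_range c)) (cball (snd c x) r)"
    using r(2) compact_cball_finite_dim[OF B] by (simp add: compactin_subtopology)
  ultimately have "compactin (atlas_topology A) K"
    unfolding K_def using image_compactin by blast
  \<comment> \<open>The Hausdorff property enters here: a chart-compact set is closed in the whole
    manifold, so extension by zero is smooth.\<close>
  then have "closedin (atlas_topology A) K"
    using manifold compactin_imp_closedin by (auto simp: smooth_manifold_def)
  then have W: "openin (atlas_topology A) (points A - K)"
    by (simp add: closedin_def topspace_atlas)
  have K: "K \<subseteq> fst c" using r(2) chart_inv_in[of _ c] by (auto simp: K_def)
  have \<psi>0: "\<psi> y = 0" if "y \<notin> K" for y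
  proof (cases "y \<in> fst c")
    case True
    have "snd c y \<notin> cball (snd c x) r"
      using that chart_inv_chart[OF assms(1) True] unfolding K_def by (metis imageI)
    then show ?thesis using \<rho>(3) by (simp add: \<psi>_def)
  qed (simp add: \<psi>_def)
  have "smooth_function A \<psi>"
    unfolding smooth_function_def
  proof
    fix d assume d: "d \<in> A"
    show "smooth_on (chart_range d) (\<psi> \<circ> chart_inv d)"
    proof (rule smooth_on_chart_range_glue[OF assms(1) d W])
      show "points A \<subseteq> fst c \<union> (points A - K)" using K by auto
      have "smooth_on (snd d ` (fst d \<inter> fst c)) (\<lambda>z. \<rho> (snd c (chart_inv d z)))"
        using smooth_on_subset[OF \<rho>(1)] by (intro smooth_transition_compose assms d) auto
      then show "smooth_on (snd d ` (fst d \<inter> fst c)) (\<psi> \<circ> chart_inv d)"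
        using smooth_on_cong[OF open_overlap[OF d assms(1)], of "\<lambda>z. \<rho> (snd c (chart_inv d z))" "\<psi> \<circ> chart_inv d"]
        by (simp add: overlap_iff d \<psi>_def)
    qed (simp add: chart_inv_chart d \<psi>0)
  qed
  moreover have "\<forall>y. y \<notin> fst c \<longrightarrow> \<psi> y = 0" by (simp add: \<psi>_def)
  ultimately have "cutoff c \<psi>"
    unfolding cutoff_def using assms(1) W K \<psi>0 by (intro conjI exI[of _ "points A - K"]) auto
  moreover have "\<psi> x = 1" using assms \<rho> by (simp add: \<psi>_def)
  ultimately show thesis by (rule that)
qed

text \<open>The tool for turning local data into global data: \<open>G\<close> is controlled only
  over the overlap with the domain of \<open>c\<close>, and the product with \<open>\<psi>\<close>
  is smooth on the entire chart range.\<close>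

lemma cutoff_smooth:
  assumes "cutoff c \<psi>" "d \<in> A" "smooth_on (snd d ` (fst d \<inter> fst c)) G"
  shows "smooth_on (chart_range d) (\<lambda>z. \<psi> (chart_inv d z) *\<^sub>R G z)"
proof -
  have c: "c \<in> A" using assms by (simp add: cutoff_def)
  obtain W where W: "openin (atlas_topology A) W" "points A \<subseteq> fst c \<union> W" "\<forall>y\<in>W. \<psi> y = 0"
    using assms(1) by (auto simp: cutoff_def)
  show ?thesis
  proof (rule smooth_on_chart_range_glue[OF c assms(2) W(1,2)])
    have "smooth_on (chart_range d) (\<psi> \<circ> chart_inv d)"
      using assms by (auto simp: cutoff_def smooth_function_def)
    then have "smooth_on (snd d ` (fst d \<inter> fst c)) (\<lambda>z. \<psi> (chart_inv d z))"
      using smooth_on_subset[of "chart_range d" "\<psi> \<circ> chart_inv d" "snd d ` (fst d \<inter> fst c)"]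
      by (auto simp: comp_def chart_range_def)
    then show "smooth_on (snd d ` (fst d \<inter> fst c)) (\<lambda>z. \<psi> (chart_inv d z) *\<^sub>R G z)"
      using assms c by (intro smooth_on_scaleR open_overlap)
  qed (simp add: chart_inv_chart assms W)
qed

lemma smooth_function_cutoff:
  assumes "cutoff c \<psi>" "smooth_on (chart_range c) q"
  shows "smooth_function A (\<lambda>y. \<psi> y * q (snd c y))"
  using assms cutoff_smooth[OF assms(1) _ smooth_transition_compose[OF _ _ assms(2)]]
  by (auto simp: smooth_function_def comp_def cutoff_def)

section \<open>Smooth sections as modules over the smooth functions\<close>

lemma smooth_function_const: "smooth_function A (\<lambda>y. r)"
  by (simp add: smooth_function_def comp_def smooth_on_const)

lemma smooth_function_mult:
  "smooth_function A f \<Longrightarrow> smooth_function A g \<Longrightarrow> smooth_function A (\<lambda>y. f y * g y)"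
  by (auto simp: smooth_function_def comp_def intro: smooth_on_mult open_chart_range)

lemma smooth_vf_add: "smooth_vf A Y \<Longrightarrow> smooth_vf A Z \<Longrightarrow> smooth_vf A (\<lambda>y. Y y + Z y)"
  unfolding smooth_vf_def vf_in_def Let_def blinfun.add_right
  by (auto intro: smooth_on_add open_chart_range)

lemma smooth_vf_scale: "smooth_function A f \<Longrightarrow> smooth_vf A Y \<Longrightarrow> smooth_vf A (\<lambda>y. f y *\<^sub>R Y y)"
  unfolding smooth_vf_def vf_in_def Let_def blinfun.scaleR_right smooth_function_def comp_def
  by (auto intro: smooth_on_scaleR open_chart_range)

lemma smooth_form_add: "smooth_form A \<alpha> \<Longrightarrow> smooth_form A \<beta> \<Longrightarrow> smooth_form A (\<lambda>y. \<alpha> y + \<beta> y)"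
proof -
  have *: "form_in A c (\<lambda>y. \<alpha> y + \<beta> y) = (\<lambda>z. form_in A c \<alpha> z + form_in A c \<beta> z)" for c
    by (intro ext blinfun_eqI) (simp add: form_in_def Let_def blinfun.add_left)
  show "smooth_form A \<alpha> \<Longrightarrow> smooth_form A \<beta> \<Longrightarrow> smooth_form A (\<lambda>y. \<alpha> y + \<beta> y)"
    unfolding smooth_form_def * by (auto intro: smooth_on_add open_chart_range)
qed

lemma smooth_form_scale: "smooth_function A f \<Longrightarrow> smooth_form A \<alpha> \<Longrightarrow> smooth_form A (\<lambda>y. f y *\<^sub>R \<alpha> y)"
proof -
  have *: "form_in A c (\<lambda>y. f y *\<^sub>R \<alpha> y) = (\<lambda>z. f (chart_inv c z) *\<^sub>R form_in A c \<alpha> z)" for c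
    by (intro ext blinfun_eqI) (simp add: form_in_def Let_def blinfun.scaleR_left)
  show "smooth_function A f \<Longrightarrow> smooth_form A \<alpha> \<Longrightarrow> smooth_form A (\<lambda>y. f y *\<^sub>R \<alpha> y)"
    unfolding smooth_form_def * smooth_function_def comp_def by (auto intro: smooth_on_scaleR open_chart_range)
qed

text \<open>
  Outside \<open>fst c\<close> the coordinate change is a junk value, which \<open>\<psi> y = 0\<close> annihilates.
\<close>

definition frame_vf :: "('p, 'e) chart \<Rightarrow> ('p \<Rightarrow> real) \<Rightarrow> 'e \<Rightarrow> 'p \<Rightarrow> 'e" where
  "frame_vf c \<psi> b y = \<psi> y *\<^sub>R coord_change c (chart_at A y) y b"

definition frame_form :: "('p, 'e) chart \<Rightarrow> ('p \<Rightarrow> real) \<Rightarrow> 'e \<Rightarrow> 'p \<Rightarrow> 'e \<Rightarrow>\<^sub>L real" where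
  "frame_form c \<psi> b y = \<psi> y *\<^sub>R (blinfun_inner_left b o\<^sub>L coord_change (chart_at A y) c y)"

text \<open>The preferred chart varies erratically with the point, so it has to be eliminated first:
  by the cocycle rule the component in a fixed chart \<open>d\<close> is \<open>\<psi>\<close> times
  the derivative of the transition map in direction \<open>b\<close>.\<close>

lemma smooth_frame_vf:
  assumes "cutoff c \<psi>"
  shows "smooth_vf A (frame_vf c \<psi> b)"
  unfolding smooth_vf_def
proof
  fix d assume d: "d \<in> A"
  have c: "c \<in> A" using assms by (simp add: cutoff_def)
  let ?G = "\<lambda>z. frechet_derivative (snd d \<circ> chart_inv c) (at (snd c (chart_inv d z))) b"
  obtain B :: "'e set" where B: "orthonormal_basis B" by (rule basis_exists)
  have "smooth_on (snd d ` (fst d \<inter> fst c))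
      (\<lambda>z. (\<lambda>z. frechet_derivative (snd d \<circ> chart_inv c) (at z) b) ((snd c \<circ> chart_inv d) z))"
    by (rule smooth_on_compose[OF B open_overlap[OF d c] open_overlap[OF c d] _ transition_smooth[OF d c]
          smooth_on_frechet_derivative[OF transition_smooth[OF c d]]])
      (auto simp: chart_inv_chart c d)
  then have "smooth_on (chart_range d) (\<lambda>z. \<psi> (chart_inv d z) *\<^sub>R ?G z)"
    by (intro cutoff_smooth[OF assms d]) simp
  moreover have "\<psi> (chart_inv d z) *\<^sub>R ?G z = vf_in A d (frame_vf c \<psi> b) z" if z: "z \<in> chart_range d" for z
  proof (cases "chart_inv d z \<in> fst c")
    case True
    define y where "y = chart_inv d z"
    have y: "y \<in> fst d" "y \<in> fst c" "y \<in> points A" using True z chart_inv_in[of z d] points_I[OF c, of y] by (simp_all add: y_def)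
    then show ?thesis
      using c d coord_change_comp[of c "chart_at A y" d y b]
      by (simp add: vf_in_def frame_vf_def y_def[symmetric] blinfun.scaleR_right chart_at
          frechet_derivative_eq[OF coord_change_has_derivative])
  next
    case False
    then have "\<psi> (chart_inv d z) = 0" using assms by (simp add: cutoff_def)
    then show ?thesis by (simp add: vf_in_def frame_vf_def)
  qed
  ultimately show "smooth_on (chart_range d) (vf_in A d (frame_vf c \<psi> b))"
    by (rule smooth_on_transform[OF _ open_chart_range[OF d]])
qed

text \<open>Evaluating on a constant vector leaves a coordinate of the derivative of the transition
  map, in the opposite direction to the one for frame fields.\<close>

lemma smooth_frame_form:
  assumes "cutoff c \<psi>"
  shows "smooth_form A (frame_form c \<psi> b)"
  unfolding smooth_form_def
proof
  fix d assume d: "d \<in> A"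
  have c: "c \<in> A" using assms by (simp add: cutoff_def)
  obtain B :: "'e set" where B: "orthonormal_basis B" by (rule basis_exists)
  show "smooth_on (chart_range d) (form_in A d (frame_form c \<psi> b))"
  proof (rule smooth_on_blinfun[OF B open_chart_range[OF d]])
    fix v :: 'e
    let ?G = "\<lambda>z. frechet_derivative (snd c \<circ> chart_inv d) (at z) v \<bullet> b"
    have "smooth_on (chart_range d) (\<lambda>z. \<psi> (chart_inv d z) *\<^sub>R ?G z)"
      by (rule cutoff_smooth[OF assms d], rule smooth_on_bounded_linear[OF bounded_linear_inner_left])
        (auto intro: open_overlap smooth_on_frechet_derivative transition_smooth c d)
    moreover have "\<psi> (chart_inv d z) *\<^sub>R ?G z = form_in A d (frame_form c \<psi> b) z v" if z: "z \<in> chart_range d" for z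
    proof (cases "chart_inv d z \<in> fst c")
      case True
      define y where "y = chart_inv d z"
      have y: "y \<in> fst d" "y \<in> fst c" "y \<in> points A" using True z chart_inv_in[of z d] points_I[OF c, of y] by (simp_all add: y_def)
      have zy: "z = snd d y" using z by (simp add: y_def chart_chart_inv)
      show ?thesis
        using c d y coord_change_comp[of d "chart_at A y" c y v]
        unfolding zy
        by (simp add: form_in_chart frame_form_def chart_inv_chart blinfun.scaleR_left chart_at
            frechet_derivative_eq[OF coord_change_has_derivative])
    next
      case False
      then have "\<psi> (chart_inv d z) = 0" using assms by (simp add: cutoff_def)
      then show ?thesis by (simp add: form_in_def frame_form_def)
    qed
    ultimately show "smooth_on (chart_range d) (\<lambda>z. form_in A d (frame_form c \<psi> b) z v)"
      by (rule smooth_on_transform[OF _ open_chart_range[OF d]])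
  qed
qed

text \<open>One factor \<open>\<psi>\<close> makes the coefficients global smooth functions, the
  other is part of the frame fields; hence the square. It is harmless where \<open>\<psi>\<close> is
  1.\<close>

lemma frame_vf_expand:
  assumes "cutoff c \<psi>" "orthonormal_basis B"
  shows "(\<Sum>b\<in>B. (\<psi> y * (vf_in A c Y (snd c y) \<bullet> b)) *\<^sub>R frame_vf c \<psi> b y) = (\<psi> y * \<psi> y) *\<^sub>R Y y"
proof (cases "y \<in> fst c")
  case True
  have c: "c \<in> A" using assms by (simp add: cutoff_def)
  note y = points_I[OF c True]
  have "(\<Sum>b\<in>B. (vf_in A c Y (snd c y) \<bullet> b) *\<^sub>R coord_change c (chart_at A y) y b) = Y y"
    by (subst linear_expand[OF assms(2), symmetric])
      (auto simp: bounded_linear.linear blinfun.bounded_linear_right vf_in_chart coord_change_inverse c True y chart_at)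
  moreover have "(\<Sum>b\<in>B. (\<psi> y * (vf_in A c Y (snd c y) \<bullet> b)) *\<^sub>R frame_vf c \<psi> b y) =
      (\<psi> y * \<psi> y) *\<^sub>R (\<Sum>b\<in>B. (vf_in A c Y (snd c y) \<bullet> b) *\<^sub>R coord_change c (chart_at A y) y b)"
    by (simp add: frame_vf_def scaleR_sum_right mult_ac)
  ultimately show ?thesis by simp
next
  case False
  then have "\<psi> y = 0" using assms by (simp add: cutoff_def)
  then show ?thesis by simp
qed

lemma frame_form_expand:
  assumes "cutoff c \<psi>" "orthonormal_basis B"
  shows "(\<Sum>b\<in>B. (\<psi> y * form_in A c \<alpha> (snd c y) b) *\<^sub>R frame_form c \<psi> b y) = (\<psi> y * \<psi> y) *\<^sub>R \<alpha> y"
proof (cases "y \<in> fst c")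
  case True
  have c: "c \<in> A" using assms by (simp add: cutoff_def)
  note y = points_I[OF c True]
  have "\<alpha> y u = (\<Sum>b\<in>B. form_in A c \<alpha> (snd c y) b * (coord_change (chart_at A y) c y u \<bullet> b))" for u
  proof -
    have "\<alpha> y u = form_in A c \<alpha> (snd c y) (coord_change (chart_at A y) c y u)"
      by (simp add: form_in_chart coord_change_inverse c True y chart_at)
    also have "\<dots> = (\<Sum>b\<in>B. (coord_change (chart_at A y) c y u \<bullet> b) *\<^sub>R form_in A c \<alpha> (snd c y) b)"
      by (rule linear_expand[OF assms(2)]) (simp add: bounded_linear.linear blinfun.bounded_linear_right)
    finally show ?thesis by (simp add: mult_ac)
  qed
  then have "(\<psi> y * \<psi> y) * \<alpha> y u = (\<Sum>b\<in>B. (\<psi> y * form_in A c \<alpha> (snd c y) b) * (\<psi> y * (coord_change (chart_at A y) c y u \<bullet> b)))" for u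
    by (simp add: sum_distrib_left mult_ac)
  then show ?thesis
    by (intro blinfun_eqI) (simp add: blinfun.sum_left blinfun.scaleR_left frame_form_def mult.assoc)
next
  case False
  then have "\<psi> y = 0" using assms by (simp add: cutoff_def)
  then show ?thesis by simp
qed

lemma smooth_vf_coeff:
  assumes "cutoff c \<psi>" "smooth_vf A Y"
  shows "smooth_function A (\<lambda>y. \<psi> y * (vf_in A c Y (snd c y) \<bullet> b))"
  using assms by (intro smooth_function_cutoff smooth_on_bounded_linear[OF bounded_linear_inner_left])
    (auto simp: smooth_vf_def cutoff_def open_chart_range)

lemma smooth_form_coeff:
  assumes "cutoff c \<psi>" "smooth_form A \<alpha>"
  shows "smooth_function A (\<lambda>y. \<psi> y * form_in A c \<alpha> (snd c y) b)"
  using assms by (intro smooth_function_cutoff smooth_on_bounded_linear[OF blinfun.bounded_linear_left])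
    (auto simp: smooth_form_def cutoff_def open_chart_range)

text \<open>
  Multiplying \<open>s\<close> by a cut-off function does not change \<open>T s\<close>, and turns a local expansion in a
  frame into a global one.
\<close>

lemma tensorial:
  fixes T :: "('p \<Rightarrow> 'v::real_vector) \<Rightarrow> real"
  assumes S_add: "\<And>s t. S s \<Longrightarrow> S t \<Longrightarrow> S (\<lambda>y. s y + t y)"
    and S_scale: "\<And>f s. smooth_function A f \<Longrightarrow> S s \<Longrightarrow> S (\<lambda>y. f y *\<^sub>R s y)"
    and T_add: "\<And>s t. S s \<Longrightarrow> S t \<Longrightarrow> T (\<lambda>y. s y + t y) = T s + T t"
    and T_scale: "\<And>f s. smooth_function A f \<Longrightarrow> S s \<Longrightarrow> T (\<lambda>y. f y *\<^sub>R s y) = f x * T s"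
    and "finite I" "\<And>i. i \<in> I \<Longrightarrow> smooth_function A (a i)" "\<And>i. i \<in> I \<Longrightarrow> S (E i)"
    and s: "S s" and "smooth_function A \<rho>" "\<rho> x = 1"
    and expand: "\<And>y. (\<Sum>i\<in>I. a i y *\<^sub>R E i y) = \<rho> y *\<^sub>R s y"
  shows "T s = (\<Sum>i\<in>I. a i x * T (E i))"
proof -
  have "S (\<lambda>y. \<Sum>i\<in>I. a i y *\<^sub>R E i y) \<and> T (\<lambda>y. \<Sum>i\<in>I. a i y *\<^sub>R E i y) = (\<Sum>i\<in>I. a i x * T (E i))"
    using assms(5,6,7)
  proof (induction I)
    case empty
    \<comment> \<open>The zero section is \<open>s\<close> multiplied by the zero function; this
      yields both its admissibility and \<open>T 0 = 0\<close>.\<close>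
    show ?case using S_scale[OF smooth_function_const[of 0] s] T_scale[OF smooth_function_const[of 0] s] by simp
  next
    case (insert i I)
    then show ?case
      using S_scale[of "a i" "E i"] T_scale[of "a i" "E i"]
        S_add[of "\<lambda>y. a i y *\<^sub>R E i y" "\<lambda>y. \<Sum>i\<in>I. a i y *\<^sub>R E i y"]
        T_add[of "\<lambda>y. a i y *\<^sub>R E i y" "\<lambda>y. \<Sum>i\<in>I. a i y *\<^sub>R E i y"]
      by simp
  qed
  then show ?thesis using T_scale[OF assms(9) s] assms(10) by (simp add: expand)
qed

text \<open>At \<open>x\<close> the cut-off equals 1, so \<open>T\<close> is determined by its
  values on the frame fields; these values are the coefficients of the covector.\<close>

lemma tensorial_vf:
  assumes "\<And>Y Z. smooth_vf A Y \<Longrightarrow> smooth_vf A Z \<Longrightarrow> T (\<lambda>y. Y y + Z y) = T Y + T Z"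
    and "\<And>f Y. smooth_function A f \<Longrightarrow> smooth_vf A Y \<Longrightarrow> T (\<lambda>y. f y *\<^sub>R Y y) = f x * T Y"
    and "x \<in> points A"
  obtains \<theta> :: "'e \<Rightarrow>\<^sub>L real" where "\<And>Y. smooth_vf A Y \<Longrightarrow> T Y = \<theta> (Y x)"
proof -
  define c where "c = chart_at A x"
  obtain \<psi> where \<psi>: "cutoff c \<psi>" "\<psi> x = 1"
    using cutoff_exists[of c x] chart_at[OF assms(3)] c_def by auto
  obtain B :: "'e set" where B: "orthonormal_basis B" by (rule basis_exists)
  have "T Y = (\<Sum>b\<in>B. (\<psi> x * (vf_in A c Y (snd c x) \<bullet> b)) * T (frame_vf c \<psi> b))" if Y: "smooth_vf A Y" for Y
  proof (rule tensorial[where S = "smooth_vf A" and T = T and I = B and \<rho> = "\<lambda>y. \<psi> y * \<psi> y"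
        and a = "\<lambda>b y. \<psi> y * (vf_in A c Y (snd c y) \<bullet> b)" and E = "frame_vf c \<psi>"])
    show "finite B" using B by (simp add: orthonormal_basis_def)
    show "smooth_function A (\<lambda>y. \<psi> y * \<psi> y)" using \<psi> by (simp add: cutoff_def smooth_function_mult)
  qed (simp_all add: assms Y B \<psi> smooth_vf_add smooth_vf_scale smooth_vf_coeff smooth_frame_vf frame_vf_expand)
  then have "T Y = (\<Sum>b\<in>B. T (frame_vf c \<psi> b) *\<^sub>R blinfun_inner_left b) (Y x)" if "smooth_vf A Y" for Y
    using that assms(3) unfolding c_def
    by (simp add: \<psi>(2) vf_in_chart_at blinfun.sum_left blinfun.scaleR_left mult.commute)
  then show thesis by (rule that)
qed

text \<open>As for fields; finite dimensionality makes the representing object a tangent vector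
  instead of an element of the bidual.\<close>

lemma tensorial_form:
  assumes "\<And>\<alpha> \<beta>. smooth_form A \<alpha> \<Longrightarrow> smooth_form A \<beta> \<Longrightarrow> T (\<lambda>y. \<alpha> y + \<beta> y) = T \<alpha> + T \<beta>"
    and "\<And>f \<alpha>. smooth_function A f \<Longrightarrow> smooth_form A \<alpha> \<Longrightarrow> T (\<lambda>y. f y *\<^sub>R \<alpha> y) = f x * T \<alpha>"
    and "x \<in> points A"
  obtains u :: 'e where "\<And>\<alpha>. smooth_form A \<alpha> \<Longrightarrow> T \<alpha> = \<alpha> x u"
proof -
  define c where "c = chart_at A x"
  obtain \<psi> where \<psi>: "cutoff c \<psi>" "\<psi> x = 1"
    using cutoff_exists[of c x] chart_at[OF assms(3)] c_def by auto
  obtain B :: "'e set" where B: "orthonormal_basis B" by (rule basis_exists)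
  have "T \<alpha> = (\<Sum>b\<in>B. (\<psi> x * form_in A c \<alpha> (snd c x) b) * T (frame_form c \<psi> b))" if \<alpha>: "smooth_form A \<alpha>" for \<alpha>
  proof (rule tensorial[where S = "smooth_form A" and T = T and I = B and \<rho> = "\<lambda>y. \<psi> y * \<psi> y"
        and a = "\<lambda>b y. \<psi> y * form_in A c \<alpha> (snd c y) b" and E = "frame_form c \<psi>"])
    show "finite B" using B by (simp add: orthonormal_basis_def)
    show "smooth_function A (\<lambda>y. \<psi> y * \<psi> y)" using \<psi> by (simp add: cutoff_def smooth_function_mult)
  qed (simp_all add: assms \<alpha> B \<psi> smooth_form_add smooth_form_scale smooth_form_coeff smooth_frame_form frame_form_expand)
  then have "T \<alpha> = \<alpha> x (\<Sum>b\<in>B. T (frame_form c \<psi> b) *\<^sub>R b)" if "smooth_form A \<alpha>" for \<alpha>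
    using that assms(3) unfolding c_def
    by (simp add: \<psi>(2) form_in_chart_at blinfun.sum_right blinfun.scaleR_right mult.commute)
  then show thesis by (rule that)
qed

lemma smooth_vf_through:
  assumes "x \<in> points A"
  obtains Y where "smooth_vf A Y" "Y x = w"
proof -
  obtain \<psi> where \<psi>: "cutoff (chart_at A x) \<psi>" "\<psi> x = 1"
    using cutoff_exists chart_at[OF assms] by blast
  show thesis
    by (rule that[OF smooth_frame_vf[OF \<psi>(1), of w]])
      (simp add: frame_vf_def \<psi> coord_change_id chart_at assms)
qed

end

section \<open>Differentials and covariant derivatives\<close>

text \<open>Asserts differentiability together with the value. The equation
  \<open>dif A f x = D\<close> alone would not, since \<open>frechet_derivative\<close> returns an
  unspecified value where no derivative exists.\<close>

definition has_dif :: "('p, 'e::real_normed_vector) chart set \<Rightarrow> ('p \<Rightarrow> real) \<Rightarrow> 'p \<Rightarrow> ('e \<Rightarrow>\<^sub>L real) \<Rightarrow> bool" where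
  "has_dif A f x D \<longleftrightarrow>
     ((\<lambda>z. f (chart_inv (chart_at A x) z)) has_derivative D) (at (snd (chart_at A x) x))"

lemma dif_eqI: "has_dif A f x D \<Longrightarrow> dif A f x = D"
  by (simp add: has_dif_def dif_def comp_def frechet_derivative_eq blinfun_apply_inverse)

lemma has_dif_difI:
  assumes "(\<lambda>z. f (chart_inv (chart_at A x) z)) differentiable (at (snd (chart_at A x) x))"
  shows "has_dif A f x (dif A f x)"
  using assms unfolding has_dif_def dif_def comp_def frechet_derivative_works
  by (subst bounded_linear_Blinfun_apply) (auto intro: has_derivative_bounded_linear)

lemma has_dif_add: "has_dif A f x D \<Longrightarrow> has_dif A g x E \<Longrightarrow> has_dif A (\<lambda>y. f y + g y) x (D + E)"
  unfolding has_dif_def plus_blinfun.rep_eq by (rule has_derivative_add)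

context manifold
begin

lemma has_dif_mult:
  assumes "x \<in> points A" "has_dif A f x D" "has_dif A g x E"
  shows "has_dif A (\<lambda>y. f y * g y) x (f x *\<^sub>R E + g x *\<^sub>R D)"
proof -
  have "((\<lambda>z. f (chart_inv (chart_at A x) z) * g (chart_inv (chart_at A x) z)) has_derivative
      (\<lambda>h. f (chart_inv (chart_at A x) (snd (chart_at A x) x)) * E h +
           D h * g (chart_inv (chart_at A x) (snd (chart_at A x) x)))) (at (snd (chart_at A x) x))"
    using assms unfolding has_dif_def by (intro has_derivative_mult)
  then show ?thesis
    using assms(1) unfolding has_dif_def
    by (simp add: chart_inv_chart chart_at plus_blinfun.rep_eq scaleR_blinfun.rep_eq mult.commute)
qed

lemma smooth_function_has_dif:
  assumes "smooth_function A f" "x \<in> points A"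
  shows "has_dif A f x (dif A f x)"
proof (rule has_dif_difI)
  have "smooth_on (chart_range (chart_at A x)) (f \<circ> chart_inv (chart_at A x))"
    using assms chart_at_in unfolding smooth_function_def by blast
  from smooth_on_differentiable[OF this chart_in_range[OF in_chart_at[OF assms(2)]]]
  show "(\<lambda>z. f (chart_inv (chart_at A x) z)) differentiable (at (snd (chart_at A x) x))"
    by (simp add: comp_def)
qed

lemma has_dif_chart:
  assumes "has_dif A f x D" "c \<in> A" "x \<in> fst c"
  shows "((\<lambda>z. f (chart_inv c z)) has_derivative (\<lambda>u. D (coord_change c (chart_at A x) x u))) (at (snd c x))"
  using assms points_I[OF assms(2,3)]
  by (intro has_derivative_change_chart) (auto simp: chart_at has_dif_def)

text \<open>A cut-off times an affine function of the coordinates. The affine factor vanishes at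
  \<open>x\<close>, so the differential of the cut-off does not contribute.\<close>

lemma smooth_function_with_dif:
  assumes "x \<in> points A"
  obtains f where "smooth_function A f" "f x = 0" "dif A f x = D"
proof -
  define c where "c = chart_at A x"
  have c: "c \<in> A" "x \<in> fst c" using assms by (simp_all add: c_def chart_at)
  obtain \<psi> where \<psi>: "cutoff c \<psi>" "\<psi> x = 1" by (rule cutoff_exists[OF c])
  have "smooth_on (chart_range c) (\<lambda>z. D (z + (- snd c x)))"
    by (rule smooth_on_bounded_linear[OF blinfun.bounded_linear_right open_chart_range[OF c(1)]])
      (intro smooth_on_add smooth_on_const smooth_on_ident open_chart_range c)
  then have 1: "smooth_function A (\<lambda>y. \<psi> y * D (snd c y + (- snd c x)))"
    by (rule smooth_function_cutoff[OF \<psi>(1)])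
  have "((\<lambda>z. D (z + (- snd c x))) has_derivative D) (at (snd c x))"
    by (auto intro!: derivative_eq_intros bounded_linear.has_derivative[OF blinfun.bounded_linear_right]
        simp: blinfun.add_right blinfun.diff_right)
  then have "((\<lambda>z. D (snd c (chart_inv c z) + (- snd c x))) has_derivative D) (at (snd c x))"
    by (rule has_derivative_transform_within_open[OF _ open_chart_range[OF c(1)] chart_in_range[OF c(2)]])
      (simp add: chart_chart_inv)
  then have 2: "has_dif A (\<lambda>y. D (snd c y + (- snd c x))) x D"
    by (simp add: has_dif_def c_def)
  have "smooth_function A \<psi>" using \<psi>(1) by (simp add: cutoff_def)
  from dif_eqI[OF has_dif_mult[OF assms smooth_function_has_dif[OF this assms] 2]]
  have "dif A (\<lambda>y. \<psi> y * D (snd c y + (- snd c x))) x = D"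
    by (simp add: \<psi>)
  then show thesis using 1 by (intro that) auto
qed

lemma form_in_dif:
  assumes "smooth_function A f" "c \<in> A" "z \<in> chart_range c"
  shows "blinfun_apply (form_in A c (dif A f) z) = frechet_derivative (f \<circ> chart_inv c) (at z)"
proof -
  define x where "x = chart_inv c z"
  have x: "x \<in> fst c" "z = snd c x"
    using assms chart_inv_in[of z c] chart_chart_inv[of z c] by (auto simp: x_def)
  note p = points_I[OF assms(2) x(1)]
  show ?thesis
    using has_dif_chart[OF smooth_function_has_dif[OF assms(1) p] assms(2) x(1)] unfolding x(2)
    by (simp add: frechet_derivative_eq comp_def form_in_chart assms(2) x(1) blinfun_compose.rep_eq)
qed

lemma smooth_form_dif:
  assumes "smooth_function A f"
  shows "smooth_form A (dif A f)"
  unfolding smooth_form_def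
proof
  fix c assume c: "c \<in> A"
  obtain B :: "'e set" where B: "orthonormal_basis B" by (rule basis_exists)
  show "smooth_on (chart_range c) (form_in A c (dif A f))"
  proof (rule smooth_on_blinfun[OF B open_chart_range[OF c]])
    fix v
    have "smooth_on (chart_range c) (\<lambda>z. frechet_derivative (f \<circ> chart_inv c) (at z) v)"
      using assms c by (intro smooth_on_frechet_derivative) (simp add: smooth_function_def)
    then show "smooth_on (chart_range c) (\<lambda>z. form_in A c (dif A f) z v)"
      by (rule smooth_on_transform) (simp_all add: open_chart_range c form_in_dif assms)
  qed
qed

lemma form_in_has_derivative:
  assumes "smooth_form A \<alpha>" "c \<in> A" "z \<in> chart_range c"
  shows "(form_in A c \<alpha> has_derivative frechet_derivative (form_in A c \<alpha>) (at z)) (at z)"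
  using assms by (intro smooth_on_has_derivative) (auto simp: smooth_form_def)

lemma vf_in_has_derivative:
  assumes "smooth_vf A Y" "c \<in> A" "z \<in> chart_range c"
  shows "(vf_in A c Y has_derivative frechet_derivative (vf_in A c Y) (at z)) (at z)"
  using assms by (intro smooth_on_has_derivative) (auto simp: smooth_vf_def)

text \<open>In the preferred chart the exterior derivative of df is the difference of the two mixed
  second derivatives of the coordinate expression of \<open>f\<close>.\<close>

lemma closed_form_dif:
  assumes "smooth_function A f"
  shows "closed_form A (dif A f)"
  unfolding closed_form_def
proof (intro conjI ballI allI)
  show "smooth_form A (dif A f)" using assms by (rule smooth_form_dif)
  fix x u w assume x: "x \<in> points A"
  define c where "c = chart_at A x"
  have c: "c \<in> A" "snd c x \<in> chart_range c" using x by (simp_all add: c_def chart_at chart_in_range)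
  have *: "frechet_derivative (form_in A c (dif A f)) (at (snd c x)) u w =
      frechet_derivative (\<lambda>z. frechet_derivative (f \<circ> chart_inv c) (at z) w) (at (snd c x)) u" for u w
  proof -
    have "((\<lambda>z. form_in A c (dif A f) z w) has_derivative
        (\<lambda>u. frechet_derivative (form_in A c (dif A f)) (at (snd c x)) u w)) (at (snd c x))"
      by (rule bounded_linear.has_derivative[OF blinfun.bounded_linear_left])
        (rule form_in_has_derivative[OF smooth_form_dif[OF assms] c])
    then have "((\<lambda>z. frechet_derivative (f \<circ> chart_inv c) (at z) w) has_derivative
        (\<lambda>u. frechet_derivative (form_in A c (dif A f)) (at (snd c x)) u w)) (at (snd c x))"
      by (rule has_derivative_transform_within_open[OF _ open_chart_range[OF c(1)] c(2)])
        (simp add: form_in_dif assms c)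
    from frechet_derivative_eq[OF this] show ?thesis by simp
  qed
  have "C_diff 2 (f \<circ> chart_inv c) (chart_range c)"
    using assms c(1) by (auto simp: smooth_function_def smooth_on_def)
  from second_derivative_symmetric[OF this open_chart_range[OF c(1)] c(2)]
  show "ext_derivative A (dif A f) x u w = 0"
    unfolding ext_derivative_def Let_def c_def[symmetric] * by simp
qed

lemma
  assumes "smooth_form A \<alpha>" "smooth_vf A Y" "x \<in> points A"
  shows has_dif_pairing: "has_dif A (\<lambda>y. \<alpha> y (Y y)) x (dif A (\<lambda>y. \<alpha> y (Y y)) x)"
    and dif_pairing: "dif A (\<lambda>y. \<alpha> y (Y y)) x u =
      frechet_derivative (form_in A (chart_at A x) \<alpha>) (at (snd (chart_at A x) x)) u (Y x) +
      \<alpha> x (frechet_derivative (vf_in A (chart_at A x) Y) (at (snd (chart_at A x) x)) u)"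
proof -
  define c where "c = chart_at A x"
  have c: "c \<in> A" "snd c x \<in> chart_range c" using assms(3) by (simp_all add: c_def chart_at chart_in_range)
  have "((\<lambda>z. form_in A c \<alpha> z (vf_in A c Y z)) has_derivative
      (\<lambda>u. form_in A c \<alpha> (snd c x) (frechet_derivative (vf_in A c Y) (at (snd c x)) u) +
           frechet_derivative (form_in A c \<alpha>) (at (snd c x)) u (vf_in A c Y (snd c x)))) (at (snd c x))"
    by (intro blinfun.FDERIV form_in_has_derivative vf_in_has_derivative assms c)
  then have D: "((\<lambda>z. \<alpha> (chart_inv c z) (Y (chart_inv c z))) has_derivative
      (\<lambda>u. form_in A c \<alpha> (snd c x) (frechet_derivative (vf_in A c Y) (at (snd c x)) u) +
           frechet_derivative (form_in A c \<alpha>) (at (snd c x)) u (vf_in A c Y (snd c x)))) (at (snd c x))"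
    by (rule has_derivative_transform_within_open[OF _ open_chart_range[OF c(1)] c(2)])
      (simp add: form_in_vf_in c)
  then have "(\<lambda>z. \<alpha> (chart_inv c z) (Y (chart_inv c z))) differentiable (at (snd c x))"
    by (auto simp: differentiable_def)
  then show d: "has_dif A (\<lambda>y. \<alpha> y (Y y)) x (dif A (\<lambda>y. \<alpha> y (Y y)) x)"
    unfolding c_def by (rule has_dif_difI)
  have "blinfun_apply (dif A (\<lambda>y. \<alpha> y (Y y)) x) =
      (\<lambda>u. form_in A c \<alpha> (snd c x) (frechet_derivative (vf_in A c Y) (at (snd c x)) u) +
           frechet_derivative (form_in A c \<alpha>) (at (snd c x)) u (vf_in A c Y (snd c x)))"
    using d D unfolding has_dif_def c_def by (rule has_derivative_unique)
  then show "dif A (\<lambda>y. \<alpha> y (Y y)) x u =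
      frechet_derivative (form_in A (chart_at A x) \<alpha>) (at (snd (chart_at A x) x)) u (Y x) +
      \<alpha> x (frechet_derivative (vf_in A (chart_at A x) Y) (at (snd (chart_at A x) x)) u)"
    unfolding c_def by (simp add: form_in_chart_at vf_in_chart_at assms(3))
qed

lemma has_dif_tensor_pairing:
  assumes "smooth_tensor A T" "smooth_form A \<alpha>" "smooth_form A \<beta>" "x \<in> points A"
  shows "has_dif A (\<lambda>y. T y (\<alpha> y) (\<beta> y)) x (dif A (\<lambda>y. T y (\<alpha> y) (\<beta> y)) x)"
proof (rule has_dif_difI)
  define c where "c = chart_at A x"
  have c: "c \<in> A" "snd c x \<in> chart_range c" using assms(4) by (simp_all add: c_def chart_at chart_in_range)
  have "smooth_on (chart_range c) (\<lambda>z. tensor_in A c T z (form_in A c \<alpha> z) (form_in A c \<beta> z))"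
    using assms c(1)
    by (intro smooth_on_blinfun_apply open_chart_range) (auto simp: smooth_tensor_def smooth_form_def)
  then have "smooth_on (chart_range c) (\<lambda>z. T (chart_inv c z) (\<alpha> (chart_inv c z)) (\<beta> (chart_inv c z)))"
    by (rule smooth_on_transform) (simp_all add: open_chart_range c tensor_in_form_in)
  from smooth_on_differentiable[OF this c(2)]
  show "(\<lambda>z. T (chart_inv (chart_at A x) z) (\<alpha> (chart_inv (chart_at A x) z)) (\<beta> (chart_inv (chart_at A x) z)))
    differentiable (at (snd (chart_at A x) x))"
    by (simp add: c_def)
qed

text \<open>Reflexivity in finite dimension: the vector is assembled from the values of
  \<open>T \<alpha>\<close> on the dual basis, and covectors separate vectors, so \<open>THE\<close>
  is meaningful.\<close>

lemma anchor_apply: "blinfun_apply \<beta> (anchor T \<alpha>) = T \<alpha> (\<beta> :: 'e \<Rightarrow>\<^sub>L real)"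
proof -
  obtain B :: "'e set" where B: "orthonormal_basis B" by (rule basis_exists)
  define u where "u = (\<Sum>b\<in>B. T \<alpha> (blinfun_inner_left b) *\<^sub>R b)"
  have u: "blinfun_apply \<beta> u = T \<alpha> \<beta>" for \<beta>
  proof -
    have "\<beta> = (\<Sum>b\<in>B. \<beta> b *\<^sub>R blinfun_inner_left b)"
      by (rule blinfun_eqI, subst linear_expand[OF B bounded_linear.linear[OF blinfun.bounded_linear_right]])
        (simp add: blinfun.sum_left blinfun.scaleR_left mult.commute)
    then have "T \<alpha> \<beta> = T \<alpha> (\<Sum>b\<in>B. \<beta> b *\<^sub>R blinfun_inner_left b)" by simp
    also have "\<dots> = blinfun_apply \<beta> u"
      by (simp add: u_def blinfun.sum_right blinfun.scaleR_right mult.commute)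
    finally show ?thesis by simp
  qed
  have "\<forall>\<beta>. blinfun_apply \<beta> (anchor T \<alpha>) = T \<alpha> \<beta>"
    unfolding anchor_def
  proof (rule theI)
    show "\<forall>\<beta>. blinfun_apply \<beta> u = T \<alpha> \<beta>" using u by simp
    fix w assume w: "\<forall>\<beta>. blinfun_apply \<beta> w = T \<alpha> \<beta>"
    have "(w - u) \<bullet> (w - u) = 0"
      using u[of "blinfun_inner_left (w - u)"] w[rule_format, of "blinfun_inner_left (w - u)"]
      by (simp add: inner_diff_left)
    then show "w = u" by simp
  qed
  then show ?thesis by simp
qed

end

text \<open>The tensor product of \<open>u\<close> and \<open>w\<close>, with \<open>ev\<close> the
  embedding of vectors into the bidual.\<close>

lemma elementary_tensor_exists:
  obtains T :: "'e::real_normed_vector tensor2" where "\<And>(\<alpha> :: 'e \<Rightarrow>\<^sub>L real) (\<beta> :: 'e \<Rightarrow>\<^sub>L real). blinfun_apply (blinfun_apply T \<alpha>) \<beta> = \<alpha> u * \<beta> w"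
proof -
  define ev where "ev u = Blinfun (\<lambda>\<alpha> :: 'e \<Rightarrow>\<^sub>L real. \<alpha> u)" for u
  have ev: "ev u \<alpha> = \<alpha> u" for u \<alpha>
    unfolding ev_def by (simp add: bounded_linear_Blinfun_apply blinfun.bounded_linear_left)
  show thesis
    by (rule that[of "blinfun_scaleR_left (ev w) o\<^sub>L ev u"]) (simp add: ev blinfun.scaleR_left)
qed

section \<open>Covariant derivatives of forms and tensors\<close>

locale manifold_with_connection = manifold A
  for A :: "('p, 'e::real_inner) chart set" +
  fixes nabla :: "('p \<Rightarrow> 'e) \<Rightarrow> 'p \<Rightarrow> 'e \<Rightarrow>\<^sub>L 'e"
  assumes connection: "connection A nabla"
begin

lemma nabla_add:
  "smooth_vf A Y \<Longrightarrow> smooth_vf A Z \<Longrightarrow> x \<in> points A \<Longrightarrow> nabla (\<lambda>y. Y y + Z y) x u = nabla Y x u + nabla Z x u"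
  using connection by (simp add: connection_def blinfun.add_left)

lemma nabla_scale:
  "smooth_function A f \<Longrightarrow> smooth_vf A Y \<Longrightarrow> x \<in> points A \<Longrightarrow>
    nabla (\<lambda>y. f y *\<^sub>R Y y) x u = dif A f x u *\<^sub>R Y x + f x *\<^sub>R nabla Y x u"
  using connection by (simp add: connection_def)

text \<open>Every tangent vector is the value of a global field, so the Leibniz rule leaves no
  freedom in the covector.\<close>

lemma nabla_form_unique:
  fixes \<alpha> :: "'p \<Rightarrow> 'e \<Rightarrow>\<^sub>L real"
  assumes "x \<in> points A"
    and \<theta>: "\<And>Y. smooth_vf A Y \<Longrightarrow> dif A (\<lambda>y. \<alpha> y (Y y)) x u = blinfun_apply \<theta> (Y x) + \<alpha> x (nabla Y x u)"
  shows "nabla_form A nabla \<alpha> x u = \<theta>"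
  unfolding nabla_form_def
proof (rule the_equality)
  fix \<theta>' assume \<theta>': "\<forall>Y. smooth_vf A Y \<longrightarrow> dif A (\<lambda>y. \<alpha> y (Y y)) x u = blinfun_apply \<theta>' (Y x) + \<alpha> x (nabla Y x u)"
  show "\<theta>' = \<theta>"
  proof (rule blinfun_eqI)
    fix w
    obtain Y where "smooth_vf A Y" "Y x = w" by (rule smooth_vf_through[OF assms(1)])
    then show "\<theta>' w = \<theta> w" using \<theta>[of Y] \<theta>'[rule_format, of Y] by simp
  qed
qed (simp add: \<theta>)

text \<open>Existence behind \<open>THE\<close>: replacing \<open>Y\<close> by \<open>f Y\<close>
  adds df(u) \<alpha>(Y) both to the derivative of the pairing and to \<alpha>(\<nabla>Y), so their
  difference is linear over functions and comes from a covector.\<close>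

lemma nabla_form_apply:
  assumes "x \<in> points A" "smooth_form A \<alpha>" "smooth_vf A Y"
  shows "dif A (\<lambda>y. \<alpha> y (Y y)) x u = nabla_form A nabla \<alpha> x u (Y x) + \<alpha> x (nabla Y x u)"
proof -
  obtain \<theta> :: "'e \<Rightarrow>\<^sub>L real" where
    \<theta>: "\<And>Y. smooth_vf A Y \<Longrightarrow> dif A (\<lambda>y. \<alpha> y (Y y)) x u - \<alpha> x (nabla Y x u) = \<theta> (Y x)"
  proof (rule tensorial_vf[of "\<lambda>Y. dif A (\<lambda>y. \<alpha> y (Y y)) x u - \<alpha> x (nabla Y x u)" x])
    fix Y Z assume Y: "smooth_vf A Y" and Z: "smooth_vf A Z"
    show "dif A (\<lambda>y. \<alpha> y (Y y + Z y)) x u - \<alpha> x (nabla (\<lambda>y. Y y + Z y) x u) =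
      dif A (\<lambda>y. \<alpha> y (Y y)) x u - \<alpha> x (nabla Y x u) + (dif A (\<lambda>y. \<alpha> y (Z y)) x u - \<alpha> x (nabla Z x u))"
      using dif_eqI[OF has_dif_add[OF has_dif_pairing[OF assms(2) Y assms(1)] has_dif_pairing[OF assms(2) Z assms(1)]]]
      by (simp add: blinfun.add_right nabla_add Y Z assms(1) blinfun.add_left)
  next
    fix f Y assume f: "smooth_function A f" and Y: "smooth_vf A Y"
    show "dif A (\<lambda>y. \<alpha> y (f y *\<^sub>R Y y)) x u - \<alpha> x (nabla (\<lambda>y. f y *\<^sub>R Y y) x u) =
      f x * (dif A (\<lambda>y. \<alpha> y (Y y)) x u - \<alpha> x (nabla Y x u))"
      using dif_eqI[OF has_dif_mult[OF assms(1) smooth_function_has_dif[OF f assms(1)] has_dif_pairing[OF assms(2) Y assms(1)]]]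
      by (simp add: blinfun.add_right blinfun.scaleR_right nabla_scale f Y assms(1) blinfun.add_left
          blinfun.scaleR_left algebra_simps)
  qed (use assms(1) in auto)
  have "dif A (\<lambda>y. \<alpha> y (Y y)) x u = \<theta> (Y x) + \<alpha> x (nabla Y x u)" if "smooth_vf A Y" for Y
    using \<theta>[OF that] by simp
  then have "nabla_form A nabla \<alpha> x u = \<theta>" using assms(1) by (intro nabla_form_unique)
  then show ?thesis using \<theta>[OF assms(3)] by simp
qed

lemma nabla_form_add:
  assumes "x \<in> points A" "smooth_form A \<alpha>" "smooth_form A \<beta>"
  shows "nabla_form A nabla (\<lambda>y. \<alpha> y + \<beta> y) x u = nabla_form A nabla \<alpha> x u + nabla_form A nabla \<beta> x u"
proof (rule nabla_form_unique[OF assms(1)])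
  fix Y assume Y: "smooth_vf A Y"
  show "dif A (\<lambda>y. (\<alpha> y + \<beta> y) (Y y)) x u =
    (nabla_form A nabla \<alpha> x u + nabla_form A nabla \<beta> x u) (Y x) + (\<alpha> x + \<beta> x) (nabla Y x u)"
    using dif_eqI[OF has_dif_add[OF has_dif_pairing[OF assms(2) Y assms(1)] has_dif_pairing[OF assms(3) Y assms(1)]]]
    by (simp add: blinfun.add_left nabla_form_apply assms Y)
qed

lemma nabla_form_scale:
  assumes "x \<in> points A" "smooth_function A f" "smooth_form A \<alpha>"
  shows "nabla_form A nabla (\<lambda>y. f y *\<^sub>R \<alpha> y) x u = dif A f x u *\<^sub>R \<alpha> x + f x *\<^sub>R nabla_form A nabla \<alpha> x u"
proof (rule nabla_form_unique[OF assms(1)])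
  fix Y assume Y: "smooth_vf A Y"
  show "dif A (\<lambda>y. (f y *\<^sub>R \<alpha> y) (Y y)) x u =
    (dif A f x u *\<^sub>R \<alpha> x + f x *\<^sub>R nabla_form A nabla \<alpha> x u) (Y x) + (f x *\<^sub>R \<alpha> x) (nabla Y x u)"
    using dif_eqI[OF has_dif_mult[OF assms(1) smooth_function_has_dif[OF assms(2,1)] has_dif_pairing[OF assms(3) Y assms(1)]]]
    by (simp add: blinfun.add_left blinfun.scaleR_left nabla_form_apply assms Y algebra_simps)
qed

lemma smooth_form_through:
  assumes "x \<in> points A"
  obtains \<alpha> where "smooth_form A \<alpha>" "\<alpha> x = a"
proof -
  obtain f where "smooth_function A f" "dif A f x = a"
    using smooth_function_with_dif[OF assms] by metis
  then show thesis using smooth_form_dif that by blast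
qed

text \<open>The defect \<open>R\<close> of the Leibniz rule is linear over functions in each
  argument separately. Representing it in one argument at a time, and combining the two by a basis
  expansion, gives a tensor with these values; uniqueness follows because forms attain every
  covector at \<open>x\<close>.\<close>

lemma nabla_tensor_apply:
  assumes x: "x \<in> points A" and T: "smooth_tensor A T" and \<alpha>: "smooth_form A \<alpha>" and \<beta>: "smooth_form A \<beta>"
  shows "dif A (\<lambda>y. T y (\<alpha> y) (\<beta> y)) x u =
    nabla_tensor A nabla T x u (\<alpha> x) (\<beta> x) +
    T x (nabla_form A nabla \<alpha> x u) (\<beta> x) + T x (\<alpha> x) (nabla_form A nabla \<beta> x u)"
proof -
  define R where "R \<alpha> \<beta> = dif A (\<lambda>y. T y (\<alpha> y) (\<beta> y)) x u -
    T x (nabla_form A nabla \<alpha> x u) (\<beta> x) - T x (\<alpha> x) (nabla_form A nabla \<beta> x u)" for \<alpha> \<beta>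
  have left: "\<exists>v. \<forall>\<alpha>. smooth_form A \<alpha> \<longrightarrow> R \<alpha> \<beta> = \<alpha> x v" if \<beta>: "smooth_form A \<beta>" for \<beta>
  proof -
    obtain v where "\<And>\<alpha>. smooth_form A \<alpha> \<Longrightarrow> R \<alpha> \<beta> = \<alpha> x v"
    proof (rule tensorial_form[of "\<lambda>\<alpha>. R \<alpha> \<beta>" x])
      fix \<alpha> \<alpha>' assume a: "smooth_form A \<alpha>" and a': "smooth_form A \<alpha>'"
      show "R (\<lambda>y. \<alpha> y + \<alpha>' y) \<beta> = R \<alpha> \<beta> + R \<alpha>' \<beta>"
        using dif_eqI[OF has_dif_add[OF has_dif_tensor_pairing[OF T a \<beta> x] has_dif_tensor_pairing[OF T a' \<beta> x]]]
        by (simp add: R_def nabla_form_add x a a' blinfun.add_left blinfun.add_right)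
    next
      fix f \<alpha> assume f: "smooth_function A f" and a: "smooth_form A \<alpha>"
      show "R (\<lambda>y. f y *\<^sub>R \<alpha> y) \<beta> = f x * R \<alpha> \<beta>"
        using dif_eqI[OF has_dif_mult[OF x smooth_function_has_dif[OF f x] has_dif_tensor_pairing[OF T a \<beta> x]]]
        by (simp add: R_def nabla_form_scale x f a blinfun.add_left blinfun.add_right
            blinfun.scaleR_left blinfun.scaleR_right algebra_simps)
    qed (use x in auto)
    then show ?thesis by blast
  qed
  have right: "\<exists>v. \<forall>\<beta>. smooth_form A \<beta> \<longrightarrow> R \<alpha> \<beta> = \<beta> x v" if \<alpha>: "smooth_form A \<alpha>" for \<alpha>
  proof -
    obtain v where "\<And>\<beta>. smooth_form A \<beta> \<Longrightarrow> R \<alpha> \<beta> = \<beta> x v"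
    proof (rule tensorial_form[of "\<lambda>\<beta>. R \<alpha> \<beta>" x])
      fix \<beta> \<beta>' assume b: "smooth_form A \<beta>" and b': "smooth_form A \<beta>'"
      show "R \<alpha> (\<lambda>y. \<beta> y + \<beta>' y) = R \<alpha> \<beta> + R \<alpha> \<beta>'"
        using dif_eqI[OF has_dif_add[OF has_dif_tensor_pairing[OF T \<alpha> b x] has_dif_tensor_pairing[OF T \<alpha> b' x]]]
        by (simp add: R_def nabla_form_add x b b' blinfun.add_left blinfun.add_right)
    next
      fix f \<beta> assume f: "smooth_function A f" and b: "smooth_form A \<beta>"
      show "R \<alpha> (\<lambda>y. f y *\<^sub>R \<beta> y) = f x * R \<alpha> \<beta>"
        using dif_eqI[OF has_dif_mult[OF x smooth_function_has_dif[OF f x] has_dif_tensor_pairing[OF T \<alpha> b x]]]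
        by (simp add: R_def nabla_form_scale x f b blinfun.add_left blinfun.add_right
            blinfun.scaleR_left blinfun.scaleR_right algebra_simps)
    qed (use x in auto)
    then show ?thesis by blast
  qed
  obtain B :: "'e set" where B: "orthonormal_basis B" by (rule basis_exists)
  \<comment> \<open>The coordinate \<open>v \<bullet> b\<close> of the vector representing
    \<open>R\<close> in its first argument is \<open>R\<close> on a form whose value at
    \<open>x\<close> is the \<open>b\<close>-th coordinate functional. By \<open>right\<close> it is
    therefore given by evaluating \<open>\<beta>\<close> on a fixed vector.\<close>
  have "\<exists>w. \<forall>\<beta>. smooth_form A \<beta> \<longrightarrow> (\<forall>v. (\<forall>\<alpha>. smooth_form A \<alpha> \<longrightarrow> R \<alpha> \<beta> = \<alpha> x v) \<longrightarrow> v \<bullet> b = \<beta> x w)" for b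
  proof -
    obtain \<alpha> where \<alpha>: "smooth_form A \<alpha>" "\<alpha> x = blinfun_inner_left b" by (rule smooth_form_through[OF x])
    then obtain w where "\<forall>\<beta>. smooth_form A \<beta> \<longrightarrow> R \<alpha> \<beta> = \<beta> x w" using right by blast
    then show ?thesis using \<alpha> by (intro exI[of _ w]) (metis blinfun_inner_left.rep_eq)
  qed
  then obtain w where w: "\<And>b \<beta> v. smooth_form A \<beta> \<Longrightarrow> (\<And>\<alpha>. smooth_form A \<alpha> \<Longrightarrow> R \<alpha> \<beta> = \<alpha> x v) \<Longrightarrow> v \<bullet> b = \<beta> x (w b)"
    by metis
  have R: "R \<alpha> \<beta> = (\<Sum>b\<in>B. \<alpha> x b * \<beta> x (w b))" if \<alpha>: "smooth_form A \<alpha>" and \<beta>: "smooth_form A \<beta>" for \<alpha> \<beta>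
  proof -
    obtain v where v: "\<And>\<alpha>. smooth_form A \<alpha> \<Longrightarrow> R \<alpha> \<beta> = \<alpha> x v" using left[OF \<beta>] by blast
    have "R \<alpha> \<beta> = (\<Sum>b\<in>B. (v \<bullet> b) *\<^sub>R \<alpha> x b)"
      unfolding v[OF \<alpha>]
      by (rule linear_expand[OF B bounded_linear.linear[OF blinfun.bounded_linear_right]])
    then show ?thesis by (simp add: w[OF \<beta> v] mult.commute)
  qed
  have "\<exists>E :: 'e tensor2. \<forall>(a :: 'e \<Rightarrow>\<^sub>L real) (a' :: 'e \<Rightarrow>\<^sub>L real). blinfun_apply (blinfun_apply E a) a' = blinfun_apply a b * blinfun_apply a' (w b)" for b
    using elementary_tensor_exists[of b "w b"] by metis
  then obtain E :: "'e \<Rightarrow> 'e tensor2" where E: "\<And>b (a :: 'e \<Rightarrow>\<^sub>L real) (a' :: 'e \<Rightarrow>\<^sub>L real). blinfun_apply (blinfun_apply (E b) a) a' = blinfun_apply a b * blinfun_apply a' (w b)" by metis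
  \<comment> \<open>\<open>N\<close> is the sum over the basis of the elementary tensors of
    \<open>b\<close> and \<open>w b\<close>.\<close>
  define N where "N = (\<Sum>b\<in>B. E b)"
  have N: "R \<alpha> \<beta> = N (\<alpha> x) (\<beta> x)" if "smooth_form A \<alpha>" "smooth_form A \<beta>" for \<alpha> \<beta>
    using R[OF that] by (simp add: N_def blinfun.sum_left E)
  have "nabla_tensor A nabla T x u = N"
    unfolding nabla_tensor_def
  proof (rule the_equality)
    show "\<forall>\<alpha> \<beta>. smooth_form A \<alpha> \<longrightarrow> smooth_form A \<beta> \<longrightarrow> dif A (\<lambda>y. T y (\<alpha> y) (\<beta> y)) x u =
      N (\<alpha> x) (\<beta> x) + T x (nabla_form A nabla \<alpha> x u) (\<beta> x) + T x (\<alpha> x) (nabla_form A nabla \<beta> x u)"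
      by (simp flip: N add: R_def)
    fix N' assume N': "\<forall>\<alpha> \<beta>. smooth_form A \<alpha> \<longrightarrow> smooth_form A \<beta> \<longrightarrow> dif A (\<lambda>y. T y (\<alpha> y) (\<beta> y)) x u =
      blinfun_apply (blinfun_apply N' (\<alpha> x)) (\<beta> x) + T x (nabla_form A nabla \<alpha> x u) (\<beta> x) + T x (\<alpha> x) (nabla_form A nabla \<beta> x u)"
    show "N' = N"
    proof (intro blinfun_eqI)
      fix a b
      obtain \<alpha> where \<alpha>: "smooth_form A \<alpha>" "\<alpha> x = a" by (rule smooth_form_through[OF x])
      obtain \<beta> where \<beta>: "smooth_form A \<beta>" "\<beta> x = b" by (rule smooth_form_through[OF x])
      have "N' (\<alpha> x) (\<beta> x) = N (\<alpha> x) (\<beta> x)"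
        using N'[rule_format, OF \<alpha>(1) \<beta>(1)] N[OF \<alpha>(1) \<beta>(1)] by (simp add: R_def)
      then show "N' a b = N a b" by (simp add: \<alpha> \<beta>)
    qed
  qed
  then show ?thesis using N[OF \<alpha> \<beta>] by (simp add: R_def)
qed

text \<open>Antisymmetrising the Leibniz rule over extensions \<open>U\<close>, \<open>W\<close> of
  the two vectors, the terms with \<nabla>W and \<nabla>U cancel against the Lie bracket by
  vanishing torsion; what remains is the exterior derivative.\<close>

lemma nabla_closed_form_symmetric:
  assumes "torsion_free A nabla" "closed_form A \<alpha>" "x \<in> points A"
  shows "nabla_form A nabla \<alpha> x u w = nabla_form A nabla \<alpha> x w u"
proof -
  obtain U where U: "smooth_vf A U" "U x = u" by (rule smooth_vf_through[OF assms(3)])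
  obtain W where W: "smooth_vf A W" "W x = w" by (rule smooth_vf_through[OF assms(3)])
  have \<alpha>: "smooth_form A \<alpha>" using assms(2) by (simp add: closed_form_def)
  have "nabla W x u - nabla U x w = lie_bracket A U W x"
    using assms(1,3) U W by (auto simp: torsion_free_def)
  then have "\<alpha> x (nabla W x u) - \<alpha> x (nabla U x w) =
    \<alpha> x (frechet_derivative (vf_in A (chart_at A x) W) (at (snd (chart_at A x) x)) u) -
    \<alpha> x (frechet_derivative (vf_in A (chart_at A x) U) (at (snd (chart_at A x) x)) w)"
    unfolding lie_bracket_def Let_def U W by (metis blinfun.diff_right)
  moreover have "ext_derivative A \<alpha> x u w = 0" using assms by (simp add: closed_form_def)
  ultimately show ?thesis
    using nabla_form_apply[OF assms(3) \<alpha> W(1), of u] nabla_form_apply[OF assms(3) \<alpha> U(1), of w]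
    unfolding dif_pairing[OF \<alpha> W(1) assms(3)] dif_pairing[OF \<alpha> U(1) assms(3)] ext_derivative_def Let_def U W
    by simp
qed

text \<open>A field with value \<open>w\<close> is corrected by \<open>f Z\<close>, where
  \<open>f\<close> vanishes at \<open>x\<close> with df(u) = -1 and \<open>Z\<close> takes the
  unwanted derivative as its value. Only one direction at one point is made parallel, so curvature
  is no obstruction.\<close>

lemma parallel_vf_exists:
  assumes "x \<in> points A"
  obtains Y where "smooth_vf A Y" "Y x = w" "nabla Y x u = 0"
proof -
  obtain Y where Y: "smooth_vf A Y" "Y x = w" by (rule smooth_vf_through[OF assms])
  show thesis
  proof (cases "u = 0")
    case True
    then show thesis using Y that by simp
  next
    case False
    \<comment> \<open>The factor -1/(u . u) normalises the functional of \<open>u\<close> to take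
      the value -1 on \<open>u\<close>.\<close>
    obtain f where f: "smooth_function A f" "f x = 0" "dif A f x = (- 1 / (u \<bullet> u)) *\<^sub>R blinfun_inner_left u"
      by (rule smooth_function_with_dif[OF assms])
    obtain Z where Z: "smooth_vf A Z" "Z x = nabla Y x u" by (rule smooth_vf_through[OF assms])
    have "dif A f x u = -1" using False by (simp add: f blinfun.scaleR_left blinfun.minus_left)
    then show thesis
      using Y Z f assms
      by (intro that[of "\<lambda>y. Y y + f y *\<^sub>R Z y"])
        (simp_all add: smooth_vf_add smooth_vf_scale nabla_add nabla_scale)
  qed
qed

end

section \<open>Covectors on the tangent bundle\<close>

definition has_tangent_map ::
  "('p, 'e::real_normed_vector) chart set \<Rightarrow> ('q, 'f::real_normed_vector) chart set \<Rightarrow>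
    ('p \<Rightarrow> 'q) \<Rightarrow> 'p \<Rightarrow> ('e \<Rightarrow>\<^sub>L 'f) \<Rightarrow> bool" where
  "has_tangent_map A B F x L \<longleftrightarrow>
     ((\<lambda>z. snd (chart_at B (F x)) (F (chart_inv (chart_at A x) z))) has_derivative L) (at (snd (chart_at A x) x))"

lemma has_tangent_mapI:
  assumes "(\<lambda>z. snd (chart_at B (F x)) (F (chart_inv (chart_at A x) z))) differentiable (at (snd (chart_at A x) x))"
  shows "has_tangent_map A B F x (tangent_map A B F x)"
  using assms unfolding has_tangent_map_def tangent_map_def comp_def frechet_derivative_works
  by (subst bounded_linear_Blinfun_apply) (auto intro: has_derivative_bounded_linear)

text \<open>The facts about charts are hypotheses on \<open>x\<close>, \<open>U\<close> and
  \<open>inv\<close>, so that one chain rule serves sections, the projection and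
  \<open>\<pi>\<close>, with \<open>P\<close> or \<open>TP\<close> on either side.
  \<open>inv\<close> says that near \<open>x\<close> the image stays in the preferred chart at
  \<open>F x\<close>.\<close>

lemma has_dif_compose:
  assumes F: "has_tangent_map A B F x L" and f: "has_dif B f (F x) D"
    and x: "chart_inv (chart_at A x) (snd (chart_at A x) x) = x"
    and U: "open U" "snd (chart_at A x) x \<in> U"
    and inv: "\<And>z. z \<in> U \<Longrightarrow> chart_inv (chart_at B (F x)) (snd (chart_at B (F x)) (F (chart_inv (chart_at A x) z))) =
      F (chart_inv (chart_at A x) z)"
  shows "has_dif A (\<lambda>y. f (F y)) x (D o\<^sub>L L)"
proof -
  have "((\<lambda>z. f (chart_inv (chart_at B (F x)) (snd (chart_at B (F x)) (F (chart_inv (chart_at A x) z)))))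
      has_derivative (\<lambda>u. D (L u))) (at (snd (chart_at A x) x))"
    by (rule has_derivative_compose[OF F[unfolded has_tangent_map_def]])
      (use f in \<open>simp add: has_dif_def x\<close>)
  then have "((\<lambda>z. f (F (chart_inv (chart_at A x) z))) has_derivative (\<lambda>u. D (L u))) (at (snd (chart_at A x) x))"
    by (rule has_derivative_transform_within_open[OF _ U]) (simp add: inv)
  then show ?thesis
    by (simp add: has_dif_def blinfun_compose.rep_eq comp_def)
qed

lemma has_derivative_compose_fst:
  assumes "(g has_derivative g') (at (fst p))"
  shows "((\<lambda>q. g (fst q)) has_derivative (\<lambda>h. g' (fst h))) (at p)"
  by (rule has_derivative_compose[OF bounded_linear.has_derivative[OF bounded_linear_fst has_derivative_ident] assms])

context manifold
begin

section \<open>Bundle charts of the tangent bundle\<close>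

lemma points_tangent: "v \<in> points (tangent_atlas A) \<longleftrightarrow> fst v \<in> points A"
  by (cases v) (auto simp: points_def tangent_atlas_def tangent_chart_def)

lemma fst_tangent_chart: "fst (tangent_chart A d) = fst d \<times> UNIV"
  and snd_tangent_chart: "snd (tangent_chart A d) (x, w) = (snd d x, coord_change (chart_at A x) d x w)"
  by (simp_all add: tangent_chart_def)

lemma tangent_chart_inj: "d \<in> A \<Longrightarrow> inj_on (snd (tangent_chart A d)) (fst (tangent_chart A d))"
proof (rule inj_onI)
  fix p q assume d: "d \<in> A" and p: "p \<in> fst (tangent_chart A d)" and q: "q \<in> fst (tangent_chart A d)"
    and eq: "snd (tangent_chart A d) p = snd (tangent_chart A d) q"
  obtain x w x' w' where pq: "p = (x, w)" "q = (x', w')" by (cases p, cases q)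
  have x: "x \<in> fst d" "x' \<in> fst d" using p q by (simp_all add: pq fst_tangent_chart)
  then have xx: "x' = x" using eq inj_onD[OF chart_inj[OF d]] by (simp add: pq snd_tangent_chart)
  then have "coord_change d (chart_at A x) x (coord_change (chart_at A x) d x w) =
      coord_change d (chart_at A x) x (coord_change (chart_at A x) d x w')"
    using eq by (simp add: pq snd_tangent_chart)
  then show "p = q"
    using x d points_I[OF d x(1)] by (simp add: pq xx coord_change_inverse chart_at)
qed

lemma chart_inv_tangent_chart:
  assumes "d \<in> A" "z \<in> chart_range d"
  shows "chart_inv (tangent_chart A d) (z, \<omega>) =
    (chart_inv d z, coord_change d (chart_at A (chart_inv d z)) (chart_inv d z) \<omega>)"
proof -
  define y where "y = chart_inv d z"
  have y: "y \<in> fst d" "z = snd d y" using assms chart_inv_in[of z d] chart_chart_inv[of z d] by (simp_all add: y_def)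
  let ?p = "(y, coord_change d (chart_at A y) y \<omega>)"
  have "snd (tangent_chart A d) ?p = (z, \<omega>)"
    using y points_I[OF assms(1) y(1)] by (simp add: snd_tangent_chart coord_change_inverse assms chart_at)
  moreover have "?p \<in> fst (tangent_chart A d)" using y by (simp add: fst_tangent_chart)
  ultimately show ?thesis
    unfolding chart_inv_def[of "tangent_chart A d"] y_def[symmetric] using tangent_chart_inj[OF assms(1)]
    by (metis inv_into_f_f)
qed

lemma tangent_chart_image:
  assumes "d \<in> A" "U \<subseteq> fst d"
  shows "snd (tangent_chart A d) ` (U \<times> UNIV) = snd d ` U \<times> UNIV"
proof (intro equalityI subsetI)
  fix p assume "p \<in> snd d ` U \<times> (UNIV :: 'e set)"
  then obtain x \<omega> where x: "x \<in> U" "p = (snd d x, \<omega>)" by auto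
  then have "p = snd (tangent_chart A d) (x, coord_change d (chart_at A x) x \<omega>)"
    using assms points_I[OF assms(1)] by (auto simp: snd_tangent_chart coord_change_inverse chart_at subset_iff)
  then show "p \<in> snd (tangent_chart A d) ` (U \<times> UNIV)" using x by blast
qed (auto simp: snd_tangent_chart)

text \<open>Transition maps act by \<tau> on the base and by its derivative on the fibre. Its role
  here is to give access to the topology of \<open>TP\<close>, on which the continuity of
  \<open>\<pi>\<close> rests.\<close>

lemma smooth_atlas_tangent: "smooth_atlas (tangent_atlas A)"
  unfolding smooth_atlas_def
proof (intro conjI ballI)
  fix c' assume "c' \<in> tangent_atlas A"
  then obtain c where c: "c \<in> A" "c' = tangent_chart A c" by (auto simp: tangent_atlas_def)
  show "inj_on (snd c') (fst c')" using c tangent_chart_inj by simp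
  show "open (chart_range c')"
    using tangent_chart_image[OF c(1) order_refl] open_chart_range[OF c(1)]
    by (simp add: c(2) chart_range_def fst_tangent_chart open_Times)
  fix d' assume "d' \<in> tangent_atlas A"
  then obtain d where d: "d \<in> A" "d' = tangent_chart A d" by (auto simp: tangent_atlas_def)
  define V where "V = snd c ` (fst c \<inter> fst d)"
  have V: "open V" using open_overlap c d by (simp add: V_def)
  have ov: "snd c' ` (fst c' \<inter> fst d') = V \<times> UNIV"
    using tangent_chart_image[OF c(1), of "fst c \<inter> fst d"]
    by (simp add: V_def c(2) d(2) fst_tangent_chart Times_Int_Times)
  then show "open (snd c' ` (fst c' \<inter> fst d'))" using V by (simp add: open_Times)
  obtain B :: "'e set" where B: "orthonormal_basis B" by (rule basis_exists)
  have OU: "open (V \<times> (UNIV :: 'e set))" using V by (simp add: open_Times)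
  have fst_smooth: "smooth_on (V \<times> (UNIV :: 'e set)) (\<lambda>p. g (fst p))" if "smooth_on V g" for g :: "'e \<Rightarrow> 'e"
    by (rule smooth_on_compose[OF B OU V _ _ that])
      (auto intro!: smooth_on_bounded_linear[OF bounded_linear_fst OU smooth_on_ident])
  \<comment> \<open>The fibre part is expanded in a basis, which reduces it to derivatives of the
    transition map in fixed directions.\<close>
  have "smooth_on (V \<times> UNIV) (\<lambda>p. ((snd d \<circ> chart_inv c) (fst p), 0) +
      (0, \<Sum>b\<in>B. (snd p \<bullet> b) *\<^sub>R frechet_derivative (snd d \<circ> chart_inv c) (at (fst p)) b))"
  proof (rule smooth_on_add[OF OU])
    show "smooth_on (V \<times> (UNIV :: 'e set)) (\<lambda>p. ((snd d \<circ> chart_inv c) (fst p), 0 :: 'e))"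
      using fst_smooth[OF transition_smooth[OF c(1) d(1), folded V_def]]
      by (intro smooth_on_bounded_linear[where L = "\<lambda>a. (a, 0)", OF _ OU])
        (simp_all add: bounded_linear_Pair bounded_linear_ident)
    have "smooth_on (V \<times> UNIV)
       (\<lambda>p. \<Sum>b\<in>B. (snd p \<bullet> b) *\<^sub>R frechet_derivative (snd d \<circ> chart_inv c) (at (fst p)) b)"
    proof (intro smooth_on_sum[OF OU] smooth_on_scaleR[OF OU])
      fix b :: 'e
      show "smooth_on (V \<times> UNIV) (\<lambda>p. snd p \<bullet> b)"
        by (rule smooth_on_bounded_linear[OF bounded_linear_inner_left OU
              smooth_on_bounded_linear[OF bounded_linear_snd OU smooth_on_ident]])
      show "smooth_on (V \<times> (UNIV :: 'e set)) (\<lambda>p. frechet_derivative (snd d \<circ> chart_inv c) (at (fst p)) b)"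
        by (rule fst_smooth[OF smooth_on_frechet_derivative[OF transition_smooth[OF c(1) d(1), folded V_def]]])
    qed
    then show "smooth_on (V \<times> UNIV)
       (\<lambda>p. (0 :: 'e, \<Sum>b\<in>B. (snd p \<bullet> b) *\<^sub>R frechet_derivative (snd d \<circ> chart_inv c) (at (fst p)) b))"
      by (intro smooth_on_bounded_linear[where L = "\<lambda>a. (0, a)", OF _ OU])
        (simp_all add: bounded_linear_Pair bounded_linear_ident)
  qed
  then have "smooth_on (V \<times> UNIV) (snd d' \<circ> chart_inv c')"
  proof (rule smooth_on_transform[OF _ OU])
    fix p :: "'e \<times> 'e" assume "p \<in> V \<times> UNIV"
    then obtain x \<omega> where p: "p = (snd c x, \<omega>)" and x: "x \<in> fst c" "x \<in> fst d" by (auto simp: V_def)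
    have D: "frechet_derivative (snd d \<circ> chart_inv c) (at (snd c x)) = coord_change c d x"
      by (intro frechet_derivative_eq coord_change_has_derivative c d x)
    have "(\<Sum>b\<in>B. (\<omega> \<bullet> b) *\<^sub>R coord_change c d x b) = coord_change c d x \<omega>"
      by (rule linear_expand[OF B bounded_linear.linear[OF blinfun.bounded_linear_right], symmetric])
    then show "((snd d \<circ> chart_inv c) (fst p), 0) +
      (0, \<Sum>b\<in>B. (snd p \<bullet> b) *\<^sub>R frechet_derivative (snd d \<circ> chart_inv c) (at (fst p)) b) =
      (snd d' \<circ> chart_inv c') p"
      using x points_I[OF c(1) x(1)]
      by (simp add: p D c d chart_inv_tangent_chart chart_in_range snd_tangent_chart chart_inv_chart
          coord_change_comp chart_at)
  qed
  then show "smooth_on (snd c' ` (fst c' \<inter> fst d')) (snd d' \<circ> chart_inv c')" by (simp add: ov)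
qed

text \<open>
  The chart \<open>d\<close> below need not be \<open>chart_at A (fst v)\<close>, so the coordinate changes between the two
  charts do not disappear in the tangent space of \<open>TP\<close> at \<open>v\<close>.
\<close>

lemma chart_at_tangent:
  assumes "v \<in> points (tangent_atlas A)"
  obtains d where "d \<in> A" "fst v \<in> fst d" "chart_at (tangent_atlas A) v = tangent_chart A d"
proof -
  have "\<exists>c. c \<in> tangent_atlas A \<and> v \<in> fst c" using assms by (auto simp: points_def)
  from someI_ex[OF this] have "chart_at (tangent_atlas A) v \<in> tangent_atlas A" "v \<in> fst (chart_at (tangent_atlas A) v)"
    by (auto simp: chart_at_def)
  then obtain d where d: "d \<in> A" "chart_at (tangent_atlas A) v = tangent_chart A d" "v \<in> fst (tangent_chart A d)"
    by (auto simp: tangent_atlas_def)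
  then have "fst v \<in> fst d" by (auto simp: fst_tangent_chart)
  with d show thesis using that by blast
qed

lemma chart_inv_chart_at_tangent:
  assumes "v \<in> points (tangent_atlas A)"
  shows "chart_inv (chart_at (tangent_atlas A) v) (snd (chart_at (tangent_atlas A) v) v) = v"
proof -
  obtain d where d: "d \<in> A" "fst v \<in> fst d" "chart_at (tangent_atlas A) v = tangent_chart A d"
    by (rule chart_at_tangent[OF assms])
  have "v \<in> fst (tangent_chart A d)" using d by (cases v) (simp add: fst_tangent_chart)
  then show ?thesis unfolding d(3) chart_inv_def using tangent_chart_inj[OF d(1)] by (rule inv_into_f_f[rotated])
qed

text \<open>In a bundle chart the two functions read \<open>form_in A d \<alpha> z \<omega>\<close>
  and f(z). The differential of the first is recorded only on vertical vectors: its remaining part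
  involves derivatives of the components of \<alpha> and is handled through sections of
  \<open>TP\<close>.\<close>

lemma
  assumes d: "d \<in> A" "x \<in> fst d" "chart_at (tangent_atlas A) (x, w) = tangent_chart A d"
  shows has_dif_fibre_linear: "smooth_form A \<alpha> \<Longrightarrow>
      has_dif (tangent_atlas A) (fibre_linear \<alpha>) (x, w) (dif (tangent_atlas A) (fibre_linear \<alpha>) (x, w))"
    and dif_fibre_linear_vertical: "smooth_form A \<alpha> \<Longrightarrow>
      dif (tangent_atlas A) (fibre_linear \<alpha>) (x, w) (0, \<omega>) = \<alpha> x (coord_change d (chart_at A x) x \<omega>)"
    and has_dif_fst: "smooth_function A f \<Longrightarrow>
      has_dif (tangent_atlas A) (f \<circ> fst) (x, w) (dif (tangent_atlas A) (f \<circ> fst) (x, w))"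
    and dif_fst: "smooth_function A f \<Longrightarrow>
      dif (tangent_atlas A) (f \<circ> fst) (x, w) h = dif A f x (coord_change d (chart_at A x) x (fst h))"
proof -
  define \<omega>0 where "\<omega>0 = coord_change (chart_at A x) d x w"
  have base: "snd (tangent_chart A d) (x, w) = (snd d x, \<omega>0)" by (simp add: snd_tangent_chart \<omega>0_def)
  have U: "open (chart_range d \<times> (UNIV :: 'e set))" using open_chart_range[OF d(1)] by (simp add: open_Times)
  have inU: "(snd d x, \<omega>0) \<in> chart_range d \<times> UNIV" using d by (simp add: chart_in_range)
  note x = points_I[OF d(1,2)]
  {
    assume \<alpha>: "smooth_form A \<alpha>"
    let ?F = "form_in A d \<alpha>"
    have "((\<lambda>p. ?F (fst p)) has_derivative (\<lambda>h. frechet_derivative ?F (at (snd d x)) (fst h))) (at (snd d x, \<omega>0))"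
      using form_in_has_derivative[OF \<alpha> d(1) chart_in_range[OF d(2)]]
      by (intro has_derivative_compose_fst) simp
    then have "((\<lambda>p. ?F (fst p) (snd p)) has_derivative
        (\<lambda>h. ?F (fst (snd d x, \<omega>0)) (snd h) + frechet_derivative ?F (at (snd d x)) (fst h) (snd (snd d x, \<omega>0)))) (at (snd d x, \<omega>0))"
      by (rule blinfun.FDERIV)
        (rule bounded_linear.has_derivative[OF bounded_linear_snd has_derivative_ident])
    then have "((\<lambda>p. fibre_linear \<alpha> (chart_inv (tangent_chart A d) p)) has_derivative
        (\<lambda>h. ?F (snd d x) (snd h) + frechet_derivative ?F (at (snd d x)) (fst h) \<omega>0)) (at (snd d x, \<omega>0))"
      unfolding fst_conv snd_conv
      by (rule has_derivative_transform_within_open[OF _ U inU])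
        (auto simp: fibre_linear_def chart_inv_tangent_chart d(1) form_in_def Let_def)
    then have D: "((\<lambda>p. fibre_linear \<alpha> (chart_inv (chart_at (tangent_atlas A) (x, w)) p)) has_derivative
        (\<lambda>h. ?F (snd d x) (snd h) + frechet_derivative ?F (at (snd d x)) (fst h) \<omega>0)) (at (snd (chart_at (tangent_atlas A) (x, w)) (x, w)))"
      by (simp add: d(3) base)
    then show h: "has_dif (tangent_atlas A) (fibre_linear \<alpha>) (x, w) (dif (tangent_atlas A) (fibre_linear \<alpha>) (x, w))"
      by (intro has_dif_difI) (auto simp: differentiable_def)
    have "blinfun_apply (dif (tangent_atlas A) (fibre_linear \<alpha>) (x, w)) =
        (\<lambda>h. ?F (snd d x) (snd h) + frechet_derivative ?F (at (snd d x)) (fst h) \<omega>0)"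
      using h[unfolded has_dif_def] D by (rule has_derivative_unique)
    then show "dif (tangent_atlas A) (fibre_linear \<alpha>) (x, w) (0, \<omega>) = \<alpha> x (coord_change d (chart_at A x) x \<omega>)"
      using linear_0[OF has_derivative_linear[OF form_in_has_derivative[OF \<alpha> d(1) chart_in_range[OF d(2)]]]]
      by (simp add: form_in_chart d)
  }
  {
    assume f: "smooth_function A f"
    have "((\<lambda>p. f (chart_inv d (fst p))) has_derivative (\<lambda>h. dif A f x (coord_change d (chart_at A x) x (fst h)))) (at (snd d x, \<omega>0))"
      using has_dif_chart[OF smooth_function_has_dif[OF f x] d(1,2)]
      by (intro has_derivative_compose_fst) simp
    then have "((\<lambda>p. (f \<circ> fst) (chart_inv (tangent_chart A d) p)) has_derivative
        (\<lambda>h. dif A f x (coord_change d (chart_at A x) x (fst h)))) (at (snd d x, \<omega>0))"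
      by (rule has_derivative_transform_within_open[OF _ U inU]) (auto simp: chart_inv_tangent_chart d(1))
    then have D: "((\<lambda>p. (f \<circ> fst) (chart_inv (chart_at (tangent_atlas A) (x, w)) p)) has_derivative
        (\<lambda>h. dif A f x (coord_change d (chart_at A x) x (fst h)))) (at (snd (chart_at (tangent_atlas A) (x, w)) (x, w)))"
      by (simp add: d(3) base)
    then show h: "has_dif (tangent_atlas A) (f \<circ> fst) (x, w) (dif (tangent_atlas A) (f \<circ> fst) (x, w))"
      by (intro has_dif_difI) (auto simp: differentiable_def)
    have "blinfun_apply (dif (tangent_atlas A) (f \<circ> fst) (x, w)) = (\<lambda>h. dif A f x (coord_change d (chart_at A x) x (fst h)))"
      using h[unfolded has_dif_def] D by (rule has_derivative_unique)
    then show "dif (tangent_atlas A) (f \<circ> fst) (x, w) h = dif A f x (coord_change d (chart_at A x) x (fst h))"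
      by simp
  }
qed

lemma vertical_lift_chart:
  assumes "d \<in> A" "x \<in> fst d" "chart_at (tangent_atlas A) (x, w) = tangent_chart A d"
  shows "vertical_lift A (x, w) u = (0, coord_change (chart_at A x) d x u)"
proof -
  let ?J = "coord_change (chart_at A x) d x"
  have "((\<lambda>s. (snd d x, ?J w + s *\<^sub>R ?J u)) has_vector_derivative (0, ?J u)) (at 0)"
    unfolding has_vector_derivative_def by (auto intro!: derivative_eq_intros)
  then show ?thesis
    using assms(3)
    by (simp add: vertical_lift_def velocity_def snd_tangent_chart blinfun.add_right blinfun.scaleR_right
        vector_derivative_at)
qed

text \<open>\<open>k\<close> is chosen to match the covector on vertical vectors. The remainder
  kills vertical vectors, hence factors through the projection and is the pull-back of some
  dh.\<close>

lemma covector_TP_expand: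
  assumes "(x, w) \<in> points (tangent_atlas A)"
  obtains k h where "smooth_function A k" "smooth_function A h"
    "\<xi> = dif (tangent_atlas A) (fibre_linear (dif A k)) (x, w) + dif (tangent_atlas A) (h \<circ> fst) (x, w)"
proof -
  obtain d where d: "d \<in> A" "x \<in> fst d" "chart_at (tangent_atlas A) (x, w) = tangent_chart A d"
    using chart_at_tangent[OF assms] by auto
  note x = points_I[OF d(1,2)]
  let ?J = "coord_change (chart_at A x) d x" and ?J' = "coord_change d (chart_at A x) x"
  \<comment> \<open>The coordinate changes translate between the chart of \<open>TP\<close> at the
    point and the preferred chart at \<open>x\<close>, in which dk is prescribed.\<close>
  define b where "b = Blinfun (\<lambda>u. \<xi> (0, ?J u))"
  have b: "b u = \<xi> (0, ?J u)" for u
    unfolding b_def by (subst bounded_linear_Blinfun_apply)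
      (auto intro!: bounded_linear_intros bounded_linear_Pair bounded_linear_zero)
  obtain k where k: "smooth_function A k" "dif A k x = b"
    using smooth_function_with_dif[OF x] by metis
  define \<zeta> where "\<zeta> = \<xi> - dif (tangent_atlas A) (fibre_linear (dif A k)) (x, w)"
  define a where "a = Blinfun (\<lambda>u. \<zeta> (?J u, 0))"
  have a: "a u = \<zeta> (?J u, 0)" for u
    unfolding a_def by (subst bounded_linear_Blinfun_apply)
      (auto intro!: bounded_linear_intros bounded_linear_Pair bounded_linear_zero)
  obtain h where h: "smooth_function A h" "dif A h x = a"
    using smooth_function_with_dif[OF x] by metis
  have inv: "?J (?J' u) = u" for u by (simp add: coord_change_inverse d chart_at x)
  have vert: "\<zeta> (0, \<omega>) = 0" for \<omega>
    by (simp add: \<zeta>_def blinfun.diff_left dif_fibre_linear_vertical[OF d] smooth_form_dif k b inv)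
  have "\<zeta> p = dif (tangent_atlas A) (h \<circ> fst) (x, w) p" for p
  proof -
    have "p = (fst p, 0) + (0, snd p)" by simp
    then have "\<zeta> p = \<zeta> (fst p, 0) + \<zeta> (0, snd p)" by (metis blinfun.add_right)
    then show ?thesis by (simp add: vert dif_fst[OF d h(1)] h(2) a inv)
  qed
  then have "\<zeta> = dif (tangent_atlas A) (h \<circ> fst) (x, w)" by (rule blinfun_eqI)
  then have "\<xi> = dif (tangent_atlas A) (fibre_linear (dif A k)) (x, w) + dif (tangent_atlas A) (h \<circ> fst) (x, w)"
    by (simp add: \<zeta>_def algebra_simps)
  then show thesis using k h that by blast
qed

text \<open>The two families of differentials span the cotangent space, so they span in particular
  the inner product functional of \<open>p - q\<close>.\<close>

lemma tangent_vector_TP_eqI: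
  assumes "(x, w) \<in> points (tangent_atlas A)"
    and "\<And>k. smooth_function A k \<Longrightarrow> dif (tangent_atlas A) (fibre_linear (dif A k)) (x, w) p =
      dif (tangent_atlas A) (fibre_linear (dif A k)) (x, w) q"
    and "\<And>h. smooth_function A h \<Longrightarrow> dif (tangent_atlas A) (h \<circ> fst) (x, w) p = dif (tangent_atlas A) (h \<circ> fst) (x, w) q"
  shows "p = q"
proof -
  obtain k h where "smooth_function A k" "smooth_function A h" and
    \<xi>: "blinfun_inner_left (p - q) =
      dif (tangent_atlas A) (fibre_linear (dif A k)) (x, w) + dif (tangent_atlas A) (h \<circ> fst) (x, w)"
    by (rule covector_TP_expand[OF assms(1)])
  then have "blinfun_inner_left (p - q) p = blinfun_inner_left (p - q) q"
    unfolding \<xi> by (simp add: blinfun.add_left assms)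
  then have "(p - q) \<bullet> (p - q) = 0" by (simp add: inner_diff_left inner_commute)
  then show ?thesis by simp
qed

section \<open>Chain rules for sections, the projection and smooth maps\<close>

lemma dif_compose_section:
  assumes Y: "smooth_vf A Y" and x: "x \<in> points A" and F: "has_dif (tangent_atlas A) F (x, Y x) D"
  shows "dif A (\<lambda>y. F (y, Y y)) x u = D (tangent_map A (tangent_atlas A) (\<lambda>y. (y, Y y)) x u)"
proof -
  have v: "(x, Y x) \<in> points (tangent_atlas A)" using x by (simp add: points_tangent)
  obtain d where d: "d \<in> A" "x \<in> fst d" "chart_at (tangent_atlas A) (x, Y x) = tangent_chart A d"
    using chart_at_tangent[OF v] by auto
  define c where "c = chart_at A x"
  have c: "c \<in> A" "x \<in> fst c" using x by (simp_all add: c_def chart_at)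
  define U where "U = snd c ` (fst c \<inter> fst d)"
  have U: "open U" "snd c x \<in> U" using c d open_overlap by (auto simp: U_def)
  have \<tau>: "((snd d \<circ> chart_inv c) has_derivative coord_change c d x) (at (snd c x))"
    by (intro coord_change_has_derivative c d)
  have "(vf_in A d Y has_derivative frechet_derivative (vf_in A d Y) (at (snd d x))) (at ((snd d \<circ> chart_inv c) (snd c x)))"
    using vf_in_has_derivative[OF Y d(1) chart_in_range[OF d(2)]] by (simp add: chart_inv_chart c)
  from has_derivative_Pair[OF \<tau> has_derivative_compose[OF \<tau> this]]
  obtain D' where "((\<lambda>z. ((snd d \<circ> chart_inv c) z, vf_in A d Y ((snd d \<circ> chart_inv c) z))) has_derivative D') (at (snd c x))"
    by blast
  then have "((\<lambda>z. snd (chart_at (tangent_atlas A) (x, Y x)) (chart_inv c z, Y (chart_inv c z))) has_derivative D') (at (snd c x))"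
    by (rule has_derivative_transform_within_open[OF _ U])
      (auto simp: U_def d snd_tangent_chart chart_inv_chart c vf_in_chart)
  then have T: "has_tangent_map A (tangent_atlas A) (\<lambda>y. (y, Y y)) x (tangent_map A (tangent_atlas A) (\<lambda>y. (y, Y y)) x)"
    unfolding c_def by (intro has_tangent_mapI) (auto simp: differentiable_def)
  have "has_dif A (\<lambda>y. F (y, Y y)) x (D o\<^sub>L tangent_map A (tangent_atlas A) (\<lambda>y. (y, Y y)) x)"
  proof (rule has_dif_compose[OF T F _ U[unfolded c_def]])
    show "chart_inv (chart_at A x) (snd (chart_at A x) x) = x" by (simp add: chart_inv_chart chart_at x)
    fix z assume "z \<in> U"
    then obtain y where y: "z = snd c y" "y \<in> fst c" "y \<in> fst d" by (auto simp: U_def)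
    then show "chart_inv (chart_at (tangent_atlas A) (x, Y x)) (snd (chart_at (tangent_atlas A) (x, Y x))
        (chart_inv (chart_at A x) z, Y (chart_inv (chart_at A x) z))) = (chart_inv (chart_at A x) z, Y (chart_inv (chart_at A x) z))"
      using points_I[OF d(1) y(3)] unfolding c_def[symmetric] d(3)
      by (simp add: chart_inv_chart c snd_tangent_chart chart_inv_tangent_chart d chart_in_range coord_change_inverse chart_at)
  qed
  from dif_eqI[OF this] show ?thesis by simp
qed

lemma dif_tangent_map_fst:
  assumes x: "x \<in> points A" and f: "smooth_function A f"
  shows "dif A f x (tangent_map (tangent_atlas A) A fst (x, w) p) = dif (tangent_atlas A) (f \<circ> fst) (x, w) p"
proof -
  have v: "(x, w) \<in> points (tangent_atlas A)" using x by (simp add: points_tangent)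
  obtain d where d: "d \<in> A" "x \<in> fst d" "chart_at (tangent_atlas A) (x, w) = tangent_chart A d"
    using chart_at_tangent[OF v] by auto
  define c where "c = chart_at A x"
  have c: "c \<in> A" "x \<in> fst c" using x by (simp_all add: c_def chart_at)
  define U where "U = snd d ` (fst d \<inter> fst c) \<times> (UNIV :: 'e set)"
  have U: "open U" "snd (chart_at (tangent_atlas A) (x, w)) (x, w) \<in> U"
    using c d open_overlap by (auto simp: U_def open_Times snd_tangent_chart)
  have "((\<lambda>q. (snd c \<circ> chart_inv d) (fst q)) has_derivative (\<lambda>q. coord_change d c x (fst q)))
      (at (snd (chart_at (tangent_atlas A) (x, w)) (x, w)))"
    using coord_change_has_derivative[OF d(1) c(1) d(2) c(2)]
    by (intro has_derivative_compose_fst) (simp add: d snd_tangent_chart comp_def)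
  then have "((\<lambda>q. snd c (fst (chart_inv (chart_at (tangent_atlas A) (x, w)) q))) has_derivative (\<lambda>q. coord_change d c x (fst q)))
      (at (snd (chart_at (tangent_atlas A) (x, w)) (x, w)))"
    by (rule has_derivative_transform_within_open[OF _ U])
      (auto simp: U_def d chart_inv_tangent_chart chart_in_range)
  then have T: "has_tangent_map (tangent_atlas A) A fst (x, w) (tangent_map (tangent_atlas A) A fst (x, w))"
    unfolding c_def by (intro has_tangent_mapI) (auto simp: differentiable_def)
  have "has_dif A f (fst (x, w)) (dif A f x)" using smooth_function_has_dif[OF f x] by simp
  then have "has_dif (tangent_atlas A) (\<lambda>y. f (fst y)) (x, w) (dif A f x o\<^sub>L tangent_map (tangent_atlas A) A fst (x, w))"
  proof (rule has_dif_compose[OF T _ chart_inv_chart_at_tangent[OF v] U])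
    fix z assume "z \<in> U"
    then obtain y \<omega> where y: "z = (snd d y, \<omega>)" "y \<in> fst c" "y \<in> fst d" by (auto simp: U_def)
    then show "chart_inv (chart_at A (fst (x, w))) (snd (chart_at A (fst (x, w)))
       (fst (chart_inv (chart_at (tangent_atlas A) (x, w)) z))) = fst (chart_inv (chart_at (tangent_atlas A) (x, w)) z)"
      by (simp add: d chart_inv_tangent_chart chart_in_range chart_inv_chart c_def[symmetric] c)
  qed
  from dif_eqI[OF this] show ?thesis by (simp add: comp_def)
qed

lemma dif_compose_smooth_map:
  assumes \<pi>: "smooth_map (tangent_atlas A) A \<pi>" and v: "v \<in> points (tangent_atlas A)"
    and f: "smooth_function A f"
  shows "\<pi> v \<in> points A" "dif (tangent_atlas A) (f \<circ> \<pi>) v = dif A f (\<pi> v) o\<^sub>L tangent_map (tangent_atlas A) A \<pi> v"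
proof -
  have cont: "continuous_map (atlas_topology (tangent_atlas A)) (atlas_topology A) \<pi>"
    using \<pi> by (simp add: smooth_map_def)
  have top: "topspace (atlas_topology (tangent_atlas A)) = points (tangent_atlas A)"
    by (rule topspace_atlas_topology[OF smooth_atlas_tangent])
  show \<pi>v: "\<pi> v \<in> points A"
    using cont v by (auto simp: continuous_map_def top topspace_atlas)
  define d where "d = chart_at A (\<pi> v)"
  have d: "d \<in> A" "\<pi> v \<in> fst d" using \<pi>v by (simp_all add: d_def chart_at)
  define C where "C = chart_at (tangent_atlas A) v"
  obtain c where c: "c \<in> A" "fst v \<in> fst c" "C = tangent_chart A c"
    using chart_at_tangent[OF v] C_def by auto
  have C: "C \<in> tangent_atlas A" "v \<in> fst C"
    using c by (cases v; simp add: tangent_atlas_def fst_tangent_chart)+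
  define U where "U = snd C ` (fst C \<inter> \<pi> -` fst d)"
  \<comment> \<open>Continuity of \<open>\<pi>\<close> makes the domain of its coordinate expression
    open, so smoothness on it gives a derivative at \<open>v\<close>.\<close>
  have "openin (atlas_topology (tangent_atlas A)) {p \<in> points (tangent_atlas A). \<pi> p \<in> fst d}"
    using cont openin_chart[OF d(1)] by (auto simp: continuous_map_def top)
  then have "open (snd C ` ({p \<in> points (tangent_atlas A). \<pi> p \<in> fst d} \<inter> fst C))"
    using C(1) by (simp add: openin_atlas_topology[OF smooth_atlas_tangent])
  moreover have "{p \<in> points (tangent_atlas A). \<pi> p \<in> fst d} \<inter> fst C = fst C \<inter> \<pi> -` fst d"
    using C(1) unfolding points_def by blast
  ultimately have U: "open U" "snd C v \<in> U" using C d by (auto simp: U_def)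
  have inj: "chart_inv C (snd C p) = p" if "p \<in> fst C" for p
    using tangent_chart_inj[OF c(1)] that by (simp add: chart_inv_def c(3))
  have "smooth_on U (snd d \<circ> \<pi> \<circ> chart_inv C)"
    using \<pi> C(1) d(1) unfolding U_def smooth_map_def by blast
  from smooth_on_differentiable[OF this U(2)]
  have T: "has_tangent_map (tangent_atlas A) A \<pi> v (tangent_map (tangent_atlas A) A \<pi> v)"
    unfolding C_def d_def by (intro has_tangent_mapI) (simp add: comp_def)
  have "has_dif (tangent_atlas A) (\<lambda>p. f (\<pi> p)) v (dif A f (\<pi> v) o\<^sub>L tangent_map (tangent_atlas A) A \<pi> v)"
  proof (rule has_dif_compose[OF T smooth_function_has_dif[OF f \<pi>v] chart_inv_chart_at_tangent[OF v] U[unfolded C_def]])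
    fix z assume "z \<in> U"
    then show "chart_inv (chart_at A (\<pi> v)) (snd (chart_at A (\<pi> v)) (\<pi> (chart_inv (chart_at (tangent_atlas A) v) z))) =
        \<pi> (chart_inv (chart_at (tangent_atlas A) v) z)"
      unfolding C_def[symmetric] d_def[symmetric] U_def by (auto simp: inj chart_inv_chart d(1))
  qed
  from dif_eqI[OF this]
  show "dif (tangent_atlas A) (f \<circ> \<pi>) v = dif A f (\<pi> v) o\<^sub>L tangent_map (tangent_atlas A) A \<pi> v"
    by (simp add: comp_def)
qed

end

context manifold_with_connection
begin

section \<open>The bracket of pull-backs\<close>

lemma tangent_vector_eqI:
  assumes "x \<in> points A" "\<And>f. smooth_function A f \<Longrightarrow> dif A f x p = dif A f x q"
  shows "p = q"
proof -
  obtain f where f: "smooth_function A f" "dif A f x = blinfun_inner_left (p - q)"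
    using smooth_function_with_dif[OF assms(1)] by metis
  then have "(p - q) \<bullet> (p - q) = 0"
    using assms(2)[OF f(1)] by (simp add: inner_diff_left inner_commute)
  then show ?thesis by simp
qed

text \<open>Fixing one extension \<open>Y\<close> of \<open>w\<close>, the Leibniz rule expresses
  the value by two terms that are visibly linear in \<open>u\<close>.\<close>

lemma nabla_form_linear:
  assumes "x \<in> points A" "smooth_form A \<alpha>"
  shows "linear (\<lambda>u. nabla_form A nabla \<alpha> x u w)"
proof -
  obtain Y where Y: "smooth_vf A Y" "Y x = w" by (rule smooth_vf_through[OF assms(1)])
  have "nabla_form A nabla \<alpha> x u w = dif A (\<lambda>y. \<alpha> y (Y y)) x u - \<alpha> x (nabla Y x u)" for u
    using nabla_form_apply[OF assms Y(1), of u] Y(2) by simp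
  then show ?thesis
    by (simp add: linear_iff blinfun.add_right blinfun.scaleR_right right_diff_distrib)
qed

text \<open>Along the section \<open>Y\<close> the fibrewise linear function becomes the pairing
  \<alpha>(Y), whose derivative loses the term \<alpha>(\<nabla>Y) by parallelism at
  \<open>x\<close>. The results depend on \<open>Y\<close> only through its value
  \<open>w\<close>.\<close>

lemma dif_parallel_section:
  assumes x: "x \<in> points A" and Y: "smooth_vf A Y" "Y x = w" "nabla Y x u = 0"
    and p: "p = tangent_map A (tangent_atlas A) (\<lambda>y. (y, Y y)) x u"
  shows "smooth_function A f \<Longrightarrow> dif (tangent_atlas A) (f \<circ> fst) (x, w) p = dif A f x u"
    and "smooth_form A \<alpha> \<Longrightarrow> dif (tangent_atlas A) (fibre_linear \<alpha>) (x, w) p = nabla_form A nabla \<alpha> x u w"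
    and "tangent_map (tangent_atlas A) A fst (x, w) p = u"
proof -
  obtain d where d: "d \<in> A" "x \<in> fst d" "chart_at (tangent_atlas A) (x, w) = tangent_chart A d"
    using chart_at_tangent[of "(x, w)"] x by (auto simp: points_tangent)
  show f: "dif (tangent_atlas A) (f \<circ> fst) (x, w) p = dif A f x u" if "smooth_function A f" for f
    using dif_compose_section[OF Y(1) x, of "f \<circ> fst"] has_dif_fst[OF d that] unfolding Y(2) p by simp
  show "dif (tangent_atlas A) (fibre_linear \<alpha>) (x, w) p = nabla_form A nabla \<alpha> x u w" if "smooth_form A \<alpha>"
    using dif_compose_section[OF Y(1) x, of "fibre_linear \<alpha>"] has_dif_fibre_linear[OF d that]
      nabla_form_apply[OF x that Y(1), of u] Y(3) unfolding Y(2) p by (simp add: fibre_linear_def)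
  show "tangent_map (tangent_atlas A) A fst (x, w) p = u"
    by (rule tangent_vector_eqI[OF x]) (simp add: dif_tangent_map_fst x f)
qed

text \<open>Any two parallel extensions of \<open>w\<close> give tangent vectors with the same
  differentials, hence the same vector; this makes \<open>THE\<close> in
  \<open>horizontal_lift\<close> well defined.\<close>

lemma dif_horizontal_lift:
  assumes x: "x \<in> points A"
  shows "smooth_function A f \<Longrightarrow>
      dif (tangent_atlas A) (f \<circ> fst) (x, w) (horizontal_lift A nabla (x, w) u) = dif A f x u"
    and "smooth_form A \<alpha> \<Longrightarrow>
      dif (tangent_atlas A) (fibre_linear \<alpha>) (x, w) (horizontal_lift A nabla (x, w) u) = nabla_form A nabla \<alpha> x u w"
proof -
  obtain Y where Y: "smooth_vf A Y" "Y x = w" "nabla Y x u = 0" by (rule parallel_vf_exists[OF x])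
  define p where "p = tangent_map A (tangent_atlas A) (\<lambda>y. (y, Y y)) x u"
  note pY = dif_parallel_section[OF x Y p_def]
  have "horizontal_lift A nabla (x, w) u = p"
    unfolding horizontal_lift_def
  proof (rule the_equality)
    show "p \<in> horizontal_space A nabla (x, w) \<and> tangent_map (tangent_atlas A) A fst (x, w) p = u"
      using Y pY(3) unfolding horizontal_space_def p_def by auto
    fix q assume "q \<in> horizontal_space A nabla (x, w) \<and> tangent_map (tangent_atlas A) A fst (x, w) q = u"
    then obtain Z u' where Z: "smooth_vf A Z" "Z x = w" "nabla Z x u' = 0"
      and q: "q = tangent_map A (tangent_atlas A) (\<lambda>y. (y, Z y)) x u'"
      and u': "tangent_map (tangent_atlas A) A fst (x, w) q = u"
      unfolding horizontal_space_def by auto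
    note qZ = dif_parallel_section[OF x Z q]
    \<comment> \<open>An element of the horizontal space may come with its own direction; projecting
      to \<open>P\<close> recovers it.\<close>
    have "u' = u" using u' qZ(3) by simp
    then show "q = p"
      using x by (intro tangent_vector_TP_eqI[of x w]) (simp_all add: points_tangent smooth_form_dif pY qZ)
  qed
  then show "smooth_function A f \<Longrightarrow>
      dif (tangent_atlas A) (f \<circ> fst) (x, w) (horizontal_lift A nabla (x, w) u) = dif A f x u"
    and "smooth_form A \<alpha> \<Longrightarrow>
      dif (tangent_atlas A) (fibre_linear \<alpha>) (x, w) (horizontal_lift A nabla (x, w) u) = nabla_form A nabla \<alpha> x u w"
    using pY by simp_all
qed

text \<open>Lifts of different \<open>u\<close> come from unrelated sections, so linearity is read
  off from the values of all differentials.\<close>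

lemma horizontal_lift_linear:
  assumes x: "x \<in> points A"
  shows "linear (horizontal_lift A nabla (x, w))"
proof (rule linearI)
  have v: "(x, w) \<in> points (tangent_atlas A)" using x by (simp add: points_tangent)
  fix u u' and r :: real
  show "horizontal_lift A nabla (x, w) (u + u') = horizontal_lift A nabla (x, w) u + horizontal_lift A nabla (x, w) u'"
    by (rule tangent_vector_TP_eqI[OF v])
      (simp_all add: dif_horizontal_lift x smooth_form_dif blinfun.add_right linear_add[OF nabla_form_linear])
  show "horizontal_lift A nabla (x, w) (r *\<^sub>R u) = r *\<^sub>R horizontal_lift A nabla (x, w) u"
    by (rule tangent_vector_TP_eqI[OF v])
      (simp_all add: dif_horizontal_lift x smooth_form_dif blinfun.scaleR_right linear_cmul[OF nabla_form_linear])
qed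

lemma dif_vertical_lift:
  assumes x: "x \<in> points A"
  shows "smooth_function A f \<Longrightarrow> dif (tangent_atlas A) (f \<circ> fst) (x, w) (vertical_lift A (x, w) u) = 0"
    and "smooth_form A \<alpha> \<Longrightarrow> dif (tangent_atlas A) (fibre_linear \<alpha>) (x, w) (vertical_lift A (x, w) u) = \<alpha> x u"
    and vertical_lift_linear: "linear (vertical_lift A (x, w))"
proof -
  obtain d where d: "d \<in> A" "x \<in> fst d" "chart_at (tangent_atlas A) (x, w) = tangent_chart A d"
    using chart_at_tangent[of "(x, w)"] x by (auto simp: points_tangent)
  note V = vertical_lift_chart[OF d]
  show "smooth_function A f \<Longrightarrow> dif (tangent_atlas A) (f \<circ> fst) (x, w) (vertical_lift A (x, w) u) = 0"
    by (simp add: V dif_fst[OF d])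
  show "smooth_form A \<alpha> \<Longrightarrow> dif (tangent_atlas A) (fibre_linear \<alpha>) (x, w) (vertical_lift A (x, w) u) = \<alpha> x u"
    by (simp add: V dif_fibre_linear_vertical[OF d] coord_change_inverse chart_at x d)
  show "linear (vertical_lift A (x, w))"
    by (rule linearI) (simp_all add: V blinfun.add_right blinfun.scaleR_right)
qed

text \<open>\<open>Blinfun\<close> gives the intended operator only for a bounded linear argument;
  in finite dimension linearity suffices.\<close>

lemma Blinfun_compose_linear:
  assumes "linear (F :: 'e \<Rightarrow> 'b::real_normed_vector)"
  shows "Blinfun (\<lambda>u. blinfun_apply L (F u)) u = L (F u)"
proof -
  have "linear (\<lambda>u. blinfun_apply L (F u))"
    by (rule linearI) (simp_all add: linear_add[OF assms] linear_cmul[OF assms] blinfun.add_right blinfun.scaleR_right)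
  then show ?thesis by (simp add: bounded_linear_Blinfun_apply linear_bounded)
qed

lemma partial1_apply:
  assumes "x \<in> points A"
  shows "partial1 A \<pi> (x, w) u = tangent_map (tangent_atlas A) A \<pi> (x, w) (vertical_lift A (x, w) u)"
  unfolding partial1_def
  by (rule Blinfun_compose_linear[OF vertical_lift_linear[OF assms]])

lemma partial2_apply:
  assumes "x \<in> points A"
  shows "partial2 A nabla \<pi> (x, w) u = tangent_map (tangent_atlas A) A \<pi> (x, w) (horizontal_lift A nabla (x, w) u)"
  unfolding partial2_def
  by (rule Blinfun_compose_linear[OF horizontal_lift_linear[OF assms]])

lemma pullback_covector:
  assumes tf: "torsion_free A nabla" and \<pi>: "smooth_map (tangent_atlas A) A \<pi>"
    and x: "x \<in> points A" and f: "smooth_function A f"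
  obtains k h where "smooth_function A k" "smooth_function A h"
    "dif (tangent_atlas A) (f \<circ> \<pi>) (x, w) =
      dif (tangent_atlas A) (fibre_linear (dif A k)) (x, w) + dif (tangent_atlas A) (h \<circ> fst) (x, w)"
    "dif A f (\<pi> (x, w)) o\<^sub>L partial1 A \<pi> (x, w) = dif A k x"
    "dif A f (\<pi> (x, w)) o\<^sub>L partial2 A nabla \<pi> (x, w) = nabla_form A nabla (dif A k) x w + dif A h x"
proof -
  have v: "(x, w) \<in> points (tangent_atlas A)" using x by (simp add: points_tangent)
  obtain k h where k: "smooth_function A k" and h: "smooth_function A h" and
    eq: "dif (tangent_atlas A) (f \<circ> \<pi>) (x, w) =
      dif (tangent_atlas A) (fibre_linear (dif A k)) (x, w) + dif (tangent_atlas A) (h \<circ> fst) (x, w)"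
    by (rule covector_TP_expand[OF v])
  note dk = smooth_form_dif[OF k]
  have \<xi>: "dif A f (\<pi> (x, w)) (tangent_map (tangent_atlas A) A \<pi> (x, w) p) =
      dif (tangent_atlas A) (fibre_linear (dif A k)) (x, w) p + dif (tangent_atlas A) (h \<circ> fst) (x, w) p" for p
    using dif_compose_smooth_map(2)[OF \<pi> v f] unfolding eq by (metis blinfun_apply_blinfun_compose plus_blinfun.rep_eq)
  have "dif A f (\<pi> (x, w)) o\<^sub>L partial1 A \<pi> (x, w) = dif A k x"
    by (rule blinfun_eqI) (simp add: partial1_apply x \<xi> dif_vertical_lift dk h)
  moreover have "dif A f (\<pi> (x, w)) o\<^sub>L partial2 A nabla \<pi> (x, w) = nabla_form A nabla (dif A k) x w + dif A h x"
    by (rule blinfun_eqI)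
      (simp add: partial2_apply x \<xi> dif_horizontal_lift dk h blinfun.add_left
        nabla_closed_form_symmetric[OF tf closed_form_dif[OF k] x, of w])
  ultimately show thesis using k h eq that by blast
qed

text \<open>Bilinearity of \<open>\<Lambda>\<close> produces four terms. Two exact forms give
  D\<eta> plus \<eta> terms in \<nabla>dk and \<nabla>dk'; the mixed terms add dh and dh' and
  complete these to \<open>a o\<^sub>L Q\<close> and \<open>b o\<^sub>L Q\<close>; two pull-backs
  from \<open>P\<close> give 0.\<close>

lemma bracket_pullback:
  assumes tf: "torsion_free A nabla" and \<eta>: "poisson_bivector A \<eta>" and \<Lambda>: "dual_poisson_structure A \<eta> \<Lambda>"
    and \<pi>: "smooth_map (tangent_atlas A) A \<pi>" and f: "smooth_function A f" and g: "smooth_function A g"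
    and v: "v \<in> points (tangent_atlas A)"
  defines "a \<equiv> dif A f (\<pi> v)" and "b \<equiv> dif A g (\<pi> v)"
    and "P \<equiv> partial1 A \<pi> v" and "Q \<equiv> partial2 A nabla \<pi> v"
  shows "bracket (tangent_atlas A) \<Lambda> (f \<circ> \<pi>) (g \<circ> \<pi>) v =
    D_eta A nabla \<eta> v (a o\<^sub>L P) (b o\<^sub>L P) + \<eta> (fst v) (a o\<^sub>L P) (b o\<^sub>L Q) + \<eta> (fst v) (a o\<^sub>L Q) (b o\<^sub>L P)"
proof -
  obtain x w where vw: "v = (x, w)" by (cases v)
  have x: "x \<in> points A" using v by (simp add: vw points_tangent)
  obtain k h where k: "smooth_function A k" and h: "smooth_function A h" and
    \<xi>: "dif (tangent_atlas A) (f \<circ> \<pi>) v =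
      dif (tangent_atlas A) (fibre_linear (dif A k)) v + dif (tangent_atlas A) (h \<circ> fst) v"
    "a o\<^sub>L P = dif A k x" "a o\<^sub>L Q = nabla_form A nabla (dif A k) x w + dif A h x"
    unfolding a_def P_def Q_def vw by (rule pullback_covector[OF tf \<pi> x f])
  obtain k' h' where k': "smooth_function A k'" and h': "smooth_function A h'" and
    \<xi>': "dif (tangent_atlas A) (g \<circ> \<pi>) v =
      dif (tangent_atlas A) (fibre_linear (dif A k')) v + dif (tangent_atlas A) (h' \<circ> fst) v"
    "b o\<^sub>L P = dif A k' x" "b o\<^sub>L Q = nabla_form A nabla (dif A k') x w + dif A h' x"
    unfolding b_def P_def Q_def vw by (rule pullback_covector[OF tf \<pi> x g])
  have skew: "\<eta> x \<alpha> \<beta> = - \<eta> x \<beta> \<alpha>" "\<Lambda> v \<xi> \<xi>' = - \<Lambda> v \<xi>' \<xi>" for \<alpha> \<beta> \<xi> \<xi>'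
    using \<eta> \<Lambda> x v unfolding dual_poisson_structure_def poisson_bivector_def by blast+
  have 1: "\<Lambda> v (dif (tangent_atlas A) (fibre_linear (dif A k)) v) (dif (tangent_atlas A) (fibre_linear (dif A k')) v) =
      D_eta A nabla \<eta> v (dif A k x) (dif A k' x) +
      \<eta> x (nabla_form A nabla (dif A k) x w) (dif A k' x) + \<eta> x (dif A k x) (nabla_form A nabla (dif A k') x w)"
  proof -
    have "bracket (tangent_atlas A) \<Lambda> (fibre_linear (dif A k)) (fibre_linear (dif A k')) v =
        fibre_linear (form_bracket A \<eta> (dif A k) (dif A k')) v"
      using \<Lambda> v closed_form_dif[OF k] closed_form_dif[OF k'] unfolding dual_poisson_structure_def by blast
    moreover have "smooth_tensor A \<eta>" using \<eta> by (simp add: poisson_bivector_def)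
    ultimately show ?thesis
      unfolding D_eta_def
      by (simp add: bracket_def fibre_linear_def form_bracket_def vw nabla_tensor_apply x smooth_form_dif k k')
  qed
  have 2: "\<Lambda> v (dif (tangent_atlas A) (fibre_linear (dif A k)) v) (dif (tangent_atlas A) (h \<circ> fst) v) =
      \<eta> x (dif A k x) (dif A h x)" if k: "smooth_function A k" and h: "smooth_function A h" for k h
  proof -
    have "bracket (tangent_atlas A) \<Lambda> (fibre_linear (dif A k)) (h \<circ> fst) v =
        dif A h (fst v) (anchor (\<eta> (fst v)) (dif A k (fst v)))"
      using \<Lambda> v closed_form_dif[OF k] h unfolding dual_poisson_structure_def by blast
    then show ?thesis by (simp add: bracket_def vw anchor_apply)
  qed
  have "bracket (tangent_atlas A) \<Lambda> (h \<circ> fst) (h' \<circ> fst) v = 0"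
    using \<Lambda> v h h' unfolding dual_poisson_structure_def by blast
  then have 3: "\<Lambda> v (dif (tangent_atlas A) (h \<circ> fst) v) (dif (tangent_atlas A) (h' \<circ> fst) v) = 0"
    by (simp add: bracket_def)
  \<comment> \<open>The structure prescribes only the other order of arguments; skewness of both
    \<open>\<Lambda>\<close> and \<eta> is used, and the two signs cancel.\<close>
  have 4: "\<Lambda> v (dif (tangent_atlas A) (h \<circ> fst) v) (dif (tangent_atlas A) (fibre_linear (dif A k')) v) =
      \<eta> x (dif A h x) (dif A k' x)"
    using skew(2)[of "dif (tangent_atlas A) (h \<circ> fst) v"] 2[OF k' h] skew(1)[of "dif A h x" "dif A k' x"] by simp
  have fst_v: "fst v = x" by (simp add: vw)
  show ?thesis
    unfolding bracket_def \<xi> \<xi>' fst_v blinfun.add_left blinfun.add_right 1 2[OF k h'] 3 4 by simp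
qed

end

theorem corollary5p2:
  fixes A :: "('p, 'e::real_inner) chart set"
    and \<eta> :: "'p \<Rightarrow> 'e tensor2"
    and nabla :: "('p \<Rightarrow> 'e) \<Rightarrow> 'p \<Rightarrow> 'e \<Rightarrow>\<^sub>L 'e"
    and \<Lambda> :: "'p \<times> 'e \<Rightarrow> ('e \<times> 'e) tensor2"
    and \<pi> :: "'p \<times> 'e \<Rightarrow> 'p"
  assumes "smooth_manifold A"
    and "poisson_bivector A \<eta>"
    and "connection A nabla" and "torsion_free A nabla"
    and "dual_poisson_structure A \<eta> \<Lambda>"
    and "smooth_map (tangent_atlas A) A \<pi>"
  shows
    "(\<forall>f g. smooth_function A f \<longrightarrow> smooth_function A g \<longrightarrow>
        (\<forall>v\<in>points (tangent_atlas A).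
           bracket (tangent_atlas A) \<Lambda> (f \<circ> \<pi>) (g \<circ> \<pi>) v =
           wedge_pairing
             (tensor_map (partial1 A \<pi> v) (partial1 A \<pi> v) (D_eta A nabla \<eta> v) +
              2 *\<^sub>R tensor_map (partial1 A \<pi> v) (partial2 A nabla \<pi> v) (\<eta> (fst v)))
             (dif A f (\<pi> v)) (dif A g (\<pi> v)))) \<and>
     (poisson_map (tangent_atlas A) \<Lambda> A \<eta> \<pi> \<longleftrightarrow>
        (\<forall>v\<in>points (tangent_atlas A).
           (1/2) *\<^sub>R sym_tensor_map (partial1 A \<pi> v) (partial1 A \<pi> v) (D_eta A nabla \<eta> v) +
           sym_tensor_map (partial1 A \<pi> v) (partial2 A nabla \<pi> v) (\<eta> (fst v)) =
           \<eta> (\<pi> v)))"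
proof -
  interpret manifold_with_connection A nabla
    using assms by unfold_locales
  let ?S = "\<lambda>v. (1/2) *\<^sub>R sym_tensor_map (partial1 A \<pi> v) (partial1 A \<pi> v) (D_eta A nabla \<eta> v) +
      sym_tensor_map (partial1 A \<pi> v) (partial2 A nabla \<pi> v) (\<eta> (fst v))"
  \<comment> \<open>Half of the symmetric product of the first partial derivative with itself is its
    tensor square, whence the coefficient 1/2.\<close>
  have S: "bracket (tangent_atlas A) \<Lambda> (f \<circ> \<pi>) (g \<circ> \<pi>) v = ?S v (dif A f (\<pi> v)) (dif A g (\<pi> v))"
    if "smooth_function A f" "smooth_function A g" "v \<in> points (tangent_atlas A)" for f g v
    using bracket_pullback[OF assms(4,2,5,6) that]
    by (simp add: sym_tensor_map_def tensor_map_apply blinfun.add_left blinfun.scaleR_left)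
  show ?thesis
  proof (intro conjI allI impI ballI)
    fix f g v assume f: "smooth_function A f" and g: "smooth_function A g" and v: "v \<in> points (tangent_atlas A)"
    have "fst v \<in> points A" using v by (simp add: points_tangent)
    then have skew: "\<eta> (fst v) \<alpha> \<beta> = - \<eta> (fst v) \<beta> \<alpha>" "\<Lambda> v \<xi> \<xi>' = - \<Lambda> v \<xi>' \<xi>" for \<alpha> \<beta> \<xi> \<xi>'
      using assms(2,5) v unfolding dual_poisson_structure_def poisson_bivector_def by blast+
    define P Q where "P = partial1 A \<pi> v" and "Q = partial2 A nabla \<pi> v"
    define a b where "a = dif A f (\<pi> v)" and "b = dif A g (\<pi> v)"
    \<comment> \<open>Antisymmetry is taken from \<open>\<Lambda>\<close>: half the difference with
      the swapped bracket antisymmetrises the D\<eta> term, and skewness of \<eta> merges the mixed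
      terms in pairs, which produces the factor 2.\<close>
    have "bracket (tangent_atlas A) \<Lambda> (f \<circ> \<pi>) (g \<circ> \<pi>) v =
      (bracket (tangent_atlas A) \<Lambda> (f \<circ> \<pi>) (g \<circ> \<pi>) v - bracket (tangent_atlas A) \<Lambda> (g \<circ> \<pi>) (f \<circ> \<pi>) v) / 2"
      unfolding bracket_def using skew(2)[of "dif (tangent_atlas A) (g \<circ> \<pi>) v"] by simp
    also have "\<dots> = wedge_pairing (tensor_map P P (D_eta A nabla \<eta> v) + 2 *\<^sub>R tensor_map P Q (\<eta> (fst v))) a b"
      unfolding bracket_pullback[OF assms(4,2,5,6) f g v] bracket_pullback[OF assms(4,2,5,6) g f v]
        P_def[symmetric] Q_def[symmetric] a_def[symmetric] b_def[symmetric]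
      using skew(1)[of "b o\<^sub>L P" "a o\<^sub>L Q"] skew(1)[of "b o\<^sub>L Q" "a o\<^sub>L P"]
      by (simp add: wedge_pairing_def tensor_map_apply blinfun.add_left blinfun.scaleR_left)
    finally show "bracket (tangent_atlas A) \<Lambda> (f \<circ> \<pi>) (g \<circ> \<pi>) v =
           wedge_pairing
             (tensor_map (partial1 A \<pi> v) (partial1 A \<pi> v) (D_eta A nabla \<eta> v) +
              2 *\<^sub>R tensor_map (partial1 A \<pi> v) (partial2 A nabla \<pi> v) (\<eta> (fst v)))
             (dif A f (\<pi> v)) (dif A g (\<pi> v))"
      unfolding P_def Q_def a_def b_def .
  next
    show "poisson_map (tangent_atlas A) \<Lambda> A \<eta> \<pi> \<longleftrightarrow> (\<forall>v\<in>points (tangent_atlas A). ?S v = \<eta> (\<pi> v))"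
    proof
      assume P: "poisson_map (tangent_atlas A) \<Lambda> A \<eta> \<pi>"
      show "\<forall>v\<in>points (tangent_atlas A). ?S v = \<eta> (\<pi> v)"
      proof (intro ballI blinfun_eqI)
        fix v a b assume v: "v \<in> points (tangent_atlas A)"
        \<comment> \<open>The constant function only fills the function slot of the chain rule; the
          point concerns \<open>\<pi>\<close> alone.\<close>
        have \<pi>v: "\<pi> v \<in> points A" by (rule dif_compose_smooth_map(1)[OF assms(6) v smooth_function_const])
        \<comment> \<open>Equality of brackets for all functions yields equality of tensors because
          \<open>a\<close> and \<open>b\<close> are differentials of global functions.\<close>
        obtain f where f: "smooth_function A f" "dif A f (\<pi> v) = a" using smooth_function_with_dif[OF \<pi>v] by metis
        obtain g where g: "smooth_function A g" "dif A g (\<pi> v) = b" using smooth_function_with_dif[OF \<pi>v] by metis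
        have "?S v (dif A f (\<pi> v)) (dif A g (\<pi> v)) = \<eta> (\<pi> v) (dif A f (\<pi> v)) (dif A g (\<pi> v))"
          using P f g v S[OF f(1) g(1) v] by (simp add: poisson_map_def bracket_def[of A])
        then show "?S v a b = \<eta> (\<pi> v) a b" by (simp only: f g)
      qed
    next
      assume "\<forall>v\<in>points (tangent_atlas A). ?S v = \<eta> (\<pi> v)"
      then show "poisson_map (tangent_atlas A) \<Lambda> A \<eta> \<pi>"
        by (auto simp: poisson_map_def S bracket_def[of A])
    qed
  qed
qed

end
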